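(* Let $k$ be an algebraically closed field of characteristic $0$ and let $X$ be a concatenation of nilpotent blocks, scroll blocks and Jordan blocks over $k$. Assume that $X$ satisfies the length condition $m\le 2n$, where $m$ is the maximal length of a nilpotent block and $n$ is the minimal length of a scroll block of $X$ (the condition is regarded as satisfied if there is no nilpotent block or no scroll block). Then the ring $R=k[X]/I_2(X)$ has a Koszul filtration.
   Context: Blocks are $2$-row matrices of the following types. (a) Nilpotent block of length $m\ge 1$ ($m$ columns): $\begin{pmatrix}0&x_1&x_2&\cdots&x_{m-2}&x_{m-1}\\ x_1&x_2&x_3&\cdots&x_{m-1}&0\end{pmatrix}$ (a zero column if $m=1$). (b) Scroll block of length $n\ge 1$ ($n$ columns): $\begin{pmatrix}y_1&y_2&\cdots&y_n\\ y_2&y_3&\cdots&y_{n+1}\end{pmatrix}$. (c) Jordan block of length $p\ge 1$ with eigenvalue $\lambda\in k$ ($p$ columns): $\begin{pmatrix}z_1&z_2&\cdots&z_{p-1}&z_p\\ z_2+\lambda z_1&z_3+\lambda z_2&\cdots&z_p+\lambda z_{p-1}&\lambda z_p\end{pmatrix}$. In a concatenation, the variables occurring in all the blocks together are pairwise distinct, $k[X]$ is the standard graded polynomial ring over $k$ in all these variables, and $I_2(X)$ is the ideal of $2\times 2$ minors of $X$. Koszul filtration: let $R$ be a standard graded $k$-algebra with graded maximal ideal $\mathfrak m$. A set $\mathcal F$ of ideals of $R$ is a Koszul filtration of $R$ if (1) every ideal in $\mathcal F$ is generated by linear forms; (2) $0$ and $\mathfrak m$ belong to $\mathcal F$; (3)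 for every $I\in\mathcal F$ with $I\ne 0$ there exist an ideal $J\in\mathcal F$ and a linear form $x\in R_1\setminus 0$ such that $I=J+(x)$ and $J:I\in\mathcal F$. *)

theory Defs
  imports
    "HOL-Library.Poly_Mapping"
    "HOL-Computational_Algebra.Polynomial"
    "HOL-Algebra.QuotRing"
begin

text \<open>
  A polynomial over \<open>'k\<close> in variables from \<open>'v\<close> is a finitely supported map from exponent
  vectors to coefficients; the product is the convolution of \<^theory>\<open>HOL-Library.Poly_Mapping\<close>.
\<close>

type_synonym ('v, 'k) mpoly = "('v \<Rightarrow>\<^sub>0 nat) \<Rightarrow>\<^sub>0 'k"

definition Var :: "'v \<Rightarrow> ('v, 'k::comm_ring_1) mpoly" where
  "Var v = Poly_Mapping.single (Poly_Mapping.single v 1) 1"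

definition Const :: "'k \<Rightarrow> ('v, 'k::comm_ring_1) mpoly" where
  "Const c = Poly_Mapping.single 0 c"

definition mpoly_vars :: "('v, 'k::comm_ring_1) mpoly \<Rightarrow> 'v set" where
  "mpoly_vars p = (\<Union>t\<in>Poly_Mapping.keys p. Poly_Mapping.keys t)"

definition mpoly_ring :: "'v set \<Rightarrow> ('v, 'k::comm_ring_1) mpoly ring" where
  "mpoly_ring V = \<lparr>carrier = {p. mpoly_vars p \<subseteq> V}, mult = (*), one = 1, zero = 0, add = (+)\<rparr>"

definition monom_degree :: "('v \<Rightarrow>\<^sub>0 nat) \<Rightarrow> nat" where
  "monom_degree t = (\<Sum>v\<in>Poly_Mapping.keys t. Poly_Mapping.lookup t v)"

definition mpoly_component :: "'v set \<Rightarrow> nat \<Rightarrow> ('v, 'k::comm_ring_1) mpoly set" where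
  "mpoly_component V d =
     {p \<in> carrier (mpoly_ring V). \<forall>t\<in>Poly_Mapping.keys p. monom_degree t = d}"

lemma mpoly_vars_add: "mpoly_vars (p + q) \<subseteq> mpoly_vars p \<union> mpoly_vars q"
  unfolding mpoly_vars_def using Poly_Mapping.keys_add[of p q] by auto

lemma mpoly_vars_mult: "mpoly_vars (p * q) \<subseteq> mpoly_vars p \<union> mpoly_vars q"
proof
  fix v assume "v \<in> mpoly_vars (p * q)"
  then obtain t where t: "t \<in> Poly_Mapping.keys (p * q)" "v \<in> Poly_Mapping.keys t"
    unfolding mpoly_vars_def by blast
  then obtain a b where "t = a + b" "a \<in> Poly_Mapping.keys p" "b \<in> Poly_Mapping.keys q"
    using Poly_Mapping.keys_mult[of p q] by blast
  then show "v \<in> mpoly_vars p \<union> mpoly_vars q"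
    using t(2) Poly_Mapping.keys_add[of a b] unfolding mpoly_vars_def by blast
qed

lemma mpoly_ring_cring: "cring (mpoly_ring V)"
proof (rule cringI)
  have "\<exists>q. mpoly_vars q \<subseteq> V \<and> q + p = 0" if "mpoly_vars p \<subseteq> V" for p :: "('a, 'b) mpoly"
    using that by (intro exI[of _ "- p"]) (simp add: mpoly_vars_def)
  moreover have "mpoly_vars (p + q) \<subseteq> V" if "mpoly_vars p \<subseteq> V" "mpoly_vars q \<subseteq> V"
    for p q :: "('a, 'b) mpoly"
    using that mpoly_vars_add[of p q] by blast
  moreover have "mpoly_vars (0 :: ('a, 'b) mpoly) \<subseteq> V"
    by (simp add: mpoly_vars_def)
  ultimately show "abelian_group (mpoly_ring V :: ('a, 'b) mpoly ring)"
    by (intro abelian_groupI) (simp_all add: mpoly_ring_def add_ac)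
  have "mpoly_vars (p * q) \<subseteq> V" if "mpoly_vars p \<subseteq> V" "mpoly_vars q \<subseteq> V"
    for p q :: "('a, 'b) mpoly"
    using that mpoly_vars_mult[of p q] by blast
  moreover have "mpoly_vars (1 :: ('a, 'b) mpoly) \<subseteq> V"
    by (simp add: mpoly_vars_def)
  ultimately show "comm_monoid (mpoly_ring V :: ('a, 'b) mpoly ring)"
    by (intro comm_monoidI) (simp_all add: mpoly_ring_def mult_ac)
qed (simp add: mpoly_ring_def distrib_right)

text \<open>A matrix with two rows is the list of its columns (upper entry, lower entry).\<close>

type_synonym 'a two_row_matrix = "('a \<times> 'a) list"

definition minors2 :: "'a::comm_ring_1 two_row_matrix \<Rightarrow> 'a set" where
  "minors2 X = {fst (X ! i) * snd (X ! j) - fst (X ! j) * snd (X ! i) | i j.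
     i < j \<and> j < length X}"

definition matrix_vars :: "('v, 'k::comm_ring_1) mpoly two_row_matrix \<Rightarrow> 'v set" where
  "matrix_vars X = (\<Union>(p, q)\<in>set X. mpoly_vars p \<union> mpoly_vars q)"

definition determinantal_ideal ::
    "('v, 'k::comm_ring_1) mpoly two_row_matrix \<Rightarrow> ('v, 'k) mpoly set" where
  "determinantal_ideal X = Idl\<^bsub>mpoly_ring (matrix_vars X)\<^esub> (minors2 X)"

definition determinantal_ring ::
    "('v, 'k::comm_ring_1) mpoly two_row_matrix \<Rightarrow> ('v, 'k) mpoly set ring" where
  "determinantal_ring X = mpoly_ring (matrix_vars X) Quot determinantal_ideal X"

definition determinantal_component ::
    "('v, 'k::comm_ring_1) mpoly two_row_matrix \<Rightarrow> nat \<Rightarrow> ('v, 'k) mpoly set set" where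
  "determinantal_component X d =
     (\<lambda>p. determinantal_ideal X +>\<^bsub>mpoly_ring (matrix_vars X)\<^esub> p) `
       mpoly_component (matrix_vars X) d"

datatype 'k block =
    Nilpotent (block_length: nat)
  | Scroll (block_length: nat)
  | Jordan (block_length: nat) (eigenvalue: 'k)

text \<open>
  The variables of the \<open>i\<close>-th block of a concatenation are \<open>(i, 1), (i, 2), \<dots>\<close>, so distinct
  blocks never share a variable. The boundary conventions are \<open>x\<^sub>0 = x\<^sub>m = 0\<close> for a nilpotent
  block of length \<open>m\<close> and \<open>z\<^sub>p\<^sub>+\<^sub>1 = 0\<close> for a Jordan block of length \<open>p\<close>.
\<close>

fun block_matrix :: "nat \<Rightarrow> 'k::comm_ring_1 block \<Rightarrow> (nat \<times> nat, 'k) mpoly two_row_matrix" where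
  "block_matrix i (Nilpotent m) =
     (let x = (\<lambda>j. if 1 \<le> j \<and> j < m then Var (i, j) else 0)
      in map (\<lambda>j. (x (j - 1), x j)) [1..<Suc m])"
| "block_matrix i (Scroll n) = map (\<lambda>j. (Var (i, j), Var (i, j + 1))) [1..<Suc n]"
| "block_matrix i (Jordan p c) =
     (let z = (\<lambda>j. if 1 \<le> j \<and> j \<le> p then Var (i, j) else 0)
      in map (\<lambda>j. (z j, z (j + 1) + Const c * z j)) [1..<Suc p])"

definition concatenation ::
    "'k::comm_ring_1 block list \<Rightarrow> (nat \<times> nat, 'k) mpoly two_row_matrix" where
  "concatenation bs = concat (map (\<lambda>i. block_matrix i (bs ! i)) [0..<length bs])"

definition length_condition :: "'k block list \<Rightarrow> bool" where
  "length_condition bs \<longleftrightarrow>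
     (let N = {m. Nilpotent m \<in> set bs}; S = {n. Scroll n \<in> set bs}
      in N = {} \<or> S = {} \<or> Max N \<le> 2 * Min S)"

definition colon_ideal :: "('a, 'b) ring_scheme \<Rightarrow> 'a set \<Rightarrow> 'a set \<Rightarrow> 'a set" where
  "colon_ideal R J I = {r \<in> carrier R. \<forall>a\<in>I. r \<otimes>\<^bsub>R\<^esub> a \<in> J}"

definition graded_maximal_ideal :: "('a, 'b) ring_scheme \<Rightarrow> (nat \<Rightarrow> 'a set) \<Rightarrow> 'a set" where
  "graded_maximal_ideal R G = Idl\<^bsub>R\<^esub> (\<Union>d\<in>{1..}. G d)"

text \<open>
  Here \<open>R\<close> is meant to be a standard graded algebra with homogeneous components \<open>G d\<close>;
  in particular, \<open>G 1\<close> is its space of linear forms.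
\<close>

definition koszul_filtration ::
    "('a, 'b) ring_scheme \<Rightarrow> (nat \<Rightarrow> 'a set) \<Rightarrow> 'a set set \<Rightarrow> bool" where
  "koszul_filtration R G F \<longleftrightarrow>
     (\<forall>I\<in>F. ideal I R \<and> (\<exists>L\<subseteq>G 1. I = Idl\<^bsub>R\<^esub> L)) \<and>
     {\<zero>\<^bsub>R\<^esub>} \<in> F \<and>
     graded_maximal_ideal R G \<in> F \<and>
     (\<forall>I\<in>F. I \<noteq> {\<zero>\<^bsub>R\<^esub>} \<longrightarrow>
        (\<exists>J\<in>F. \<exists>x\<in>G 1 - {\<zero>\<^bsub>R\<^esub>}.
           I = J <+>\<^bsub>R\<^esub> (PIdl\<^bsub>R\<^esub> x) \<and> colon_ideal R J I \<in> F))"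

end

theory Submission
  imports Defs "HOL-Library.Product_Lexorder"
begin

text \<open>
  In a scroll block put \<open>y\<^sub>b\<^sub>+\<^sub>1 = Y t\<^sup>b\<close>, in a Jordan block \<open>z\<^sub>b\<^sub>+\<^sub>1 = Z u\<^sup>b\<close> with \<open>u = t - \<lambda>\<close> and \<open>u\<^sup>p = 0\<close>,
  and in a nilpotent block \<open>x\<^sub>a = X t\<^sup>a\<close>, where the two ends \<open>X t\<^sup>0\<close> and \<open>X t\<^sup>m\<close> are zero. The minors say
  that powers of \<open>t\<close>, hence of \<open>u\<close>, can be moved between factors. So products of nilpotent variables
  with nilpotent or Jordan variables vanish, as do products of Jordan variables for distinct
  eigenvalues, and a product of degree \<open>t\<^sup>c\<close> of a nilpotent and a scroll variable vanishes unless
  \<open>n < c < m\<close>. The filtration consists of the ideals generated, block by block, by the forms divisible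
  by a power of \<open>u\<close>; of ideals generated by nilpotent variables; and of ideals that contain all forms
  \<open>Y t\<^sup>b\<close> except those with \<open>b\<close> in a gap \<open>d \<le> b < g\<close>. The latter are the annihilators of the middle
  variables \<open>x\<^sub>a\<close>, \<open>a = \<lfloor>m / 2\<rfloor>\<close>, of the nilpotent blocks, and \<open>m \<le> 2 n\<close> is what makes them generated by
  linear forms. Each colon ideal is bounded from above by a homomorphism or functional which
  kills \<open>J\<close> and remembers the class of \<open>r\<close> in \<open>r x\<close>.
\<close>

section \<open>Polynomials, evaluation and ideals\<close>

text \<open>The annihilator of a nilpotent variable is the obstacle. For x_a it misses the forms Y
  t^b with n - a < b < m - a, so it is no profile ideal, and it must still contain every product of
  two scroll forms. Sliding powers of t brings such a product to an available generator provided
  that Y t^0 is annihilated and that Y t^(m-a) exists, that is, a \<le> n and m - a \<le> n. An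
  index with both properties exists exactly if m \<le> 2 n. Such a variable also controls its block:
  a nonzero product of another variable of the block with a scroll form can be rewritten with the
  factor x_a. So while x_a is in the ideal, the other variables of the block leave with the maximal
  ideal as colon, and x_a has to leave last. A second constraint comes from the points of the
  projective line. Scroll forms are expanded at a single point l, and a Jordan block with another
  eigenvalue has no power of u to exchange with them; it stays completely in the ideal until all
  scroll forms are gone. After that no form depends on l, and the point can be chosen anew for each
  Jordan block.\<close>

abbreviation lookup where "lookup \<equiv> Poly_Mapping.lookup"
abbreviation keys where "keys \<equiv> Poly_Mapping.keys"
abbreviation single where "single \<equiv> Poly_Mapping.single"
abbreviation Mon :: "('v \<Rightarrow>\<^sub>0 nat) \<Rightarrow> ('v, 'k::comm_ring_1) mpoly" where
  "Mon t \<equiv> single t 1"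

text \<open>With the ring acting on itself, subspaces are ideals, so the span lemmas become lemmas
  on ideals. These live in the polynomial ring over all variables of the type; variables outside
  \<open>V\<close> are handled by \<open>mpoly_restrict\<close>.\<close>

global_interpretation idl: Modules.module "(*) :: 'a::comm_ring_1 \<Rightarrow> 'a \<Rightarrow> 'a"
  defines ideal_span = idl.span
  by unfold_locales (auto simp: algebra_simps)

text \<open>As a simplification rule, \<^term>\<open>a * (b * x) = (a * b) * x\<close> loops with commutativity and associativity.\<close>

declare idl.scale_scale [simp del]

lemma Mon_add: "Mon (s + t) = Mon s * Mon t"
  by (simp add: mult_single)

lemma Const_mult_Mon: "Const c * Mon t = single t c"
  by (simp add: Const_def mult_single)

lemma Var_eq_Mon: "Var v = Mon (single v 1)"
  by (simp add: Var_def)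

lemma poly_mapping_expand: "p = (\<Sum>t\<in>keys p. single t (lookup p t))"
  by (rule poly_mapping_eqI) (auto simp: lookup_sum lookup_single when_def in_keys_iff)

lemma mpoly_expand: "p = (\<Sum>t\<in>keys p. Const (lookup p t) * Mon t)"
  unfolding Const_mult_Mon by (rule poly_mapping_expand)

lemma Const_simps [simp]:
  "Const 0 = 0" "Const 1 = 1" "Const (a + b) = Const a + Const b"
  "Const (a * b) = Const a * Const b" "Const (- a) = - Const a" "Const (a - b) = Const a - Const b"
  by (simp_all add: Const_def single_add mult_single single_uminus single_diff)

section \<open>Exponent vectors and total degree\<close>

lemma exp_split:
  fixes t :: "'v \<Rightarrow>\<^sub>0 nat"
  assumes "v \<in> keys t"
  shows "t = single v 1 + (t - single v 1)"
  using assms by (intro poly_mapping_eqI) (auto simp: lookup_add lookup_minus lookup_single in_keys_iff when_def)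

lemma monom_degree_superset:
  assumes "finite A" "keys t \<subseteq> A"
  shows "monom_degree t = (\<Sum>v\<in>A. lookup t v)"
  unfolding monom_degree_def using assms by (intro sum.mono_neutral_left) (auto simp: in_keys_iff)

lemma monom_degree_add [simp]: "monom_degree (s + t) = monom_degree s + monom_degree t"
proof -
  let ?A = "keys s \<union> keys t"
  have "monom_degree (s + t) = (\<Sum>v\<in>?A. lookup (s + t) v)"
    using Poly_Mapping.keys_add[of s t] by (intro monom_degree_superset) auto
  also have "\<dots> = (\<Sum>v\<in>?A. lookup s v) + (\<Sum>v\<in>?A. lookup t v)"
    by (simp add: lookup_add sum.distrib)
  finally show ?thesis by (simp add: monom_degree_superset[of ?A])
qed

lemma monom_degree_simps [simp]: "monom_degree 0 = 0" "monom_degree (single v n) = n"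
  by (simp_all add: monom_degree_def)

lemma monom_degree_eq_0_iff [simp]: "monom_degree t = 0 \<longleftrightarrow> t = 0"
  by (auto simp: monom_degree_def in_keys_iff poly_mapping_eq_iff fun_eq_iff)

lemma keys_exp_add: "keys (s + t :: 'v \<Rightarrow>\<^sub>0 nat) = keys s \<union> keys t"
  by (auto simp: in_keys_iff lookup_add)

lemma exp_induct [case_names zero step]:
  fixes t :: "'v \<Rightarrow>\<^sub>0 nat"
  assumes "P 0" and "\<And>v t. P t \<Longrightarrow> P (single v 1 + t)"
  shows "P t"
proof (induction "monom_degree t" arbitrary: t)
  case 0
  then show ?case using assms(1) by simp
next
  case (Suc n)
  then have "t \<noteq> 0" by auto
  then obtain v where "v \<in> keys t" by (metis all_not_in_conv keys_eq_empty)
  then have t: "t = single v 1 + (t - single v 1)" by (rule exp_split)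
  have "monom_degree t = 1 + monom_degree (t - single v 1)"
    by (subst t) simp
  then have "monom_degree (t - single v 1) = n" using Suc(2) by simp
  then show ?case using Suc(1) assms(2) t by metis
qed

lemma mpoly_vars_simps [simp]:
  "mpoly_vars 0 = {}" "mpoly_vars 1 = {}" "mpoly_vars (Const c) = {}"
  "mpoly_vars (Mon t :: ('v, 'k::comm_ring_1) mpoly) = keys t"
  "mpoly_vars (Var v :: ('v, 'k::comm_ring_1) mpoly) = {v}"
  by (auto simp: mpoly_vars_def Const_def Var_def)

lemma mpoly_vars_uminus [simp]: "mpoly_vars (- p) = mpoly_vars p"
  by (simp add: mpoly_vars_def)

lemma mpoly_vars_diff: "mpoly_vars (p - q) \<subseteq> mpoly_vars p \<union> mpoly_vars q"
  using mpoly_vars_add[of p "- q"] by simp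

lemma mpoly_induct [consumes 1, case_names const var add mult]:
  assumes "mpoly_vars p \<subseteq> V"
    and const: "\<And>c. P (Const c)" and var: "\<And>v. v \<in> V \<Longrightarrow> P (Var v)"
    and add: "\<And>p q. P p \<Longrightarrow> P q \<Longrightarrow> P (p + q)"
    and mult: "\<And>p q. P p \<Longrightarrow> P q \<Longrightarrow> P (p * q)"
  shows "P p"
proof -
  have mon: "keys t \<subseteq> V \<longrightarrow> P (Mon t)" for t
  proof (induction t rule: exp_induct)
    case zero
    show ?case using const[of 1] by simp
  next
    case (step v t)
    show ?case using step var mult by (auto simp: Mon_add keys_exp_add Var_eq_Mon simp del: One_nat_def)
  qed
  have "P (\<Sum>t\<in>A. Const (lookup p t) * Mon t)" if "A \<subseteq> keys p" for A
  proof -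
    have "finite A" using that finite_keys finite_subset by blast
    then show ?thesis using that
    proof (induction A rule: finite_induct)
      case empty
      show ?case using const[of 0] by simp
    next
      case (insert t A)
      then have "keys t \<subseteq> V" using assms(1) by (auto simp: mpoly_vars_def)
      then show ?case using insert mon by (auto intro!: add mult const)
    qed
  qed
  then show ?thesis by (subst mpoly_expand) simp
qed

section \<open>Homomorphisms and evaluation of polynomials\<close>

definition ring_morph :: "('a::comm_ring_1 \<Rightarrow> 'b::comm_ring_1) \<Rightarrow> bool" where
  "ring_morph f \<longleftrightarrow> (\<forall>a b. f (a + b) = f a + f b) \<and> (\<forall>a b. f (a * b) = f a * f b) \<and> f 1 = 1"

lemma ring_morphD:
  assumes "ring_morph f"
  shows "f (a + b) = f a + f b" "f (a * b) = f a * f b" "f 1 = 1" "f 0 = 0"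
    "f (a - b) = f a - f b" "f (- a) = - f a"
proof -
  show 0: "f (a + b) = f a + f b" "f (a * b) = f a * f b" "f 1 = 1" for a b
    using assms by (auto simp: ring_morph_def)
  show z: "f 0 = 0" using 0(1)[of 0 0] by simp
  show m: "f (- a) = - f a" for a using 0(1)[of "- a" a] z by (simp add: eq_neg_iff_add_eq_0)
  show "f (a - b) = f a - f b" using 0(1)[of a "- b"] m by simp
qed

text \<open>Coefficients pass through \<open>h\<close> because the targets are polynomial rings and
  polynomial rings over them, where a constant becomes \<open>Const c\<close> or
  \<open>[:Const c:]\<close>.\<close>

definition mpoly_eval :: "('k \<Rightarrow> 'a) \<Rightarrow> ('v \<Rightarrow> 'a) \<Rightarrow> ('v, 'k::comm_ring_1) mpoly \<Rightarrow> 'a::comm_ring_1" where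
  "mpoly_eval h f p = (\<Sum>t\<in>keys p. h (lookup p t) * (\<Prod>v\<in>keys t. f v ^ lookup t v))"

lemma exp_eval_add:
  fixes f :: "'v \<Rightarrow> 'a::comm_ring_1"
  shows "(\<Prod>v\<in>keys (s + t). f v ^ lookup (s + t) v) =
    (\<Prod>v\<in>keys s. f v ^ lookup s v) * (\<Prod>v\<in>keys t. f v ^ lookup t v)"
proof -
  have sup: "(\<Prod>v\<in>keys r. f v ^ lookup r v) = (\<Prod>v\<in>keys s \<union> keys t. f v ^ lookup r v)"
    if "keys r \<subseteq> keys s \<union> keys t" for r
    using that by (intro prod.mono_neutral_left) (auto simp: in_keys_iff)
  show ?thesis
    by (subst (1 2 3) sup) (auto simp: keys_exp_add lookup_add power_add prod.distrib)
qed

context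
  fixes h :: "'k::comm_ring_1 \<Rightarrow> 'a::comm_ring_1"
  assumes h: "ring_morph h"
begin

lemma mpoly_eval_add: "mpoly_eval h f (p + q) = mpoly_eval h f p + mpoly_eval h f q"
  unfolding mpoly_eval_def
  by (rule setsum_keys_plus_distrib) (simp_all add: ring_morphD[OF h] distrib_right)

lemma mpoly_eval_single:
  "mpoly_eval h f (single t c) = h c * (\<Prod>v\<in>keys t. f v ^ lookup t v)"
  by (cases "c = 0") (simp_all add: mpoly_eval_def ring_morphD[OF h])

lemma mpoly_eval_sum: "mpoly_eval h f (\<Sum>i\<in>A. g i) = (\<Sum>i\<in>A. mpoly_eval h f (g i))"
  by (induction A rule: infinite_finite_induct) (simp_all add: mpoly_eval_add, simp_all add: mpoly_eval_def)

lemma mpoly_eval_mult: "mpoly_eval h f (p * q) = mpoly_eval h f p * mpoly_eval h f q"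
proof -
  have "mpoly_eval h f (p * q) = mpoly_eval h f
      ((\<Sum>s\<in>keys p. single s (lookup p s)) * (\<Sum>t\<in>keys q. single t (lookup q t)))"
    by (simp flip: poly_mapping_expand)
  also have "\<dots> = (\<Sum>s\<in>keys p. \<Sum>t\<in>keys q. mpoly_eval h f (single (s + t) (lookup p s * lookup q t)))"
    by (simp add: sum_product mult_single mpoly_eval_sum)
  also have "\<dots> = mpoly_eval h f (\<Sum>s\<in>keys p. single s (lookup p s)) *
      mpoly_eval h f (\<Sum>t\<in>keys q. single t (lookup q t))"
    unfolding mpoly_eval_sum mpoly_eval_single exp_eval_add ring_morphD(2)[OF h] sum_product
    by (intro sum.cong refl) (simp only: mult_ac)
  finally show ?thesis
    by (simp flip: poly_mapping_expand)
qed

lemma mpoly_eval_Const [simp]: "mpoly_eval h f (Const c) = h c"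
  by (simp add: Const_def mpoly_eval_single)

lemma mpoly_eval_Var [simp]: "mpoly_eval h f (Var v) = f v"
  by (simp add: Var_def mpoly_eval_single ring_morphD[OF h])

lemma mpoly_eval_morph: "ring_morph (mpoly_eval h f)"
  using mpoly_eval_Const[of f 1] ring_morphD(3)[OF h]
  by (auto simp: ring_morph_def mpoly_eval_add mpoly_eval_mult)

end

lemma ring_morph_Const: "ring_morph Const"
  by (simp add: ring_morph_def)

text \<open>A retraction onto k[V]. It fixes generators in k[V], hence brings ideal membership over
  all variables back to k[V].\<close>

definition mpoly_restrict :: "'v set \<Rightarrow> ('v, 'k::comm_ring_1) mpoly \<Rightarrow> ('v, 'k) mpoly" where
  "mpoly_restrict V = mpoly_eval Const (\<lambda>v. if v \<in> V then Var v else 0)"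

lemmas mpoly_restrict_morph = mpoly_eval_morph[OF ring_morph_Const, of "\<lambda>v. if v \<in> V then Var v else 0" for V,
    folded mpoly_restrict_def]

lemma mpoly_restrict_id: "mpoly_vars p \<subseteq> V \<Longrightarrow> mpoly_restrict V p = p"
proof (induction p rule: mpoly_induct)
  case (const c)
  then show ?case by (simp add: mpoly_restrict_def ring_morph_Const)
next
  case (var v)
  then show ?case by (simp add: mpoly_restrict_def ring_morph_Const)
qed (simp_all add: ring_morphD[OF mpoly_restrict_morph])

lemma mpoly_vars_restrict: "mpoly_vars (mpoly_restrict V p) \<subseteq> V"
proof -
  have "mpoly_vars p \<subseteq> UNIV" by simp
  then show ?thesis
  proof (induction p rule: mpoly_induct)
    case (add p q)
    then show ?case using mpoly_vars_add by (fastforce simp: ring_morphD[OF mpoly_restrict_morph])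
  next
    case (mult p q)
    then show ?case using mpoly_vars_mult by (fastforce simp: ring_morphD[OF mpoly_restrict_morph])
  qed (simp_all add: mpoly_restrict_def ring_morph_Const)
qed

lemma morph_span:
  assumes "ring_morph f" "p \<in> ideal_span G" "\<And>g. g \<in> G \<Longrightarrow> f g \<in> ideal_span H"
  shows "f p \<in> ideal_span H"
  using assms(2)
proof (induction rule: idl.span_induct_alt)
  case base
  then show ?case by (simp add: ring_morphD[OF assms(1)] idl.span_zero)
next
  case (step c x y)
  then show ?case
    by (simp add: ring_morphD[OF assms(1)] idl.span_add idl.span_scale assms(3))
qed

text \<open>The difference \<open>p - s p\<close> obeys a Leibniz rule, so checking variables
  suffices. It serves to place \<open>p\<close> in the ideal once \<open>s p = 0\<close> is
  known.\<close>

lemma morph_congruence: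
  assumes s: "ring_morph s" and c: "\<And>c. s (Const c) = Const c"
    and v: "\<And>v. v \<in> V \<Longrightarrow> Var v - s (Var v) \<in> ideal_span G" and "mpoly_vars p \<subseteq> V"
  shows "p - s p \<in> ideal_span G"
  using assms(4)
proof (induction p rule: mpoly_induct)
  case (const c)
  then show ?case by (simp add: c idl.span_zero)
next
  case (add p q)
  have "p + q - s (p + q) = (p - s p) + (q - s q)" by (simp add: ring_morphD[OF s])
  then show ?case using add idl.span_add by metis
next
  case (mult p q)
  have "p * q - s (p * q) = p * (q - s q) + s q * (p - s p)"
    by (simp add: ring_morphD[OF s] algebra_simps)
  then show ?case using mult by (simp add: idl.span_add idl.span_scale)
qed (use v in auto)

section \<open>Reduction to the polynomial ring\<close>

lemma mpoly_ring_simps [simp]: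
  "p \<in> carrier (mpoly_ring V) \<longleftrightarrow> mpoly_vars p \<subseteq> V"
  "p \<otimes>\<^bsub>mpoly_ring V\<^esub> q = p * q" "p \<oplus>\<^bsub>mpoly_ring V\<^esub> q = p + q"
  "\<one>\<^bsub>mpoly_ring V\<^esub> = 1" "\<zero>\<^bsub>mpoly_ring V\<^esub> = 0"
  by (simp_all add: mpoly_ring_def)

lemma mpoly_vars_intros:
  "mpoly_vars p \<subseteq> V \<Longrightarrow> mpoly_vars q \<subseteq> V \<Longrightarrow> mpoly_vars (p + q) \<subseteq> V"
  "mpoly_vars p \<subseteq> V \<Longrightarrow> mpoly_vars q \<subseteq> V \<Longrightarrow> mpoly_vars (p * q) \<subseteq> V"
  "mpoly_vars p \<subseteq> V \<Longrightarrow> mpoly_vars q \<subseteq> V \<Longrightarrow> mpoly_vars (p - q) \<subseteq> V"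
  using mpoly_vars_add[of p q] mpoly_vars_mult[of p q] mpoly_vars_diff[of p q] by auto

lemma mpoly_ring_minus:
  assumes "mpoly_vars q \<subseteq> V"
  shows "\<ominus>\<^bsub>mpoly_ring V\<^esub> q = - q" "p \<ominus>\<^bsub>mpoly_ring V\<^esub> q = p - q"
proof -
  interpret cring "mpoly_ring V" by (rule mpoly_ring_cring)
  show "\<ominus>\<^bsub>mpoly_ring V\<^esub> q = - q" using assms by (intro minus_equality) auto
  then show "p \<ominus>\<^bsub>mpoly_ring V\<^esub> q = p - q" by (simp add: a_minus_def)
qed

lemma span_restrict:
  assumes "p \<in> ideal_span G" "\<And>g. g \<in> G \<Longrightarrow> mpoly_vars g \<subseteq> V"
  shows "mpoly_restrict V p \<in> ideal_span G"
  by (rule morph_span[OF mpoly_restrict_morph assms(1)])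
    (simp only: mpoly_restrict_id[OF assms(2)] idl.span_base)

lemma ideal_span_inter: "ideal (ideal_span G \<inter> {p. mpoly_vars p \<subseteq> V}) (mpoly_ring V)"
proof -
  interpret cring "mpoly_ring V :: ('a, 'b) mpoly ring" by (rule mpoly_ring_cring)
  show ?thesis
  proof (rule idealI)
    show "ring (mpoly_ring V :: ('a, 'b) mpoly ring)" by (rule ring_axioms)
    show "subgroup (ideal_span G \<inter> {p. mpoly_vars p \<subseteq> V}) (add_monoid (mpoly_ring V))"
    proof (rule add.subgroupI)
      have "0 \<in> ideal_span G \<inter> {p. mpoly_vars p \<subseteq> V}" by (simp add: idl.span_zero)
      then show "ideal_span G \<inter> {p. mpoly_vars p \<subseteq> V} \<noteq> {}" by blast
      show "ideal_span G \<inter> {p. mpoly_vars p \<subseteq> V} \<subseteq> carrier (mpoly_ring V)" by auto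
      fix a b assume a: "a \<in> ideal_span G \<inter> {p. mpoly_vars p \<subseteq> V}"
      then show "\<ominus>\<^bsub>mpoly_ring V\<^esub> a \<in> ideal_span G \<inter> {p. mpoly_vars p \<subseteq> V}"
        by (simp add: mpoly_ring_minus(1) idl.span_neg)
      assume b: "b \<in> ideal_span G \<inter> {p. mpoly_vars p \<subseteq> V}"
      show "a \<oplus>\<^bsub>mpoly_ring V\<^esub> b \<in> ideal_span G \<inter> {p. mpoly_vars p \<subseteq> V}"
        using a b by (simp add: idl.span_add mpoly_vars_intros)
    qed
    fix a x :: "('a, 'b) mpoly"
    assume a: "a \<in> ideal_span G \<inter> {p. mpoly_vars p \<subseteq> V}" and x: "x \<in> carrier (mpoly_ring V)"
    then have "x * a \<in> ideal_span G \<inter> {p. mpoly_vars p \<subseteq> V}"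
      by (simp add: idl.span_scale mpoly_vars_intros)
    then show "x \<otimes>\<^bsub>mpoly_ring V\<^esub> a \<in> ideal_span G \<inter> {p. mpoly_vars p \<subseteq> V}"
      "a \<otimes>\<^bsub>mpoly_ring V\<^esub> x \<in> ideal_span G \<inter> {p. mpoly_vars p \<subseteq> V}"
      by (simp_all add: mult.commute)
  qed
qed

text \<open>The retraction turns a combination with arbitrary cofactors into one with cofactors in
  k[V], so the additional variables create no new elements in k[V].\<close>

lemma genideal_mpoly_ring:
  fixes G :: "('v, 'k::comm_ring_1) mpoly set"
  assumes G: "\<And>g. g \<in> G \<Longrightarrow> mpoly_vars g \<subseteq> V"
  shows "Idl\<^bsub>mpoly_ring V\<^esub> G = ideal_span G \<inter> {p. mpoly_vars p \<subseteq> V}"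
proof
  interpret cring "mpoly_ring V :: ('v, 'k) mpoly ring" by (rule mpoly_ring_cring)
  show "Idl\<^bsub>mpoly_ring V\<^esub> G \<subseteq> ideal_span G \<inter> {p. mpoly_vars p \<subseteq> V}"
    using G by (intro genideal_minimal ideal_span_inter) (auto intro: idl.span_base)
  have sub: "G \<subseteq> carrier (mpoly_ring V)" using G by auto
  interpret K: ideal "Idl\<^bsub>mpoly_ring V\<^esub> G" "mpoly_ring V" by (rule genideal_ideal[OF sub])
  have "mpoly_restrict V p \<in> Idl\<^bsub>mpoly_ring V\<^esub> G" if "p \<in> ideal_span G" for p
    using that
  proof (induction rule: idl.span_induct_alt)
    case base
    then show ?case using K.zero_closed by (simp add: ring_morphD[OF mpoly_restrict_morph])
  next
    case (step c x y)
    have "mpoly_restrict V c \<otimes>\<^bsub>mpoly_ring V\<^esub> x \<in> Idl\<^bsub>mpoly_ring V\<^esub> G"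
      using step(1) genideal_self[OF sub] by (intro K.I_l_closed) (auto simp: mpoly_vars_restrict)
    then have "mpoly_restrict V c * x + mpoly_restrict V y \<in> Idl\<^bsub>mpoly_ring V\<^esub> G"
      using K.a_closed[of "mpoly_restrict V c * x" "mpoly_restrict V y"] step(2) by simp
    then show ?case
      using G[OF step(1)] by (simp add: ring_morphD[OF mpoly_restrict_morph] mpoly_restrict_id)
  qed
  then show "ideal_span G \<inter> {p. mpoly_vars p \<subseteq> V} \<subseteq> Idl\<^bsub>mpoly_ring V\<^esub> G"
    using mpoly_restrict_id by fastforce
qed

lemma in_maximal_ideal:
  fixes p :: "('v, 'k::comm_ring_1) mpoly"
  assumes "lookup p 0 = 0" "mpoly_vars p \<subseteq> V"
  shows "p \<in> ideal_span (Var ` V)"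
proof -
  have "Const (lookup p t) * Mon t \<in> ideal_span (Var ` V)" if "t \<in> keys p" for t
  proof -
    have "t \<noteq> 0" using that assms(1) by (auto simp: in_keys_iff)
    then obtain v where v: "v \<in> keys t" by (metis all_not_in_conv keys_eq_empty)
    then have "v \<in> V" using that assms(2) by (auto simp: mpoly_vars_def)
    moreover have "Mon t = Mon (t - single v 1) * (Var v :: ('v, 'k) mpoly)"
      unfolding Var_eq_Mon Mon_add[symmetric] using exp_split[OF v] by (simp add: add.commute)
    ultimately show ?thesis by (metis idl.span_base idl.span_scale imageI)
  qed
  then show ?thesis by (subst mpoly_expand) (rule idl.span_sum)
qed

abbreviation linear_forms :: "('v, 'k::comm_ring_1) mpoly two_row_matrix \<Rightarrow> ('v, 'k) mpoly set" where
  "linear_forms X \<equiv> mpoly_component (matrix_vars X) 1"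

abbreviation det_span :: "('v, 'k::comm_ring_1) mpoly two_row_matrix \<Rightarrow> ('v, 'k) mpoly set \<Rightarrow> ('v, 'k) mpoly set" where
  "det_span X T \<equiv> ideal_span (minors2 X \<union> T)"

lemma minors2_vars:
  assumes "g \<in> minors2 X"
  shows "mpoly_vars g \<subseteq> matrix_vars X"
proof -
  obtain i j where "i < j" and j: "j < length X"
    and g: "g = fst (X ! i) * snd (X ! j) - fst (X ! j) * snd (X ! i)"
    using assms by (auto simp: minors2_def)
  then have i: "i < length X" by simp
  have "mpoly_vars (fst (X ! l)) \<subseteq> matrix_vars X \<and> mpoly_vars (snd (X ! l)) \<subseteq> matrix_vars X"
    if "l < length X" for l
    using nth_mem[OF that] by (force simp: matrix_vars_def split_def)
  then show ?thesis unfolding g using i j by (intro mpoly_vars_intros) auto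
qed

context
  fixes X :: "('v, 'k::comm_ring_1) mpoly two_row_matrix"
begin

private abbreviation (input) "V \<equiv> matrix_vars X"
private abbreviation (input) "P \<equiv> mpoly_ring V"
private abbreviation (input) "R \<equiv> determinantal_ring X"
private abbreviation (input) "proj \<equiv> (+>\<^bsub>P\<^esub>) (determinantal_ideal X)"
private definition "quot_span T = proj ` (det_span X T \<inter> {p. mpoly_vars p \<subseteq> V})"

interpretation P: cring P by (rule mpoly_ring_cring)

private lemma det_ideal: "determinantal_ideal X = ideal_span (minors2 X) \<inter> {p. mpoly_vars p \<subseteq> V}"
  unfolding determinantal_ideal_def by (rule genideal_mpoly_ring) (rule minors2_vars)

interpretation I: ideal "determinantal_ideal X" P
  unfolding det_ideal by (rule ideal_span_inter)

interpretation R: cring R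
  unfolding determinantal_ring_def by (rule I.quotient_is_cring[OF P.cring_axioms])

interpretation proj: ring_hom_ring P R proj
  unfolding determinantal_ring_def by (rule I.rcos_ring_hom_ring)

private lemma R_carrier: "carrier R = proj ` {p. mpoly_vars p \<subseteq> V}"
  by (auto simp: determinantal_ring_def FactRing_def A_RCOSETS_def')

private lemma R_carrierE:
  assumes "r \<in> carrier R"
  obtains p where "mpoly_vars p \<subseteq> V" "r = proj p"
  using assms unfolding R_carrier by blast

private lemma proj_eq_iff:
  assumes "mpoly_vars p \<subseteq> V" "mpoly_vars q \<subseteq> V"
  shows "proj p = proj q \<longleftrightarrow> p - q \<in> ideal_span (minors2 X)"
  using P.quotient_eq_iff_same_a_r_cos[OF I.ideal_axioms, of p q] assms mpoly_vars_intros(3)[OF assms]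
  by (simp add: mpoly_ring_minus det_ideal)

private lemma proj_in_quot_span:
  assumes p: "mpoly_vars p \<subseteq> V"
  shows "proj p \<in> quot_span T \<longleftrightarrow> p \<in> det_span X T"
proof
  assume "proj p \<in> quot_span T"
  then obtain q where q: "q \<in> det_span X T" "mpoly_vars q \<subseteq> V" "proj p = proj q"
    by (auto simp: quot_span_def)
  then have "p - q \<in> ideal_span (minors2 X)" using proj_eq_iff p by blast
  then have "p - q \<in> det_span X T" using idl.span_mono[of "minors2 X" "minors2 X \<union> T"] by auto
  from idl.span_add[OF this q(1)] show "p \<in> det_span X T" by simp
qed (use p in \<open>unfold quot_span_def, blast\<close>)

private lemma quot_span_ideal: "ideal (quot_span T) R"
  unfolding quot_span_def determinantal_ring_def
  by (rule P.ring_ideal_imp_quot_ideal[OF I.ideal_axioms ideal_span_inter])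

private lemma quot_span_gen:
  assumes T: "\<And>t. t \<in> T \<Longrightarrow> mpoly_vars t \<subseteq> V"
  shows "quot_span T = Idl\<^bsub>R\<^esub> (proj ` T)"
proof
  have sub: "proj ` T \<subseteq> carrier R" using T by (auto simp: R_carrier)
  interpret K: ideal "Idl\<^bsub>R\<^esub> (proj ` T)" R by (rule R.genideal_ideal[OF sub])
  have G: "mpoly_vars g \<subseteq> V" if "g \<in> minors2 X \<union> T" for g using that T minors2_vars by blast
  have g_in: "proj g \<in> Idl\<^bsub>R\<^esub> (proj ` T)" if "g \<in> minors2 X \<union> T" for g
  proof (cases "g \<in> T")
    case True
    then show ?thesis using R.genideal_self[OF sub] by auto
  next
    case False
    then have "g - 0 \<in> ideal_span (minors2 X)" using that by (auto intro: idl.span_base)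
    then have "proj g = proj 0" using G[OF that] by (subst proj_eq_iff) auto
    then show ?thesis using K.zero_closed proj.hom_zero by simp
  qed
  have "proj (mpoly_restrict V p) \<in> Idl\<^bsub>R\<^esub> (proj ` T)" if "p \<in> det_span X T" for p
    using that
  proof (induction rule: idl.span_induct_alt)
    case base
    then show ?case using K.zero_closed proj.hom_zero by (simp add: ring_morphD[OF mpoly_restrict_morph])
  next
    case (step c x y)
    have "mpoly_restrict V (c * x + y) = mpoly_restrict V c * x + mpoly_restrict V y"
      using G[OF step(1)] by (simp add: ring_morphD[OF mpoly_restrict_morph] mpoly_restrict_id)
    moreover have "proj (mpoly_restrict V c * x + mpoly_restrict V y) =
        (proj (mpoly_restrict V c) \<otimes>\<^bsub>R\<^esub> proj x) \<oplus>\<^bsub>R\<^esub> proj (mpoly_restrict V y)"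
      using proj.hom_add[of "mpoly_restrict V c * x" "mpoly_restrict V y"]
        proj.hom_mult[of "mpoly_restrict V c" x] G[OF step(1)]
      by (simp add: mpoly_vars_restrict mpoly_vars_intros)
    moreover have "proj (mpoly_restrict V c) \<otimes>\<^bsub>R\<^esub> proj x \<in> Idl\<^bsub>R\<^esub> (proj ` T)"
      using g_in[OF step(1)] by (intro K.I_l_closed) (auto simp: R_carrier mpoly_vars_restrict)
    ultimately show ?case using step(2) by (simp add: K.a_closed)
  qed
  then show "quot_span T \<subseteq> Idl\<^bsub>R\<^esub> (proj ` T)"
    unfolding quot_span_def using mpoly_restrict_id by fastforce
  show "Idl\<^bsub>R\<^esub> (proj ` T) \<subseteq> quot_span T"
  proof (rule R.genideal_minimal[OF quot_span_ideal], rule image_subsetI)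
    fix t assume t: "t \<in> T"
    then have "t \<in> det_span X T" by (intro idl.span_base) simp
    then show "proj t \<in> quot_span T" using T[OF t] by (simp add: proj_in_quot_span)
  qed
qed

private lemma linear_form_vars: "t \<in> linear_forms X \<Longrightarrow> mpoly_vars t \<subseteq> V"
  by (auto simp: mpoly_component_def)

private lemma quot_span_insert:
  assumes x: "x \<in> linear_forms X" and T: "T \<subseteq> linear_forms X"
  shows "quot_span (insert x T) = quot_span T <+>\<^bsub>R\<^esub> (PIdl\<^bsub>R\<^esub> (proj x))"
proof (intro equalityI subsetI)
  have xV: "mpoly_vars x \<subseteq> V" using x linear_form_vars by blast
  fix a assume "a \<in> quot_span (insert x T)"
  then obtain p where p: "p \<in> det_span X (insert x T)" "mpoly_vars p \<subseteq> V" "a = proj p"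
    by (auto simp: quot_span_def)
  from p(1) obtain k where "p - k * x \<in> det_span X T"
    by (auto simp: idl.span_breakdown_eq)
  \<comment> \<open>The cofactor \<open>k\<close> may involve foreign variables; the retraction
    removes them and fixes \<open>p\<close> and \<open>x\<close>.\<close>
  then have *: "mpoly_restrict V (p - k * x) \<in> det_span X T"
  proof (rule span_restrict)
    fix g assume "g \<in> minors2 X \<union> T"
    then show "mpoly_vars g \<subseteq> V"
    proof
      assume "g \<in> T"
      then have "g \<in> linear_forms X" using T by blast
      then show ?thesis by (rule linear_form_vars)
    qed (rule minors2_vars)
  qed
  let ?q = "mpoly_restrict V (p - k * x)" and ?k = "mpoly_restrict V k"
  have "p = ?q + ?k * x"
    using xV p(2) by (simp add: ring_morphD[OF mpoly_restrict_morph] mpoly_restrict_id)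
  then have "a = proj ?q \<oplus>\<^bsub>R\<^esub> (proj ?k \<otimes>\<^bsub>R\<^esub> proj x)"
    using proj.hom_add[of ?q "?k * x"] proj.hom_mult[of ?k x] xV p(3)
    by (simp add: mpoly_vars_restrict mpoly_vars_intros)
  moreover have "proj ?q \<in> quot_span T" using * by (simp add: proj_in_quot_span mpoly_vars_restrict)
  moreover have "proj ?k \<in> carrier R" by (auto simp: R_carrier mpoly_vars_restrict)
  ultimately show "a \<in> quot_span T <+>\<^bsub>R\<^esub> (PIdl\<^bsub>R\<^esub> (proj x))"
    unfolding set_add_def' cgenideal_def by blast
next
  have xV: "mpoly_vars x \<subseteq> V" using x linear_form_vars by blast
  interpret Q: ideal "quot_span (insert x T)" R by (rule quot_span_ideal)
  fix a assume "a \<in> quot_span T <+>\<^bsub>R\<^esub> (PIdl\<^bsub>R\<^esub> (proj x))"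
  then obtain q k where q: "q \<in> quot_span T" and k: "k \<in> carrier R" "a = q \<oplus>\<^bsub>R\<^esub> (k \<otimes>\<^bsub>R\<^esub> proj x)"
    unfolding set_add_def' cgenideal_def by blast
  have "det_span X T \<subseteq> det_span X (insert x T)" by (rule idl.span_mono) auto
  then have "q \<in> quot_span (insert x T)" using q by (auto simp: quot_span_def)
  moreover have "proj x \<in> quot_span (insert x T)"
    using xV by (auto simp: proj_in_quot_span intro: idl.span_base)
  ultimately show "a \<in> quot_span (insert x T)" using k by (simp add: Q.I_l_closed Q.a_closed)
qed

text \<open>Every \<open>r\<close> maps J into J, so testing it on I = J + (x) amounts to testing
  \<open>r * x\<close>. This removes quotient rings from all later colon computations.\<close>

private lemma quot_span_colon:
  assumes x: "x \<in> linear_forms X"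
    and col: "\<And>r. mpoly_vars r \<subseteq> V \<Longrightarrow> r * x \<in> det_span X T \<longleftrightarrow> r \<in> det_span X C"
  shows "colon_ideal R (quot_span T) (quot_span (insert x T)) = quot_span C"
proof
  have xV: "mpoly_vars x \<subseteq> V" using x linear_form_vars by blast
  have mult: "proj r \<otimes>\<^bsub>R\<^esub> proj p = proj (r * p)" if "mpoly_vars r \<subseteq> V" "mpoly_vars p \<subseteq> V" for r p
    using proj.hom_mult[of r p] that by simp
  show "colon_ideal R (quot_span T) (quot_span (insert x T)) \<subseteq> quot_span C"
  proof
    fix a assume "a \<in> colon_ideal R (quot_span T) (quot_span (insert x T))"
    then have "a \<in> carrier R"
      and *: "\<forall>b\<in>quot_span (insert x T). a \<otimes>\<^bsub>R\<^esub> b \<in> quot_span T"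
      by (simp_all add: colon_ideal_def)
    from this(1) obtain r where r: "mpoly_vars r \<subseteq> V" "a = proj r" by (rule R_carrierE)
    have "proj x \<in> quot_span (insert x T)"
      using xV by (auto simp: proj_in_quot_span intro: idl.span_base)
    then have "proj r \<otimes>\<^bsub>R\<^esub> proj x \<in> quot_span T" using * r by blast
    then have "r * x \<in> det_span X T"
      using r xV by (simp only: mult proj_in_quot_span mpoly_vars_intros)
    then show "a \<in> quot_span C" using r col by (simp add: proj_in_quot_span)
  qed
  show "quot_span C \<subseteq> colon_ideal R (quot_span T) (quot_span (insert x T))"
  proof
    fix a assume "a \<in> quot_span C"
    then obtain r where r: "mpoly_vars r \<subseteq> V" "a = proj r" "r \<in> det_span X C"
      by (auto simp: quot_span_def)
    then have rx: "r * x \<in> det_span X T" using col by blast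
    have "proj r \<otimes>\<^bsub>R\<^esub> b \<in> quot_span T" if "b \<in> quot_span (insert x T)" for b
    proof -
      from that obtain p where p: "p \<in> det_span X (insert x T)" "mpoly_vars p \<subseteq> V" "b = proj p"
        by (auto simp: quot_span_def)
      from p(1) obtain k where k: "p - k * x \<in> det_span X T"
        by (auto simp: idl.span_breakdown_eq)
      have "r * p = k * (r * x) + r * (p - k * x)" by (simp add: algebra_simps)
      then have "r * p \<in> det_span X T" using k rx by (metis idl.span_add idl.span_scale)
      then show ?thesis using p r by (simp only: mult proj_in_quot_span mpoly_vars_intros)
    qed
    moreover have "a \<in> carrier R" using r by (auto simp: R_carrier)
    ultimately show "a \<in> colon_ideal R (quot_span T) (quot_span (insert x T))"
      using r by (simp add: colon_ideal_def)
  qed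
qed

private lemma quot_span_maximal:
  "graded_maximal_ideal R (determinantal_component X) = quot_span (Var ` V)"
proof
  have comp: "determinantal_component X d \<subseteq> carrier R" for d
    by (auto simp: determinantal_component_def mpoly_component_def R_carrier)
  have gen: "quot_span (Var ` V) = Idl\<^bsub>R\<^esub> (proj ` Var ` V)"
    by (rule quot_span_gen) auto
  show "graded_maximal_ideal R (determinantal_component X) \<subseteq> quot_span (Var ` V)"
    unfolding graded_maximal_ideal_def
  proof (rule R.genideal_minimal[OF quot_span_ideal], safe)
    fix a d assume "a \<in> determinantal_component X d" "1 \<le> (d::nat)"
    then obtain p where p: "p \<in> mpoly_component V d" "a = proj p"
      by (auto simp: determinantal_component_def)
    then have pV: "mpoly_vars p \<subseteq> V" by (auto simp: mpoly_component_def)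
    have "lookup p 0 = 0"
    proof (rule ccontr)
      assume "lookup p 0 \<noteq> 0"
      then have "0 \<in> keys p" by (simp add: in_keys_iff)
      then have "monom_degree (0 :: 'v \<Rightarrow>\<^sub>0 nat) = d" using p(1) unfolding mpoly_component_def by blast
      then show False using \<open>1 \<le> d\<close> by simp
    qed
    then have "p \<in> ideal_span (Var ` V)" using pV by (rule in_maximal_ideal)
    then have "p \<in> det_span X (Var ` V)"
      using idl.span_mono[of "Var ` V" "minors2 X \<union> Var ` V"] by auto
    then show "a \<in> quot_span (Var ` V)" using p pV by (simp add: proj_in_quot_span)
  qed
  have "Var ` V \<subseteq> linear_forms X"
    by (auto simp: mpoly_component_def) (simp add: Var_def)
  then have "proj ` Var ` V \<subseteq> determinantal_component X 1"
    unfolding determinantal_component_def by blast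
  then have "proj ` Var ` V \<subseteq> Idl\<^bsub>R\<^esub> (\<Union>d\<in>{1..}. determinantal_component X d)"
    using R.genideal_self[of "\<Union>d\<in>{1..}. determinantal_component X d"] comp
    by (meson UN_least UN_upper atLeast_iff order_refl subset_trans)
  then show "quot_span (Var ` V) \<subseteq> graded_maximal_ideal R (determinantal_component X)"
    unfolding gen graded_maximal_ideal_def
    using comp by (intro R.genideal_minimal R.genideal_ideal UN_least)
qed

text \<open>The family is one of generating sets, lifted to the polynomial ring. Different sets may
  generate the same ideal, so equality is asked of the spans only.\<close>

theorem koszul_filtrationI:
  assumes lin: "\<And>T. T \<in> \<T> \<Longrightarrow> T \<subseteq> linear_forms X"
    and zero: "\<exists>T\<in>\<T>. det_span X T = det_span X {}"
    and maximal: "\<exists>T\<in>\<T>. det_span X T = det_span X (Var ` matrix_vars X)"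
    and step: "\<And>T. T \<in> \<T> \<Longrightarrow> det_span X T \<noteq> det_span X {} \<Longrightarrow>
      \<exists>T'\<in>\<T>. \<exists>C\<in>\<T>. \<exists>x\<in>linear_forms X. x \<notin> det_span X {} \<and> det_span X T = det_span X (insert x T') \<and>
        (\<forall>r. mpoly_vars r \<subseteq> matrix_vars X \<longrightarrow> (r * x \<in> det_span X T' \<longleftrightarrow> r \<in> det_span X C))"
  shows "\<exists>F. koszul_filtration (determinantal_ring X) (determinantal_component X) F"
proof (rule exI[of _ "quot_span ` \<T>"], unfold koszul_filtration_def, intro conjI ballI impI)
  have eq: "quot_span S = quot_span T" if "det_span X S = det_span X T" for S T
    using that by (simp add: quot_span_def)
  have z: "quot_span {} = {\<zero>\<^bsub>R\<^esub>}"
  proof -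
    have "proj ` {} \<subseteq> carrier R" by simp
    then have "Idl\<^bsub>R\<^esub> {} = {\<zero>\<^bsub>R\<^esub>}"
      using R.genideal_minimal[OF R.zeroideal, of "{}"] R.genideal_ideal[of "{}"]
        additive_subgroup.zero_closed[OF ideal.axioms(1)] by fastforce
    then show ?thesis by (subst quot_span_gen) auto
  qed
  {
    fix I assume "I \<in> quot_span ` \<T>"
    then obtain T where T: "T \<in> \<T>" "I = quot_span T" by auto
    show "ideal I R" unfolding T(2) by (rule quot_span_ideal)
    have "I = Idl\<^bsub>R\<^esub> (proj ` T)" unfolding T(2)
      using lin[OF T(1)] linear_form_vars by (intro quot_span_gen) auto
    moreover have "proj ` T \<subseteq> determinantal_component X 1"
      using lin[OF T(1)] by (auto simp: determinantal_component_def)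
    ultimately show "\<exists>L\<subseteq>determinantal_component X 1. I = Idl\<^bsub>R\<^esub> L" by blast
  }
  show "{\<zero>\<^bsub>R\<^esub>} \<in> quot_span ` \<T>" using zero eq z by (metis imageI)
  show "graded_maximal_ideal R (determinantal_component X) \<in> quot_span ` \<T>"
    using maximal eq by (metis imageI quot_span_maximal)
  fix I assume "I \<in> quot_span ` \<T>" and nz: "I \<noteq> {\<zero>\<^bsub>R\<^esub>}"
  then obtain T where T: "T \<in> \<T>" "I = quot_span T" by auto
  then have "det_span X T \<noteq> det_span X {}" using nz z eq by metis
  from step[OF T(1) this] obtain T' C x where *: "T' \<in> \<T>" "C \<in> \<T>" "x \<in> linear_forms X"
    "x \<notin> det_span X {}" "det_span X T = det_span X (insert x T')"
    and col: "\<And>r. mpoly_vars r \<subseteq> V \<Longrightarrow> r * x \<in> det_span X T' \<longleftrightarrow> r \<in> det_span X C"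
    by metis
  have I: "I = quot_span (insert x T')" using T(2) eq[OF *(5)] by simp
  have "proj x \<noteq> \<zero>\<^bsub>R\<^esub>"
    using *(3,4) proj_in_quot_span[of x "{}"] linear_form_vars z by auto
  then have "proj x \<in> determinantal_component X 1 - {\<zero>\<^bsub>R\<^esub>}"
    using *(3) by (auto simp: determinantal_component_def)
  moreover have "I = quot_span T' <+>\<^bsub>R\<^esub> (PIdl\<^bsub>R\<^esub> (proj x))"
    unfolding I by (rule quot_span_insert[OF *(3) lin[OF *(1)]])
  moreover have "colon_ideal R (quot_span T') I = quot_span C"
    unfolding I by (rule quot_span_colon[OF *(3) col])
  ultimately show "\<exists>J\<in>quot_span ` \<T>. \<exists>x\<in>determinantal_component X 1 - {\<zero>\<^bsub>R\<^esub>}.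
      I = J <+>\<^bsub>R\<^esub> (PIdl\<^bsub>R\<^esub> x) \<and> colon_ideal R J I \<in> quot_span ` \<T>"
    using *(1,2) by (metis imageI)
qed

end

section \<open>Relations between the blocks\<close>

text \<open>Column operations stay inside the ideal of minors: any two pairs obtained by them
  satisfy the minor relation. This permits a scroll block to be rewritten in powers of t -
  l.\<close>

inductive col_span ::
    "('v, 'k::comm_ring_1) mpoly two_row_matrix \<Rightarrow> ('v, 'k) mpoly \<Rightarrow> ('v, 'k) mpoly \<Rightarrow> bool"
  for X where
  column: "(a, b) \<in> set X \<Longrightarrow> col_span X a b"
| combine: "col_span X a b \<Longrightarrow> col_span X a' b' \<Longrightarrow> col_span X (a + Const c * a') (b + Const c * b')"

lemma col_span_minor_column:
  assumes "col_span X a b" "(p, q) \<in> set X"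
  shows "p * b - a * q \<in> ideal_span (minors2 X)"
  using assms(1)
proof (induction rule: col_span.induct)
  case (column a b)
  obtain i j where ij: "i < length X" "j < length X" "(p, q) = X ! i" "(a, b) = X ! j"
    using assms(2) column by (metis in_set_conv_nth)
  let ?m = "\<lambda>i j. fst (X ! i) * snd (X ! j) - fst (X ! j) * snd (X ! i)"
  have m: "?m i j \<in> ideal_span (minors2 X)" if "i < j" "j < length X" for i j
    using that by (intro idl.span_base) (auto simp: minors2_def)
  have "?m i j \<in> ideal_span (minors2 X)"
  proof (cases i j rule: linorder_cases)
    case greater
    have "- ?m j i \<in> ideal_span (minors2 X)" using m[OF greater] ij(1) by (intro idl.span_neg)
    then show ?thesis by simp
  qed (use m ij(2) in \<open>simp_all add: idl.span_zero\<close>)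
  then show ?case by (simp flip: ij(3,4))
next
  case (combine a b a' b' e)
  have "p * (b + Const e * b') - (a + Const e * a') * q = (p * b - a * q) + Const e * (p * b' - a' * q)"
    by (simp add: algebra_simps)
  then show ?case using combine.IH by (simp only: idl.span_add idl.span_scale)
qed

lemma col_span_minor:
  assumes "col_span X a b" "col_span X a' b'"
  shows "a * b' - a' * b \<in> ideal_span (minors2 X)"
  using assms(1)
proof (induction rule: col_span.induct)
  case (column a b)
  then show ?case by (rule col_span_minor_column[OF assms(2)])
next
  case (combine a b c d e)
  have "(a + Const e * c) * b' - a' * (b + Const e * d) = (a * b' - a' * b) + Const e * (c * b' - a' * d)"
    by (simp add: algebra_simps)
  then show ?case using combine.IH by (simp only: idl.span_add idl.span_scale)
qed

text \<open>The form \<open>Y (t - l)\<^sup>c t\<^sup>j\<close> of the \<open>i\<close>-th block.\<close>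

primrec scroll_diff :: "'k::comm_ring_1 \<Rightarrow> nat \<Rightarrow> nat \<Rightarrow> nat \<Rightarrow> (nat \<times> nat, 'k) mpoly" where
  "scroll_diff l i 0 j = Var (i, Suc j)"
| "scroll_diff l i (Suc c) j = scroll_diff l i c (Suc j) - Const l * scroll_diff l i c j"

locale block_concat =
  fixes bs :: "'k::field block list"
  assumes pos: "\<forall>b\<in>set bs. block_length b \<ge> 1"
begin

abbreviation "X \<equiv> concatenation bs"
abbreviation "N \<equiv> length bs"
abbreviation "len i \<equiv> block_length (bs ! i)"

text \<open>
  The form \<open>Y (t - l)\<^sup>a\<close> of a scroll block. In the other blocks the variables are already adapted to their
  point of the projective line, and \<open>l\<close> is ignored; out of range the form is \<open>0\<close>.
\<close>

definition form :: "'k \<Rightarrow> nat \<Rightarrow> nat \<Rightarrow> (nat \<times> nat, 'k) mpoly" where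
  "form l i a = (case bs ! i of
     Nilpotent m \<Rightarrow> if 1 \<le> a \<and> a < m then Var (i, a) else 0
   | Scroll n \<Rightarrow> if a \<le> n then scroll_diff l i a 0 else 0
   | Jordan p c \<Rightarrow> if a < p then Var (i, Suc a) else 0)"

text \<open>The blocks on which t acts as u + l in the basis \<open>form l i\<close>, so that powers
  of u can be exchanged between them. The variables of a nilpotent block are powers of t itself,
  hence \<open>l = 0\<close>.\<close>

definition at_point :: "'k \<Rightarrow> nat \<Rightarrow> bool" where
  "at_point l i \<longleftrightarrow> i < N \<and> (case bs ! i of Nilpotent m \<Rightarrow> l = 0 | Scroll n \<Rightarrow> True | Jordan p c \<Rightarrow> c = l)"

definition is_nilpotent :: "nat \<Rightarrow> bool" where "is_nilpotent i \<longleftrightarrow> i < N \<and> (\<exists>m. bs ! i = Nilpotent m)"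
definition is_scroll :: "nat \<Rightarrow> bool" where "is_scroll i \<longleftrightarrow> i < N \<and> (\<exists>n. bs ! i = Scroll n)"
definition is_jordan :: "'k \<Rightarrow> nat \<Rightarrow> bool" where "is_jordan l i \<longleftrightarrow> i < N \<and> (\<exists>p. bs ! i = Jordan p l)"

lemma block_cases:
  assumes "i < N"
  obtains "is_nilpotent i" | "is_scroll i" | l where "is_jordan l i"
  using assms by (cases "bs ! i") (auto simp: is_nilpotent_def is_scroll_def is_jordan_def)

lemma block_distinct:
  "is_nilpotent i \<Longrightarrow> \<not> is_scroll i" "is_nilpotent i \<Longrightarrow> \<not> is_jordan l i" "is_scroll i \<Longrightarrow> \<not> is_jordan l i" "is_jordan l i \<Longrightarrow> is_jordan l' i \<Longrightarrow> l' = l"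
  by (auto simp: is_nilpotent_def is_scroll_def is_jordan_def)

lemma len_pos: "i < N \<Longrightarrow> len i \<ge> 1"
  using pos by simp

lemma at_point_simps: "is_nilpotent i \<Longrightarrow> at_point l i \<longleftrightarrow> l = 0" "is_scroll i \<Longrightarrow> at_point l i" "is_jordan c i \<Longrightarrow> at_point l i \<longleftrightarrow> c = l"
  by (auto simp: is_nilpotent_def is_scroll_def is_jordan_def at_point_def)

lemma form_nil: "is_nilpotent i \<Longrightarrow> form l i a = (if 1 \<le> a \<and> a < len i then Var (i, a) else 0)"
  and form_scr: "is_scroll i \<Longrightarrow> form l i a = (if a \<le> len i then scroll_diff l i a 0 else 0)"
  and form_jor: "is_jordan c i \<Longrightarrow> form l i a = (if a < len i then Var (i, Suc a) else 0)"
  by (auto simp: is_nilpotent_def is_scroll_def is_jordan_def form_def)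

lemma set_X: "set X = (\<Union>i<N. set (block_matrix i (bs ! i)))"
  by (auto simp: concatenation_def)

lemma in_set_X: "i < N \<Longrightarrow> c \<in> set (block_matrix i (bs ! i)) \<Longrightarrow> c \<in> set X"
  by (auto simp: set_X)

lemma set_map_upt: "set (map f [Suc 0..<Suc n]) = (\<lambda>a. f (Suc a)) ` {..<n}"
proof -
  have "set [Suc 0..<Suc n] = Suc ` {..<n}" by (auto simp: image_Suc_lessThan)
  then show ?thesis by (simp only: set_map image_image)
qed

lemma set_X_nil:
  "is_nilpotent i \<Longrightarrow> set (block_matrix i (bs ! i)) = (\<lambda>a. (form l i a, form l i (Suc a))) ` {..<len i}"
  unfolding is_nilpotent_def
  by (elim conjE exE, simp add: form_def Let_def set_map_upt del: set_map upt_Suc, intro image_cong refl, auto)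

lemma set_X_scr:
  "is_scroll i \<Longrightarrow> set (block_matrix i (bs ! i)) = (\<lambda>a. (Var (i, Suc a), Var (i, Suc (Suc a)))) ` {..<len i}"
  unfolding is_scroll_def by (auto simp: set_map_upt simp del: set_map upt_Suc)

lemma set_X_jor:
  "is_jordan c i \<Longrightarrow> set (block_matrix i (bs ! i)) =
    (\<lambda>a. (form l i a, form l i (Suc a) + Const c * form l i a)) ` {..<len i}"
  unfolding is_jordan_def
  by (elim conjE exE, simp add: form_def Let_def set_map_upt del: set_map upt_Suc, intro image_cong refl, auto)

lemma scroll_diff_col:
  assumes "is_scroll i" "c + j < len i"
  shows "col_span X (scroll_diff l i c j) (scroll_diff l i c (Suc j))"
  using assms(2)
proof (induction c arbitrary: j)
  case 0
  then show ?case using assms(1) by (intro col_span.column in_set_X[of i]) (auto simp: set_X_scr, simp add: is_scroll_def)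
next
  case (Suc c)
  then have "col_span X (scroll_diff l i c (Suc j)) (scroll_diff l i c (Suc (Suc j)))"
    "col_span X (scroll_diff l i c j) (scroll_diff l i c (Suc j))" by simp_all
  from col_span.combine[OF this, of "- l"] show ?case by simp
qed

text \<open>Each pair has the shape (w, t w) with w = Y u^a and t = u + l; the boundary zeros of
  \<open>form\<close> are those of the block.\<close>

lemma form_col:
  assumes "at_point l i" "a < len i"
  shows "col_span X (form l i a) (form l i (Suc a) + Const l * form l i a)"
proof -
  have i: "i < N" using assms by (simp add: at_point_def)
  then show ?thesis
  proof (cases rule: block_cases)
    case 1
    then show ?thesis using assms i by (intro col_span.column in_set_X[of i]) (auto simp: set_X_nil[of i l] at_point_simps)
  next
    case 2
    then show ?thesis using scroll_diff_col[of i a 0 l] assms by (simp add: form_scr)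
  next
    case (3 c)
    then show ?thesis using assms i by (intro col_span.column in_set_X[of i]) (auto simp: set_X_jor[of c i l] at_point_simps)
  qed
qed

abbreviation "I2 \<equiv> ideal_span (minors2 X)"

text \<open>In the minor of two such pairs the terms with \<open>l\<close> cancel, so u moves
  between factors just as t does.\<close>

lemma form_rel:
  assumes "at_point l i" "at_point l j" "a < len i" "b < len j"
  shows "form l i a * form l j (Suc b) - form l i (Suc a) * form l j b \<in> I2"
  using col_span_minor[OF form_col[OF assms(1,3)] form_col[OF assms(2,4)]]
  by (simp add: algebra_simps)

lemma form_slide:
  assumes "at_point l i" "at_point l j" "a + s \<le> len i" "s \<le> b" "b \<le> len j"
  shows "form l i a * form l j b - form l i (a + s) * form l j (b - s) \<in> I2"
  using assms(3,4)
proof (induction s)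
  case 0
  then show ?case by (simp add: idl.span_zero)
next
  case (Suc s)
  then have "form l i (a + s) * form l j (Suc (b - Suc s)) - form l i (Suc (a + s)) * form l j (b - Suc s) \<in> I2"
    using assms by (intro form_rel) auto
  moreover have "Suc (b - Suc s) = b - s" using Suc by simp
  moreover have "form l i a * form l j b - form l i (a + s) * form l j (b - s) \<in> I2"
    using Suc by simp
  ultimately show ?case using idl.span_add by fastforce
qed

lemma slide_in:
  assumes "at_point l i" "at_point l j" "a + s \<le> len i" "s \<le> b" "b \<le> len j"
    and "form l i (a + s) * form l j (b - s) \<in> det_span X T"
  shows "form l i a * form l j b \<in> det_span X T"
proof -
  have "form l i a * form l j b - form l i (a + s) * form l j (b - s) \<in> det_span X T"
    using form_slide[OF assms(1-5)] idl.span_mono[of "minors2 X" "minors2 X \<union> T"] by auto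
  from idl.span_add[OF this assms(6)] show ?thesis by simp
qed

lemma I2_in: "p \<in> I2 \<Longrightarrow> p \<in> det_span X T"
  using idl.span_mono[of "minors2 X" "minors2 X \<union> T"] by auto

lemma nil_nil: 
  assumes "is_nilpotent i" "is_nilpotent j"
  shows "form 0 i a * form 0 j b \<in> I2"
proof (cases "a \<le> len i \<and> b \<le> len j")
  case True
  have "form 0 j b * form 0 i a \<in> det_span X {}"
    \<comment> \<open>Slide until a factor meets a boundary zero: index 0 in block \<open>i\<close>
      or index \<open>len j\<close> in block \<open>j\<close>.\<close>
    by (rule slide_in[where s = "min a (len j - b)"])
      (use assms True in \<open>auto simp: at_point_simps form_nil idl.span_zero\<close>)
  then show ?thesis by (simp add: mult.commute)
qed (use assms in \<open>auto simp: form_nil idl.span_zero\<close>)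

text \<open>If the total exponent is at most n, the scroll form absorbs all powers of t and leaves
  x_0 = 0; if it is at least m, the nilpotent factor can be raised to x_m = 0.\<close>

lemma nil_scr:
  assumes "is_nilpotent i" "is_scroll j" "a + b \<le> len j \<or> len i \<le> a + b"
  shows "form 0 i a * form 0 j b \<in> I2"
proof (cases "a \<le> len i \<and> b \<le> len j")
  case True
  show ?thesis
  proof (cases "a + b \<le> len j")
    case less: True
    have "form 0 j b * form 0 i a \<in> det_span X {}"
      by (rule slide_in[where s = a])
        (use assms True less in \<open>auto simp: at_point_simps form_nil idl.span_zero\<close>)
    then show ?thesis by (simp add: mult.commute)
  next
    case False
    have "form 0 i a * form 0 j b \<in> det_span X {}"
      by (rule slide_in[where s = "len i - a"])
        (use assms True False in \<open>auto simp: at_point_simps form_nil idl.span_zero\<close>)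
    then show ?thesis by simp
  qed
qed (use assms in \<open>auto simp: form_nil form_scr idl.span_zero\<close>)

text \<open>Start from x_0 = 0: a minor expresses the product with x_(a+1) by products with x_a,
  whatever the eigenvalue.\<close>

lemma nil_jor:
  assumes "is_nilpotent i" "is_jordan l j"
  shows "form 0 i a * form l j b \<in> I2"
proof (induction a arbitrary: b)
  case 0
  then show ?case using assms by (simp add: form_nil idl.span_zero)
next
  case (Suc a)
  show ?case
  proof (cases "a < len i \<and> b < len j")
    case True
    have "form 0 i a * (form l j (Suc b) + Const l * form l j b) - form l j b * form 0 i (Suc a) \<in> I2"
      using col_span_minor[OF form_col[of 0 i a] form_col[of l j b]] assms True
      by (simp add: at_point_simps)
    from idl.span_diff[OF idl.span_add[OF Suc.IH[of "Suc b"] idl.span_scale[OF Suc.IH[of b], of "Const l"]] this]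
    show ?thesis by (simp add: algebra_simps)
  qed (use assms in \<open>auto simp: form_nil form_jor idl.span_zero\<close>)
qed

text \<open>On the product, t acts as u + l through one factor and as u' + l' through the other. So
  l' - l times the product is a combination of products further along the blocks, which end in
  zero.\<close>

lemma jor_jor:
  assumes "is_jordan l i" "is_jordan l' j" "l \<noteq> l'"
  shows "form l i a * form l' j b \<in> I2"
proof (induction "(len i - a) + (len j - b)" arbitrary: a b rule: less_induct)
  case less
  show ?case
  proof (cases "a < len i \<and> b < len j")
    case True
    have "form l i a * (form l' j (Suc b) + Const l' * form l' j b)
        - form l' j b * (form l i (Suc a) + Const l * form l i a) \<in> I2" (is "?p \<in> _")
      using col_span_minor[OF form_col[of l i a] form_col[of l' j b]] assms True
      by (simp add: at_point_simps)
    moreover have "form l i a * form l' j (Suc b) \<in> I2" "form l i (Suc a) * form l' j b \<in> I2"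
      using less True by auto
    ultimately have "?p - (form l i a * form l' j (Suc b) - form l i (Suc a) * form l' j b) \<in> I2"
      by (metis idl.span_diff)
    then have "Const (inverse (l' - l)) *
        (?p - (form l i a * form l' j (Suc b) - form l i (Suc a) * form l' j b)) \<in> I2"
      by (rule idl.span_scale)
    also have "Const (inverse (l' - l)) *
        (?p - (form l i a * form l' j (Suc b) - form l i (Suc a) * form l' j b)) =
        Const (inverse (l' - l)) * Const (l' - l) * (form l i a * form l' j b)"
      by (simp add: algebra_simps del: Const_simps(4)) 
    also have "Const (inverse (l' - l)) * Const (l' - l) = 1"
      using assms(3) by (simp flip: Const_simps(2,4) del: Const_simps)
    finally show ?thesis by simp
  qed (use assms in \<open>auto simp: form_jor idl.span_zero\<close>)
qed

end

section \<open>Substitution homomorphisms and profile ideals\<close>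

text \<open>Divisibility by \<open>d\<close> replaces the quotient of the target by (d); for
  \<open>d = 0\<close> it means vanishing.\<close>

lemma dvd_morph_span:
  assumes "ring_morph f" "p \<in> ideal_span G" "\<And>g. g \<in> G \<Longrightarrow> d dvd f g"
  shows "d dvd f p"
  using assms(2)
proof (induction rule: idl.span_induct_alt)
  case base
  then show ?case by (simp add: ring_morphD[OF assms(1)])
next
  case (step c x y)
  then show ?case by (simp add: ring_morphD[OF assms(1)] assms(3))
qed

lemma span_mult_closed:
  assumes "p \<in> ideal_span G" "\<And>g. g \<in> G \<Longrightarrow> g * x \<in> ideal_span H"
  shows "p * x \<in> ideal_span H"
  using assms(1)
proof (induction rule: idl.span_induct_alt)
  case base
  then show ?case by (simp add: idl.span_zero)
next
  case (step c g y)
  have "(c * g + y) * x = c * (g * x) + y * x" by (simp add: algebra_simps)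
  then show ?case using step assms(2) by (simp only: idl.span_add idl.span_scale)
qed

lemma span_scale_right: "x \<in> ideal_span S \<Longrightarrow> x * c \<in> ideal_span S"
  by (metis idl.span_scale mult.commute)

text \<open>Modulo \<open>d\<close> all columns become (w, s w), so the image of the matrix has rank
  at most one.\<close>

lemma dvd_morph_minors2:
  assumes f: "ring_morph f" and col: "\<And>a b. (a, b) \<in> set X \<Longrightarrow> d dvd f b - s * f a"
    and "g \<in> minors2 X"
  shows "d dvd f g"
proof -
  obtain i j where ij: "i < j" "j < length X"
    and g: "g = fst (X ! i) * snd (X ! j) - fst (X ! j) * snd (X ! i)"
    using assms(3) by (auto simp: minors2_def)
  have "f g = f (fst (X ! i)) * (f (snd (X ! j)) - s * f (fst (X ! j)))
      - f (fst (X ! j)) * (f (snd (X ! i)) - s * f (fst (X ! i)))"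
    unfolding g by (simp add: ring_morphD[OF f] algebra_simps)
  moreover have "d dvd f (snd (X ! l)) - s * f (fst (X ! l))" if "l < length X" for l
    using col[of "fst (X ! l)" "snd (X ! l)"] nth_mem[OF that] by simp
  ultimately show ?thesis using ij by simp
qed

lemma ring_morph_coeff_0: "ring_morph f \<Longrightarrow> ring_morph (\<lambda>p. coeff (f p) 0)"
  by (auto simp: ring_morph_def coeff_mult_0)

lemma ring_morph_pConst: "ring_morph (\<lambda>c. [:Const c:])"
  by (auto simp: ring_morph_def)

lemma Var_linear: "v \<in> V \<Longrightarrow> Var v \<in> mpoly_component V (Suc 0)"
  by (auto simp: mpoly_component_def) (simp add: Var_def)

lemma mpoly_component_iff:
  "p \<in> mpoly_component V d \<longleftrightarrow> (\<forall>t\<in>keys p. keys t \<subseteq> V \<and> monom_degree t = d)"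
  by (auto simp: mpoly_component_def mpoly_vars_def)

lemma mpoly_component_diff:
  assumes "p \<in> mpoly_component V d" "q \<in> mpoly_component V d"
  shows "p - Const c * q \<in> mpoly_component V d"
proof -
  have "lookup (p - Const c * q) t = lookup p t - c * lookup q t" for t
    using mult_map_scale_conv_mult[of c q] by (simp add: lookup_minus Const_def Poly_Mapping.map.rep_eq when_def flip: mult_map_scale_conv_mult)
  then have "keys (p - Const c * q) \<subseteq> keys p \<union> keys q" by (auto simp: in_keys_iff)
  then show ?thesis using assms unfolding mpoly_component_iff by blast
qed

context block_concat
begin

section \<open>Variables and linear forms of the blocks\<close>

abbreviation "V \<equiv> matrix_vars X"

lemma V_iff: "(i, a) \<in> V \<longleftrightarrow> 1 \<le> a \<and> (is_nilpotent i \<and> a < len i \<or> is_scroll i \<and> a \<le> Suc (len i) \<or> (\<exists>l. is_jordan l i) \<and> a \<le> len i)"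
proof -
  let ?W = "\<lambda>i. (\<Union>(p, q)\<in>set (block_matrix i (bs ! i)). mpoly_vars p \<union> mpoly_vars q)"
  have V: "V = (\<Union>i<N. ?W i)" by (auto simp: matrix_vars_def set_X)
  have "?W i = {(i, a) |a. 1 \<le> a \<and> (is_nilpotent i \<and> a < len i \<or> is_scroll i \<and> a \<le> Suc (len i) \<or> (\<exists>l. is_jordan l i) \<and> a \<le> len i)}"
    if i: "i < N" for i
    using i
  proof (cases rule: block_cases)
    case 1
    have "?W i = (\<Union>a<len i. mpoly_vars (form 0 i a) \<union> mpoly_vars (form 0 i (Suc a)))"
      by (simp add: set_X_nil[OF 1, of 0])
    also have "\<dots> = {(i, a) |a. 1 \<le> a \<and> a < len i}"
      using 1 by (auto simp: form_nil split: if_splits)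
    finally show ?thesis using 1 by (auto dest: block_distinct)
  next
    case 2
    have "?W i = (\<Union>a<len i. {(i, Suc a), (i, Suc (Suc a))})"
      by (simp add: set_X_scr[OF 2])
    also have "\<dots> = {(i, a) |a. 1 \<le> a \<and> a \<le> Suc (len i)}" (is "?A = ?B")
    proof
      show "?B \<subseteq> ?A"
      proof
        fix v assume "v \<in> ?B"
        then obtain a where a: "v = (i, a)" "1 \<le> a" "a \<le> Suc (len i)" by blast
        show "v \<in> ?A"
          by (cases "a \<le> len i") (use a len_pos[OF i] in \<open>auto intro!: bexI[of _ "a - 1"] bexI[of _ "a - 2"]\<close>)
      qed
    qed auto
    finally show ?thesis using 2 by (auto dest: block_distinct)
  next
    case (3 l)
    have "?W i = (\<Union>a<len i. mpoly_vars (form 0 i a) \<union> mpoly_vars (form 0 i (Suc a) + Const l * form 0 i a))"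
      by (simp add: set_X_jor[OF 3, of 0])
    also have "\<dots> = {(i, a) |a. 1 \<le> a \<and> a \<le> len i}" (is "?A = ?B")
    proof
      show "?A \<subseteq> ?B"
        using 3 by (fastforce simp: form_jor split: if_splits dest!: subsetD[OF mpoly_vars_add] subsetD[OF mpoly_vars_mult])
      show "?B \<subseteq> ?A"
      proof
        fix v assume "v \<in> ?B"
        then obtain a where a: "v = (i, a)" "1 \<le> a" "a \<le> len i" by blast
        then have "v \<in> mpoly_vars (form 0 i (a - 1))" using 3 by (auto simp: form_jor)
        then show "v \<in> ?A" using a by (intro UN_I[of "a - 1"]) auto
      qed
    qed
    finally show ?thesis using 3 by (auto dest: block_distinct)
  qed
  then show ?thesis unfolding V by (auto simp: is_nilpotent_def is_scroll_def is_jordan_def)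
qed

lemma V_nil: "is_nilpotent i \<Longrightarrow> (i, a) \<in> V \<longleftrightarrow> 1 \<le> a \<and> a < len i"
  and V_scr: "is_scroll i \<Longrightarrow> (i, a) \<in> V \<longleftrightarrow> 1 \<le> a \<and> a \<le> Suc (len i)"
  and V_jor: "is_jordan l i \<Longrightarrow> (i, a) \<in> V \<longleftrightarrow> 1 \<le> a \<and> a \<le> len i"
  using block_distinct(1)[of i] block_distinct(2,3)[of i] unfolding V_iff by blast+

lemma scroll_diff_linear:
  assumes "is_scroll i" "c + j \<le> len i"
  shows "scroll_diff l i c j \<in> linear_forms X"
  using assms(2)
proof (induction c arbitrary: j)
  case 0
  then show ?case using assms(1) by (simp add: Var_linear V_scr)
next
  case (Suc c)
  then show ?case by (simp add: mpoly_component_diff)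
qed

lemma zero_linear: "0 \<in> mpoly_component V d"
  by (simp add: mpoly_component_def)

lemma form_linear: "i < N \<Longrightarrow> form l i a \<in> linear_forms X"
  by (erule block_cases)
    (auto simp: form_nil form_scr form_jor Var_linear V_nil V_jor zero_linear scroll_diff_linear[unfolded One_nat_def])

section \<open>Profile ideals\<close>

definition profile :: "'k \<Rightarrow> (nat \<Rightarrow> nat) \<Rightarrow> (nat \<times> nat, 'k) mpoly set" where
  "profile l c = {form l i a | i a. i < N \<and> c i \<le> a \<and> a \<le> len i}"

lemma profileI: "i < N \<Longrightarrow> c i \<le> a \<Longrightarrow> a \<le> len i \<Longrightarrow> form l i a \<in> profile l c"
  by (auto simp: profile_def)

lemma profile_linear: "profile l c \<subseteq> linear_forms X"
  unfolding profile_def using form_linear by blast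

lemma form_in_profile: "i < N \<Longrightarrow> c i \<le> a \<Longrightarrow> a \<le> len i \<Longrightarrow> form l i a \<in> det_span X (profile l c)"
  by (rule idl.span_base) (auto simp: profile_def)

lemma profile_insert:
  assumes "q < N" "c q = Suc e" "e \<le> len q"
  shows "profile l (c(q := e)) = insert (form l q e) (profile l c)"
proof (intro equalityI subsetI)
  fix f assume "f \<in> profile l (c(q := e))"
  then obtain i a where "f = form l i a" "i < N" "(c(q := e)) i \<le> a" "a \<le> len i"
    by (auto simp: profile_def)
  then show "f \<in> insert (form l q e) (profile l c)"
    using assms(2) by (cases "i = q"; cases "a = e") (auto simp: profile_def)
next
  fix f assume "f \<in> insert (form l q e) (profile l c)"
  then consider "f = form l q e" | i a where "f = form l i a" "i < N" "c i \<le> a" "a \<le> len i"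
    by (auto simp: profile_def)
  then show "f \<in> profile l (c(q := e))"
  proof cases
    case 2
    then have "(c(q := e)) i \<le> a" using assms(2) by auto
    then show ?thesis using 2 unfolding profile_def by blast
  next
    case 1
    moreover have "(c(q := e)) q \<le> e" by simp
    ultimately show ?thesis using assms unfolding profile_def by blast
  qed
qed

text \<open>Expand t^j = (u + l)^j: the constant term gives l^j Y u^c, and all other terms carry a
  higher power of u.\<close>

lemma scroll_diff_span:
  assumes "is_scroll i" "c + j \<le> len i"
  shows "scroll_diff l i c j - Const (l ^ j) * form l i c \<in> ideal_span {form l i a | a. c < a \<and> a \<le> len i}"
  using assms(2)
proof (induction j arbitrary: c)
  case 0
  then show ?case using assms(1) by (simp add: form_scr idl.span_zero)
next
  case (Suc j)
  let ?S = "\<lambda>c. ideal_span {form l i a | a. c < a \<and> a \<le> len i}"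
  have "scroll_diff l i (Suc c) j - Const (l ^ j) * form l i (Suc c) \<in> ?S (Suc c)"
    using Suc.IH[of "Suc c"] Suc.prems by (simp del: scroll_diff.simps)
  then have "scroll_diff l i (Suc c) j - Const (l ^ j) * form l i (Suc c) \<in> ?S c"
    using idl.span_mono[of "{form l i a | a. Suc c < a \<and> a \<le> len i}" "{form l i a | a. c < a \<and> a \<le> len i}"]
    by fastforce
  moreover have "Const (l ^ j) * form l i (Suc c) \<in> ?S c"
    using Suc.prems by (intro idl.span_scale idl.span_base) auto
  ultimately have "scroll_diff l i (Suc c) j \<in> ?S c"
    using idl.span_add by fastforce
  moreover have "Const l * (scroll_diff l i c j - Const (l ^ j) * form l i c) \<in> ?S c"
    using Suc by (intro idl.span_scale) simp
  ultimately have "scroll_diff l i (Suc c) j + Const l * (scroll_diff l i c j - Const (l ^ j) * form l i c) \<in> ?S c"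
    by (rule idl.span_add)
  then show ?case by (simp add: algebra_simps)
qed

lemma Var_in_profile:
  assumes v: "(i, a) \<in> V" and c: "c i = 0"
  shows "Var (i, a) \<in> det_span X (profile l c)"
proof -
  have i: "i < N" using v by (auto simp: V_iff is_nilpotent_def is_scroll_def is_jordan_def)
  have f: "form l i b \<in> det_span X (profile l c)" if "b \<le> len i" for b
    using form_in_profile[OF i _ that] c by simp
  from i show ?thesis
  proof (cases rule: block_cases)
    case 1
    then have "a \<le> len i" "form l i a = Var (i, a)"
      using v by (auto simp: V_iff form_nil dest: block_distinct)
    then show ?thesis using f by metis
  next
    case 2
    then have a: "1 \<le> a" "a - 1 \<le> len i" using v by (auto simp: V_iff dest: block_distinct)
    have "{form l i b |b. 0 < b \<and> b \<le> len i} \<subseteq> det_span X (profile l c)" using f by auto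
    then have "ideal_span {form l i b |b. 0 < b \<and> b \<le> len i} \<subseteq> det_span X (profile l c)"
      by (rule idl.span_minimal) (rule idl.subspace_span)
    then have "scroll_diff l i 0 (a - 1) - Const (l ^ (a - 1)) * form l i 0 \<in> det_span X (profile l c)"
      using scroll_diff_span[OF 2, of 0 "a - 1" l] a by auto
    from idl.span_add[OF this idl.span_scale[OF f[of 0], of "Const (l ^ (a - 1))"]] show ?thesis using a by simp
  next
    case (3 m)
    then have "a - 1 \<le> len i" "form l i (a - 1) = Var (i, a)"
      using v by (auto simp: V_iff form_jor dest: block_distinct)
    then show ?thesis using f by metis
  qed
qed

text \<open>The target variable \<open>Y\<close> of the \<open>i\<close>-th block is \<^term>\<open>Var (i, 1)\<close>, so the constant coefficient is an endomorphism.\<close>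

definition eval_hom :: "'k \<Rightarrow> nat set \<Rightarrow> (nat \<times> nat, 'k) mpoly \<Rightarrow> (nat \<times> nat, 'k) mpoly poly" where
  "eval_hom l L = mpoly_eval (\<lambda>c. [:Const c:]) (\<lambda>(i, a).
     if i \<in> L then if is_scroll i then [:Var (i, Suc 0):] * [:Const l, 1:] ^ (a - 1) else monom (Var (i, Suc 0)) (a - 1) else 0)"

lemma eval_hom_morph: "ring_morph (eval_hom l L)"
  unfolding eval_hom_def by (rule mpoly_eval_morph[OF ring_morph_pConst])

lemmas eval_homD = ring_morphD[OF eval_hom_morph]

lemma eval_hom_Const [simp]: "eval_hom l L (Const c) = [:Const c:]"
  by (simp add: eval_hom_def ring_morph_pConst)

lemma eval_hom_Var: "eval_hom l L (Var (i, a)) =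
    (if i \<in> L then if is_scroll i then [:Var (i, Suc 0):] * [:Const l, 1:] ^ (a - 1) else monom (Var (i, Suc 0)) (a - 1) else 0)"
  by (simp add: eval_hom_def ring_morph_pConst)

text \<open>The point \<open>k\<close> of the substitution and the point \<open>l\<close> of the
  form may differ: with u = t - k, the factor t - l becomes u + (k - l).\<close>

lemma eval_hom_scroll_diff:
  assumes "is_scroll i" "i \<in> L"
  shows "eval_hom k L (scroll_diff l i c j) = [:Var (i, Suc 0):] * ([:Const (k - l), 1:] ^ c * [:Const k, 1:] ^ j)"
proof (induction c arbitrary: j)
  case 0
  then show ?case using assms by (simp add: eval_hom_Var del: mult_pCons_left)
next
  case (Suc c)
  have gen: "y * (b * (a * d)) - c * (y * (b * d)) = y * (b * d * (a - c))"
    for y b a c d :: "(nat \<times> nat, 'k) mpoly poly"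
    by (simp add: algebra_simps)
  have "eval_hom k L (scroll_diff l i (Suc c) j) =
      [:Var (i, Suc 0):] * ([:Const (k - l), 1:] ^ c * [:Const k, 1:] ^ j * ([:Const k, 1:] - [:Const l:]))"
    unfolding scroll_diff.simps eval_homD Suc eval_hom_Const power_Suc by (rule gen)
  also have "[:Const k, 1:] - [:Const l:] = [:Const (k - l), 1:]" by simp
  finally show ?case by (simp add: mult_ac del: mult_pCons_left mult_pCons_right)
qed

lemma eval_hom_dead: "i < N \<Longrightarrow> i \<notin> L \<Longrightarrow> eval_hom k L (form l i a) = 0"
proof (erule block_cases)
  assume i: "i \<notin> L" and s: "is_scroll i"
  have "eval_hom k L (scroll_diff l i c j) = 0" for c j
    by (induction c arbitrary: j) (simp_all add: i eval_hom_Var eval_homD)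
  then show ?thesis using s by (simp add: form_scr eval_homD)
qed (auto simp: form_nil form_jor eval_hom_Var eval_homD)

lemma eval_hom_form_scr:
  "is_scroll i \<Longrightarrow> i \<in> L \<Longrightarrow> a \<le> len i \<Longrightarrow> eval_hom k L (form l i a) = [:Var (i, Suc 0):] * [:Const (k - l), 1:] ^ a"
  by (simp add: form_scr eval_hom_scroll_diff del: mult_pCons_left)

lemma eval_hom_form:
  assumes "is_scroll i \<or> is_jordan l i" "i \<in> L"
  shows "eval_hom l L (form l i a) = (if a < len i \<or> is_scroll i \<and> a = len i then monom (Var (i, Suc 0)) a else 0)"
proof (cases "is_scroll i")
  case True
  have "[:Var (i, Suc 0):] * [:Const (l - l), 1:] ^ a = monom (Var (i, Suc 0)) a"
    by (simp add: monom_altdef)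
  then show ?thesis using True assms eval_hom_form_scr[of i L a l l] by (auto simp: form_scr eval_homD)
next
  case False
  then show ?thesis using assms by (auto simp: form_jor[of l] eval_hom_Var eval_homD)
qed

text \<open>Columns go to (w, (u + l) w), except that the last column of a surviving Jordan block of
  length p lacks the term Y u^p. Hence \<open>d\<close> has to divide u^p.\<close>

lemma eval_hom_minors2:
  assumes is_scroll: "\<And>i. i \<in> L \<Longrightarrow> is_scroll i \<or> is_jordan l i \<and> d dvd monom 1 (len i)"
    and g: "g \<in> minors2 X"
  shows "d dvd eval_hom l L g"
  using eval_hom_morph _ g
proof (rule dvd_morph_minors2[where s = "[:Const l, 1:]"])
  fix a b assume "(a, b) \<in> set X"
  then obtain i where i: "i < N" "(a, b) \<in> set (block_matrix i (bs ! i))" by (auto simp: set_X)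
  have dead: "eval_hom l L a = 0 \<and> eval_hom l L b = 0" if "i \<notin> L"
  proof (use i(1) in \<open>cases rule: block_cases\<close>)
    case 1
    then show ?thesis using i eval_hom_dead[OF i(1) that] by (auto simp: set_X_nil[of i l])
  next
    case 2
    then show ?thesis using i that by (auto simp: set_X_scr eval_hom_Var)
  next
    case (3 m)
    then show ?thesis using i eval_hom_dead[OF i(1) that] by (auto simp: set_X_jor[of m i l] eval_homD)
  qed
  show "d dvd eval_hom l L b - [:Const l, 1:] * eval_hom l L a"
  proof (cases "i \<in> L")
    case True
    then consider "is_scroll i" | "is_jordan l i" "d dvd monom 1 (len i)" using is_scroll by blast
    then show ?thesis
    proof cases
      case 1
      then show ?thesis using i True
        by (auto simp: set_X_scr eval_hom_Var simp del: mult_pCons_left mult_pCons_right)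
    next
      case 2
      then obtain e where e: "e < len i" "a = form l i e" "b = form l i (Suc e) + Const l * form l i e"
        using i by (auto simp: set_X_jor[of l i l])
      let ?m = "monom (Var (i, Suc 0)) (Suc e) :: (nat \<times> nat, 'k) mpoly poly"
      have "[:Const l, 1:] * monom (Var (i, Suc 0)) e = [:Const l:] * monom (Var (i, Suc 0)) e + ?m"
        by (simp add: monom_Suc)
      then have "eval_hom l L b - [:Const l, 1:] * eval_hom l L a = eval_hom l L (form l i (Suc e)) - ?m"
        unfolding e using 2 True e(1) by (simp add: eval_hom_form eval_homD del: mult_pCons_left)
      also have "\<dots> = (if Suc e = len i then - ?m else 0)"
        using 2 True e(1) block_distinct(3)[of i l] by (auto simp: eval_hom_form)
      also have "?m = [:Var (i, Suc 0):] * monom 1 (Suc e)" by (simp add: smult_monom)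
      finally show ?thesis using 2 by (auto simp del: mult_pCons_left)
    qed
  qed (simp add: dead)
qed

text \<open>
  The detector is the substitution modulo \<open>u\<^sup>e\<^sup>+\<^sup>1\<close>: it kills the profile ideal and sends \<open>x\<close> to \<open>Y u\<^sup>e\<close>, so
  \<open>r x = 0\<close> forces \<open>r\<close> to vanish at \<open>u = 0\<close>.
\<close>

theorem profile_colon:
  fixes l q e c
  defines "c' \<equiv> \<lambda>i. if is_nilpotent i \<or> \<not> at_point l i \<or> (c i \<le> e \<and> c i \<le> len i) then 0 else 1"
  assumes q: "is_scroll q \<or> is_jordan l q" "e < len q" "c q = Suc e"
    and is_nilpotent: "\<And>i. is_nilpotent i \<Longrightarrow> c i = 0" and is_jordan: "\<And>m i. is_jordan m i \<Longrightarrow> c i \<le> len i"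
    and is_scroll: "\<And>m i. is_scroll q \<Longrightarrow> is_jordan m i \<Longrightarrow> m \<noteq> l \<Longrightarrow> c i = 0"
    and r: "mpoly_vars r \<subseteq> V"
  shows "r * form l q e \<in> det_span X (profile l c) \<longleftrightarrow> r \<in> det_span X (profile l c')"
proof
  let ?J = "det_span X (profile l c)"
  have qN: "q < N" and q_at: "at_point l q"
    using q(1) block_distinct by (auto simp: is_scroll_def is_jordan_def at_point_def is_nilpotent_def)
  {
    assume "r \<in> det_span X (profile l c')"
    then show "r * form l q e \<in> ?J"
    proof (rule span_mult_closed)
      fix g assume "g \<in> minors2 X \<union> profile l c'"
      then consider "g \<in> minors2 X" | i a where "i < N" "c' i \<le> a" "a \<le> len i" "g = form l i a"
        by (auto simp: profile_def)
      then show "g * form l q e \<in> ?J"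
      proof cases
        case 1
        then have "g \<in> ?J" by (intro idl.span_base) simp
        then show ?thesis by (metis idl.span_scale mult.commute)
      next
        case 2
        have in_J: ?thesis if "c i \<le> a"
          using form_in_profile[of i c a l] that 2 by (metis idl.span_scale mult.commute)
        consider "is_nilpotent i" | m where "is_jordan m i" "m \<noteq> l" | "at_point l i" "\<not> is_nilpotent i"
          using 2(1) by (cases rule: block_cases) (auto simp: at_point_simps block_distinct)
        then show ?thesis
        proof cases
          case 1
          then show ?thesis using in_J is_nilpotent by simp
        next
          case (2 m)
          show ?thesis
          proof (cases "is_scroll q")
            case True
            then show ?thesis using in_J is_scroll 2 by simp
          next
            case False
            then have "is_jordan l q" using q by simp
            from jor_jor[OF 2(1) this 2(2), of a e] show ?thesis
              using 2 \<open>g = _\<close> by (auto simp: form_jor[of m] intro: I2_in)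
          qed
        next
          case 3
          show ?thesis
          proof (cases "c i \<le> e \<and> c i \<le> len i")
            case True
            show ?thesis
            proof (cases "c i \<le> a")
              case False
              \<comment> \<open>The missing powers of u are taken from \<open>form l q e\<close>; it
                has enough of them because \<open>c i \<le> e\<close>.\<close>
              then have "form l i (a + (c i - a)) * form l q (e - (c i - a)) \<in> ?J"
                using True 2(1) by (intro span_scale_right form_in_profile) auto
              then have "form l i a * form l q e \<in> ?J"
                by (rule slide_in[OF 3(1) q_at, where s = "c i - a", rotated -1])
                  (use True False q 2(3) in auto)
              then show ?thesis using 2 by simp
            qed (rule in_J)
          next
            case False
            then have a: "1 \<le> a" using 2(2) 3 by (auto simp: c'_def split: if_splits)
            \<comment> \<open>Here \<open>c' i = 1\<close>, so the other factor can give up one u,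
              which turns \<open>form l q e\<close> into a generator of the ideal.\<close>
            have "form l q (e + 1) * form l i (a - 1) \<in> ?J"
              using q by (intro span_scale_right form_in_profile[OF qN]) auto
            then have "form l q e * form l i a \<in> ?J"
              by (rule slide_in[OF q_at 3(1), where s = 1, rotated -1])
                (use a q 2(3) in auto)
            then show ?thesis using 2 by (simp add: mult.commute)
          qed
        qed
      qed
    qed
  }
  assume rJ: "r * form l q e \<in> ?J"
  \<comment> \<open>Exactly the blocks with \<open>c' i = 1\<close>. All other variables lie in the
    claimed colon ideal, so the substitution may kill them.\<close>
  define L where "L = {i. (is_scroll i \<or> is_jordan l i) \<and> \<not> (c i \<le> e \<and> c i \<le> len i)}"
  define D :: "(nat \<times> nat, 'k) mpoly poly" where "D = monom 1 (Suc e)"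
  have D: "D dvd monom a b" if "Suc e \<le> b" for a b
  proof -
    have "monom a b = D * monom a (b - Suc e)" using that by (simp add: D_def mult_monom)
    then show ?thesis by simp
  qed
  have qL: "q \<in> L" using q by (simp add: L_def)
  have c'L: "i \<in> L \<longleftrightarrow> c' i = 1" if "i < N" for i
    using that by (cases rule: block_cases) (auto simp: L_def c'_def at_point_simps dest: block_distinct)
  have "D dvd eval_hom l L (r * form l q e)"
    using eval_hom_morph rJ
  proof (rule dvd_morph_span)
    fix g assume "g \<in> minors2 X \<union> profile l c"
    then consider "g \<in> minors2 X" | i a where "i < N" "c i \<le> a" "a \<le> len i" "g = form l i a"
      by (auto simp: profile_def)
    then show "D dvd eval_hom l L g"
    proof cases
      case 1
      show ?thesis
      proof (rule eval_hom_minors2[OF _ 1])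
        fix i assume "i \<in> L"
        then have "is_scroll i \<or> is_jordan l i \<and> Suc e \<le> len i" using is_jordan[of l i] by (auto simp: L_def)
        then show "is_scroll i \<or> is_jordan l i \<and> D dvd monom 1 (len i)" using D by blast
      qed
    next
      case 2
      show ?thesis
      proof (cases "i \<in> L")
        case True
        then have "is_scroll i \<or> is_jordan l i" "Suc e \<le> a" using 2 by (auto simp: L_def)
        then show ?thesis using 2 True D by (simp add: eval_hom_form)
      qed (use 2 eval_hom_dead in simp)
    qed
  qed
  also have "eval_hom l L (r * form l q e) = eval_hom l L r * monom (Var (q, Suc 0)) e"
    using q qL by (simp add: eval_homD eval_hom_form)
  finally obtain s where s: "eval_hom l L r * monom (Var (q, Suc 0)) e = D * s" by (auto elim: dvdE)
  have "coeff (eval_hom l L r * monom (Var (q, Suc 0)) e) e = coeff (eval_hom l L r) 0 * Var (q, Suc 0)"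
    by (simp add: coeff_monom_mult mult.commute[of "eval_hom l L r"] mult.commute[of "coeff _ _"])
  moreover have "coeff (D * s) e = 0" by (simp add: D_def coeff_monom_mult)
  moreover have "Var (q, Suc 0) \<noteq> (0 :: (nat \<times> nat, 'k) mpoly)"
    unfolding Var_def by (metis keys_single keys_zero empty_iff insertI1 zero_neq_one)
  \<comment> \<open>The polynomial ring is a domain: the lexicographic order on the variables makes
    the exponent vectors a linearly ordered monoid.\<close>
  ultimately have r0: "coeff (eval_hom l L r) 0 = 0" using s by simp
  \<comment> \<open>Setting u = 0 changes a variable only by forms with a positive power of u or
    from blocks outside \<open>L\<close>, and these lie in the colon ideal.\<close>
  have "r - coeff (eval_hom l L r) 0 \<in> det_span X (profile l c')"
  proof (rule morph_congruence[OF ring_morph_coeff_0[OF eval_hom_morph] _ _ r])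
    fix v assume v: "v \<in> V"
    obtain i a where ia: "v = (i, a)" by fastforce
    then have iN: "i < N" and a: "1 \<le> a" using v by (auto simp: V_iff is_nilpotent_def is_scroll_def is_jordan_def)
    show "Var v - coeff (eval_hom l L (Var v)) 0 \<in> det_span X (profile l c')"
    proof (cases "i \<in> L")
      case False
      then have "c' i = 0" using c'L[OF iN] by (auto simp: c'_def split: if_splits)
      then show ?thesis using Var_in_profile v ia False by (simp add: eval_hom_Var)
    next
      case True
      then have c': "c' i = 1" using c'L[OF iN] by simp
      show ?thesis
      proof (cases "is_scroll i")
        case s: True
        have a': "a - 1 \<le> len i" using v ia s by (auto simp: V_iff dest: block_distinct)
        have "coeff ([:Var (i, Suc 0):] * [:Const l, 1:] ^ (a - 1)) 0 = Const (l ^ (a - 1)) * (Var (i, Suc 0) :: (nat \<times> nat, 'k) mpoly)"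
        proof -
          have "coeff ([:Const l, 1:] ^ n) 0 = (Const (l ^ n) :: (nat \<times> nat, 'k) mpoly)" for n
            by (induction n) (simp_all add: coeff_mult_0 del: mult_pCons_left)
          then show ?thesis by (simp add: coeff_mult_0 mult.commute del: mult_pCons_left)
        qed
        then have "Var v - coeff (eval_hom l L (Var v)) 0 =
            scroll_diff l i 0 (a - 1) - Const (l ^ (a - 1)) * form l i 0"
          using True s ia a by (simp add: eval_hom_Var form_scr del: mult_pCons_left)
        also have "\<dots> \<in> ideal_span {form l i b |b. 0 < b \<and> b \<le> len i}"
          using scroll_diff_span[OF s, of 0 "a - 1" l] a' by simp
        also have "\<dots> \<subseteq> det_span X (profile l c')"
          using c' iN by (intro idl.span_mono) (auto intro: profileI)
        finally show ?thesis .
      next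
        case False
        then have j: "is_jordan l i" using True by (auto simp: L_def)
        then have al: "a \<le> len i" using v ia by (auto simp: V_iff dest: block_distinct)
        have "Var v \<in> det_span X (profile l c')" if "a \<noteq> 1"
        proof -
          from that a have "a = Suc (Suc (a - 2))" by simp
          then obtain b where b: "a = Suc (Suc b)" by blast
          then have "form l i (Suc b) = Var v" using j al ia by (simp add: form_jor)
          then show ?thesis using al b c' form_in_profile[OF iN, of c' "Suc b" l] by simp
        qed
        then show ?thesis
          using False True ia a by (cases "a = 1") (simp_all add: eval_hom_Var idl.span_zero)
      qed
    qed
  qed simp
  then show "r \<in> det_span X (profile l c')" using r0 by simp
qed

end

section \<open>The coordinate ring of a scroll\<close>

lemma Const_sum: "Const (sum f A) = (\<Sum>x\<in>A. Const (f x))"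
  by (induction A rule: infinite_finite_induct) simp_all

context block_concat
begin

lemma scroll_diff_0: "scroll_diff 0 i c j = Var (i, Suc (c + j))"
  by (induction c arbitrary: j) simp_all

lemma form_0_scr: "is_scroll i \<Longrightarrow> a \<le> len i \<Longrightarrow> form 0 i a = Var (i, Suc a)"
  by (simp add: form_scr scroll_diff_0)

text \<open>A class of monomials is given by the multidegree \<open>block_exp\<close> in the blocks and the exponent \<open>weight\<close> of \<open>t\<close>.\<close>

definition live :: "nat set \<Rightarrow> (nat \<times> nat \<Rightarrow>\<^sub>0 nat) \<Rightarrow> bool" where
  "live L t \<longleftrightarrow> (\<forall>v\<in>keys t. v \<in> V \<and> fst v \<in> L)"

definition block_exp :: "(nat \<times> nat \<Rightarrow>\<^sub>0 nat) \<Rightarrow> nat \<times> nat \<Rightarrow>\<^sub>0 nat" where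
  "block_exp t = (\<Sum>v\<in>keys t. single (fst v, Suc 0) (lookup t v))"

definition weight :: "(nat \<times> nat \<Rightarrow>\<^sub>0 nat) \<Rightarrow> nat" where
  "weight t = (\<Sum>v\<in>keys t. (snd v - 1) * lookup t v)"

lemma live_add: "live L (s + t) \<longleftrightarrow> live L s \<and> live L t"
  by (auto simp: live_def keys_exp_add)

lemma live_single: "live L (single v 1) \<longleftrightarrow> v \<in> V \<and> fst v \<in> L"
  by (simp add: live_def)

lemma block_exp_add: "block_exp (s + t) = block_exp s + block_exp t"
  unfolding block_exp_def by (rule setsum_keys_plus_distrib) (simp_all add: single_add)

lemma weight_add: "weight (s + t) = weight s + weight t"
  unfolding weight_def by (rule setsum_keys_plus_distrib) (simp_all add: distrib_left)

lemma block_exp_single: "block_exp (single (i, a) 1) = single (i, Suc 0) 1"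
  and weight_single: "weight (single (i, a) 1) = a - 1"
  by (simp_all add: block_exp_def weight_def)

lemmas exp_simps = live_add live_single block_exp_add weight_add block_exp_single weight_single

lemma degree_block_exp: "monom_degree (block_exp t) = monom_degree t"
proof (induction t rule: exp_induct)
  case zero
  then show ?case by (simp add: block_exp_def)
next
  case (step v t)
  then show ?case by (cases v) (simp add: exp_simps del: One_nat_def)
qed

text \<open>Weight passes from \<open>s\<close> to the factor of block \<open>j\<close> one unit at
  a time, until that factor is full or \<open>s\<close> has no weight left.\<close>

lemma push:
  assumes L: "\<And>i. i \<in> L \<Longrightarrow> is_scroll i" and j: "j \<in> L" and "live L s" "b \<le> len j"
  shows "\<exists>s'. live L s' \<and> weight s' + min (len j) (b + weight s) = b + weight s \<and> block_exp s' = block_exp s \<and>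
    Var (j, Suc b) * Mon s - Var (j, Suc (min (len j) (b + weight s))) * Mon s' \<in> I2"
  using assms(3,4)
proof (induction "len j - b" arbitrary: b s)
  case 0
  then have "min (len j) (b + weight s) = b" by simp
  then show ?case using 0 by (intro exI[of _ s]) (simp add: idl.span_zero)
next
  case (Suc d)
  show ?case
  proof (cases "weight s = 0")
    case True
    then show ?thesis using Suc by (intro exI[of _ s]) (simp add: idl.span_zero)
  next
    case False
    then obtain v where v: "v \<in> keys s" "snd v - 1 \<noteq> 0" by (auto simp: weight_def)
    define k a where "k = fst v" and "a = snd v - 2"
    have v': "v = (k, Suc (Suc a))" using v(2) by (cases v) (simp add: k_def a_def)
    define s0 where "s0 = s - single v 1"
    have s: "s = single (k, Suc (Suc a)) 1 + s0" unfolding s0_def v'[symmetric] by (rule exp_split[OF v(1)])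
    have k: "k \<in> L" "(k, Suc (Suc a)) \<in> V" "live L s0" using Suc.prems(1) unfolding s by (simp_all add: exp_simps del: One_nat_def)
    then have a: "a < len k" using L by (simp add: V_scr)
    define s1 where "s1 = single (k, Suc a) 1 + s0"
    have s1: "live L s1" "weight s = Suc (weight s1)" "block_exp s1 = block_exp s"
      using k a L unfolding s s1_def by (simp_all add: exp_simps V_scr del: One_nat_def)
    have "d = len j - Suc b" "Suc b \<le> len j" using Suc.hyps(2) by simp_all
    from Suc.hyps(1)[OF this(1) s1(1) this(2)] obtain s' where s': "live L s'"
      "weight s' + min (len j) (Suc b + weight s1) = Suc b + weight s1" "block_exp s' = block_exp s1"
      "Var (j, Suc (Suc b)) * Mon s1 - Var (j, Suc (min (len j) (Suc b + weight s1))) * Mon s' \<in> I2"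
      by blast
    have "Var (j, Suc b) * Var (k, Suc (Suc a)) - Var (j, Suc (Suc b)) * Var (k, Suc a) \<in> I2"
      using form_rel[of 0 j k b a] L[OF j] L[OF k(1)] a \<open>Suc b \<le> len j\<close>
      by (simp add: at_point_simps form_0_scr)
    then have "Mon s0 * (Var (j, Suc b) * Var (k, Suc (Suc a)) - Var (j, Suc (Suc b)) * Var (k, Suc a)) \<in> I2"
      by (rule idl.span_scale)
    also have "Mon s0 * (Var (j, Suc b) * Var (k, Suc (Suc a)) - Var (j, Suc (Suc b)) * Var (k, Suc a)) =
        Var (j, Suc b) * Mon s - Var (j, Suc (Suc b)) * Mon s1"
      unfolding s s1_def Mon_add Var_eq_Mon[symmetric] by (simp add: algebra_simps)
    finally have "Var (j, Suc b) * Mon s - Var (j, Suc (min (len j) (Suc b + weight s1))) * Mon s' \<in> I2"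
      using idl.span_add[OF _ s'(4)] by fastforce
    then show ?thesis using s' s1 by (intro exI[of _ s']) simp
  qed
qed

text \<open>The factor split off depends only on \<open>j\<close> and the weight of
  \<open>t\<close>, not on \<open>t\<close> itself; this is what makes normal forms
  possible.\<close>

lemma pull_out:
  assumes L: "\<And>i. i \<in> L \<Longrightarrow> is_scroll i" and "live L t" "(j, b) \<in> keys t"
  shows "\<exists>s. live L s \<and> weight s + min (len j) (weight t) = weight t \<and> single (j, Suc 0) 1 + block_exp s = block_exp t \<and>
    Mon t - Var (j, Suc (min (len j) (weight t))) * Mon s \<in> I2"
proof -
  have jb: "j \<in> L" "(j, b) \<in> V" using assms(2,3) by (auto simp: live_def)
  then have b: "1 \<le> b" "b - 1 \<le> len j" using L by (auto simp: V_scr)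
  define s where "s = t - single (j, b) 1"
  have t: "t = single (j, b) 1 + s" unfolding s_def by (rule exp_split[OF assms(3)])
  have "live L s" using assms(2) unfolding t by (simp add: exp_simps)
  from push[OF L jb(1) this b(2)] obtain s' where
    "live L s'" "weight s' + min (len j) (b - 1 + weight s) = b - 1 + weight s" "block_exp s' = block_exp s"
    "Var (j, Suc (b - 1)) * Mon s - Var (j, Suc (min (len j) (b - 1 + weight s))) * Mon s' \<in> I2"
    by blast
  moreover have "weight t = b - 1 + weight s" "block_exp t = single (j, Suc 0) 1 + block_exp s"
    unfolding t by (simp_all add: exp_simps del: One_nat_def)
  moreover have "Mon t = Var (j, Suc (b - 1)) * (Mon s :: (nat \<times> nat, 'k) mpoly)"
    using b unfolding t Mon_add Var_eq_Mon by simp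
  ultimately show ?thesis by metis
qed

text \<open>Both monomials meet the same blocks, so \<open>pull_out\<close> splits the same factor
  off both; the remainders agree in class again and have smaller degree.\<close>

lemma same_class:
  assumes L: "\<And>i. i \<in> L \<Longrightarrow> is_scroll i"
  shows "live L s \<Longrightarrow> live L t \<Longrightarrow> block_exp s = block_exp t \<Longrightarrow> weight s = weight t \<Longrightarrow> Mon s - Mon t \<in> I2"
proof (induction "monom_degree s" arbitrary: s t)
  case 0
  then have "monom_degree t = 0" using degree_block_exp by metis
  then show ?case using 0 by (simp add: idl.span_zero)
next
  case (Suc n)
  then obtain j b where jb: "(j, b) \<in> keys s" by (metis all_not_in_conv keys_eq_empty monom_degree_simps(1) nat.distinct(1) surj_pair)
  have "lookup (block_exp s) (j, Suc 0) \<noteq> 0"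
    by (subst exp_split[OF jb]) (simp only: block_exp_add block_exp_single lookup_add, simp)
  then have "(\<Sum>v\<in>keys t. lookup (single (fst v, Suc 0) (lookup t v)) (j, Suc 0)) \<noteq> 0"
    unfolding Suc.prems(3) by (simp add: block_exp_def lookup_sum)
  then obtain v where v: "v \<in> keys t" "lookup (single (fst v, Suc 0) (lookup t v)) (j, Suc 0) \<noteq> 0"
    by (meson sum.neutral)
  then obtain b' where jb': "(j, b') \<in> keys t" by (cases v) (auto simp: lookup_single when_def split: if_splits)
  obtain s1 where s1: "live L s1" "weight s1 + min (len j) (weight s) = weight s"
      "single (j, Suc 0) 1 + block_exp s1 = block_exp s"
      "Mon s - Var (j, Suc (min (len j) (weight s))) * Mon s1 \<in> I2"
    using pull_out[OF L Suc.prems(1) jb] by blast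
  obtain t1 where t1: "live L t1" "weight t1 + min (len j) (weight t) = weight t"
      "single (j, Suc 0) 1 + block_exp t1 = block_exp t"
      "Mon t - Var (j, Suc (min (len j) (weight t))) * Mon t1 \<in> I2"
    using pull_out[OF L Suc.prems(2) jb'] by blast
  have w: "weight s1 = weight t1" using s1(2) t1(2) Suc.prems(4) by simp
  have bl: "block_exp s1 = block_exp t1" using s1(3) t1(3) Suc.prems(3) by (metis add_left_imp_eq)
  have "monom_degree s = 1 + monom_degree s1"
    using degree_block_exp[of s] degree_block_exp[of s1] s1(3) by (metis monom_degree_add monom_degree_simps(2))
  then have "Mon s1 - Mon t1 \<in> I2" using Suc.hyps s1(1) t1(1) bl w by simp
  then have "Var (j, Suc (min (len j) (weight s))) * (Mon s1 - Mon t1) \<in> I2" by (rule idl.span_scale)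
  from idl.span_diff[OF idl.span_add[OF s1(4) this] t1(4)] show ?case
    using Suc.prems(4) by (simp add: algebra_simps)
qed

text \<open>\<open>block_exp\<close> is a vector in the variables \<open>(i, 1)\<close>, the targets
  of the substitution, so the image of a surviving monomial records precisely its class.\<close>

lemma eval_hom_Mon:
  assumes L: "\<And>i. i \<in> L \<Longrightarrow> is_scroll i"
  shows "eval_hom 0 L (Mon t) = (if \<forall>v\<in>keys t. fst v \<in> L then monom (Mon (block_exp t)) (weight t) else 0)"
proof (induction t rule: exp_induct)
  case zero
  then show ?case by (simp add: eval_homD block_exp_def weight_def)
next
  case (step v t)
  obtain i a where v: "v = (i, a)" by fastforce
  have "eval_hom 0 L (Var v) = (if i \<in> L then monom (Var (i, Suc 0)) (a - 1) else 0)"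
    using L by (auto simp: v eval_hom_Var monom_altdef)
  moreover have "Mon (single v 1 + t) = Var v * (Mon t :: (nat \<times> nat, 'k) mpoly)" by (simp only: Mon_add Var_eq_Mon)
  ultimately have "eval_hom 0 L (Mon (single v 1 + t)) =
      (if i \<in> L then monom (Var (i, Suc 0)) (a - 1) else 0) * eval_hom 0 L (Mon t)"
    using eval_homD(2)[of 0 L "Var v" "Mon t"] by presburger
  then show ?case
    unfolding step v exp_simps Mon_add Var_eq_Mon[symmetric]
    by (auto simp: keys_exp_add mult_monom)
qed

text \<open>Distinct classes have distinct images, so nothing cancels between classes.\<close>

lemma eval_hom_coeff:
  assumes L: "\<And>i. i \<in> L \<Longrightarrow> is_scroll i" and r: "mpoly_vars r \<subseteq> V"
  shows "lookup (coeff (eval_hom 0 L r) w) e =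
    (\<Sum>t | t \<in> keys r \<and> live L t \<and> weight t = w \<and> block_exp t = e. lookup r t)"
proof -
  have lv: "live L t \<longleftrightarrow> (\<forall>v\<in>keys t. fst v \<in> L)" if "t \<in> keys r" for t
    using that r by (auto simp: live_def mpoly_vars_def)
  have "eval_hom 0 L r = (\<Sum>t\<in>keys r. [:Const (lookup r t):] * eval_hom 0 L (Mon t))"
  proof -
    have sum: "eval_hom 0 L (\<Sum>t\<in>A. f t) = (\<Sum>t\<in>A. eval_hom 0 L (f t))" for A f
      by (induction A rule: infinite_finite_induct) (simp_all add: eval_homD)
    have "eval_hom 0 L r = eval_hom 0 L (\<Sum>t\<in>keys r. Const (lookup r t) * Mon t)"
      by (simp flip: mpoly_expand)
    then show ?thesis by (simp only: sum eval_homD eval_hom_Const)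
  qed
  also have "\<dots> = (\<Sum>t\<in>keys r. if live L t then monom (single (block_exp t) (lookup r t)) (weight t) else 0)"
    by (intro sum.cong refl) (simp add: eval_hom_Mon[OF L] lv smult_monom Const_mult_Mon)
  also have "lookup (coeff \<dots> w) e =
      (\<Sum>t\<in>keys r. if live L t \<and> weight t = w \<and> block_exp t = e then lookup r t else 0)"
    by (auto simp: coeff_sum lookup_sum lookup_single when_def intro!: sum.cong)
  also have "\<dots> = (\<Sum>t | t \<in> keys r \<and> live L t \<and> weight t = w \<and> block_exp t = e. lookup r t)"
    by (simp add: sum.inter_filter)
  finally show ?thesis .
qed

text \<open>
  By \<open>same_class\<close>, \<open>r\<close> is congruent to a combination of one monomial for each class, whose coefficients can be
  read off from the image of \<open>r\<close>.
\<close>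

lemma eval_hom_kernel:
  assumes L: "\<And>i. i \<in> L \<Longrightarrow> is_scroll i" and r: "mpoly_vars r \<subseteq> V"
    and dead: "\<And>v. v \<in> V \<Longrightarrow> fst v \<notin> L \<Longrightarrow> Var v \<in> det_span X T"
    and coeff: "\<And>w. coeff (eval_hom 0 L r) w \<noteq> 0 \<Longrightarrow> g \<le> w"
    and high: "\<And>t. coeff (eval_hom 0 L r) (weight t) \<noteq> 0 \<Longrightarrow> live L t \<Longrightarrow> g \<le> weight t \<Longrightarrow> Mon t \<in> det_span X T"
  shows "r \<in> det_span X T"
proof -
  define A where "A = {t \<in> keys r. live L t}"
  define cls where "cls t = (weight t, block_exp t)" for t
  define rep where "rep k = (SOME t. live L t \<and> cls t = k)" for k
  have fin: "finite A" by (simp add: A_def)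
  have rep: "live L (rep (cls t)) \<and> cls (rep (cls t)) = cls t" if "live L t" for t
    unfolding rep_def using that by (rule_tac someI[of _ t]) simp
  have "(\<Sum>t\<in>A. Const (lookup r t) * Mon (rep (cls t))) =
      (\<Sum>k\<in>cls ` A. \<Sum>t | t \<in> A \<and> cls t = k. Const (lookup r t) * Mon (rep (cls t)))"
    by (rule sum.image_gen[OF fin])
  also have "\<dots> \<in> det_span X T"
  proof (rule idl.span_sum)
    fix k assume "k \<in> cls ` A"
    then obtain u where u: "live L u" "cls u = k" by (auto simp: A_def)
    have "(\<Sum>t | t \<in> A \<and> cls t = k. Const (lookup r t) * Mon (rep (cls t))) =
        Const (\<Sum>t | t \<in> A \<and> cls t = k. lookup r t) * Mon (rep k)"
      by (simp add: sum_distrib_right Const_sum)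
    moreover have "{t. t \<in> A \<and> cls t = k} = {t. t \<in> keys r \<and> live L t \<and> weight t = fst k \<and> block_exp t = snd k}"
      by (auto simp: A_def cls_def)
    ultimately have "(\<Sum>t | t \<in> A \<and> cls t = k. Const (lookup r t) * Mon (rep (cls t))) =
        Const (lookup (coeff (eval_hom 0 L r) (fst k)) (snd k)) * Mon (rep k)"
      by (simp only: eval_hom_coeff[OF L r])
    also have "Const (lookup (coeff (eval_hom 0 L r) (fst k)) (snd k)) * Mon (rep k) \<in> det_span X T"
    proof (cases "coeff (eval_hom 0 L r) (fst k) = 0")
      case True
      then show ?thesis by (simp add: idl.span_zero)
    next
      case False
      have "live L (rep k)" "weight (rep k) = fst k" using rep[OF u(1)] u(2) by (auto simp: cls_def)
      then have "Mon (rep k) \<in> det_span X T" using False coeff by (intro high) auto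
      then show ?thesis by (rule idl.span_scale)
    qed
    finally show "(\<Sum>t | t \<in> A \<and> cls t = k. Const (lookup r t) * Mon (rep (cls t))) \<in> det_span X T" .
  qed
  finally have 1: "(\<Sum>t\<in>A. Const (lookup r t) * Mon (rep (cls t))) \<in> det_span X T" .
  have 2: "(\<Sum>t\<in>A. Const (lookup r t) * (Mon t - Mon (rep (cls t)))) \<in> det_span X T"
  proof (intro idl.span_sum idl.span_scale I2_in)
    fix t assume "t \<in> A"
    then have "live L t" by (simp add: A_def)
    with rep[OF this] show "Mon t - Mon (rep (cls t)) \<in> I2"
      by (intro same_class[OF L]) (auto simp: cls_def)
  qed
  have 3: "(\<Sum>t\<in>keys r - A. Const (lookup r t) * Mon t) \<in> det_span X T"
  proof (intro idl.span_sum idl.span_scale)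
    fix t assume "t \<in> keys r - A"
    then obtain v where v: "v \<in> keys t" "v \<in> V" "fst v \<notin> L"
      using r by (auto simp: A_def live_def mpoly_vars_def)
    have "Mon t = Mon (t - single v 1) * (Var v :: (nat \<times> nat, 'k) mpoly)"
      unfolding Var_eq_Mon Mon_add[symmetric] using exp_split[OF v(1)] by (simp add: add.commute)
    then show "Mon t \<in> det_span X T" using dead[OF v(2,3)] by (metis idl.span_scale)
  qed
  \<comment> \<open>Three parts: monomials with a killed variable, differences from class
    representatives, and representatives with the coefficients of the image of
    \<open>r\<close>.\<close>
  have "r = (\<Sum>t\<in>keys r - A. Const (lookup r t) * Mon t) + (\<Sum>t\<in>A. Const (lookup r t) * Mon t)"
    using sum.subset_diff[of A "keys r" "\<lambda>t. Const (lookup r t) * Mon t"] mpoly_expand[of r] by (simp add: A_def)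
  moreover have "(\<Sum>t\<in>A. Const (lookup r t) * Mon t) =
      (\<Sum>t\<in>A. Const (lookup r t) * (Mon t - Mon (rep (cls t)))) + (\<Sum>t\<in>A. Const (lookup r t) * Mon (rep (cls t)))"
    by (simp add: sum.distrib[symmetric] algebra_simps)
  moreover note idl.span_add[OF 3 idl.span_add[OF 2 1]]
  ultimately show ?thesis by simp
qed

lemma eval_hom_minors2_zero:
  assumes "\<And>i. i \<in> L \<Longrightarrow> is_scroll i" "g \<in> minors2 X"
  shows "eval_hom l L g = 0"
  using eval_hom_minors2[of L l 0 g] assms by simp

text \<open>The ideal without \<open>x\<close> contains no form of block \<open>q\<close>, so
  truncating powers of u detects nothing. Instead, the scroll blocks without forms in the ideal are
  mapped to a domain in which \<open>x\<close> survives; hence \<open>r\<close> maps to zero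
  there.\<close>

theorem profile_colon_fresh:
  fixes l q c
  defines "c' \<equiv> \<lambda>i. if is_scroll i \<and> len i < c i then Suc (len i) else 0"
  assumes q: "is_scroll q" "c q = Suc (len q)"
    and is_nilpotent: "\<And>i. is_nilpotent i \<Longrightarrow> c i = 0" and is_jordan: "\<And>m i. is_jordan m i \<Longrightarrow> c i \<le> len i \<and> c i \<le> len q"
    and jor': "\<And>m i. is_jordan m i \<Longrightarrow> m \<noteq> l \<Longrightarrow> c i = 0"
    and is_scroll: "\<And>i. is_scroll i \<Longrightarrow> c i \<le> len i \<Longrightarrow> c i \<le> len q"
    and r: "mpoly_vars r \<subseteq> V"
  shows "r * form l q (len q) \<in> det_span X (profile l c) \<longleftrightarrow> r \<in> det_span X (profile l c')"
proof
  let ?J = "det_span X (profile l c)" and ?x = "form l q (len q)"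
  have qN: "q < N" and q_at: "at_point l q" using q(1) by (auto simp: is_scroll_def at_point_def)
  {
    assume "r \<in> det_span X (profile l c')"
    then show "r * ?x \<in> ?J"
    proof (rule span_mult_closed)
      fix g assume "g \<in> minors2 X \<union> profile l c'"
      then consider "g \<in> minors2 X" | i a where "i < N" "c' i \<le> a" "a \<le> len i" "g = form l i a"
        by (auto simp: profile_def)
      then show "g * ?x \<in> ?J"
      proof cases
        case 1
        then have "g \<in> ?J" by (intro idl.span_base) simp
        then show ?thesis by (rule span_scale_right)
      next
        case 2
        have in_J: ?thesis if "c i \<le> a"
          using form_in_profile[of i c a l] that 2 by (auto intro: span_scale_right)
        have cl: "c i \<le> len i" using 2(2,3) by (auto simp: c'_def is_nilpotent is_jordan split: if_splits intro: ccontr dest: block_distinct)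
            (metis 2(1) block_cases is_jordan le0 is_nilpotent not_le)
        consider "is_nilpotent i" | m where "is_jordan m i" "m \<noteq> l" | "at_point l i" "c i \<le> len q"
          using 2(1) cl is_jordan is_scroll by (cases rule: block_cases) (auto simp: at_point_simps)
        then show ?thesis
        proof cases
          case 3
          show ?thesis
          proof (cases "c i \<le> a")
            case False
            \<comment> \<open>The bounds by \<open>len q\<close> in the hypotheses ensure that the
              last form of \<open>q\<close> has enough powers of u to lend.\<close>
            then have "form l i (a + (c i - a)) * form l q (len q - (c i - a)) \<in> ?J"
              using cl 2(1) by (intro span_scale_right form_in_profile) auto
            then have "form l i a * ?x \<in> ?J"
              by (rule slide_in[OF 3(1) q_at, where s = "c i - a", rotated -1])
                (use False cl 3 in auto)
            then show ?thesis using 2 by simp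
          qed (rule in_J)
        qed (use in_J is_nilpotent jor' in auto)
      qed
    qed
  }
  assume rJ: "r * ?x \<in> ?J"
  define L where "L = {i. is_scroll i \<and> len i < c i}"
  have Ls: "\<And>i. i \<in> L \<Longrightarrow> is_scroll i" by (simp add: L_def)
  have "0 dvd eval_hom 0 L (r * ?x)"
    using eval_hom_morph rJ
  proof (rule dvd_morph_span)
    fix g assume "g \<in> minors2 X \<union> profile l c"
    then consider "g \<in> minors2 X" | i a where "i < N" "c i \<le> a" "a \<le> len i" "g = form l i a"
      by (auto simp: profile_def)
    then show "0 dvd eval_hom 0 L g"
    proof cases
      case 2
      then have "i \<notin> L" by (auto simp: L_def)
      then show ?thesis using 2 eval_hom_dead by simp
    qed (use eval_hom_minors2_zero[OF Ls] in simp)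
  qed
  then have "eval_hom 0 L r * eval_hom 0 L ?x = 0" by (simp add: eval_homD)
  \<comment> \<open>The substitution is at 0 because the kernel lemma concerns powers of t; the form
    at \<open>l\<close> becomes Y (t - l)^n.\<close>
  moreover have "eval_hom 0 L ?x \<noteq> 0"
  proof -
    have "Var (q, Suc 0) \<noteq> (0 :: (nat \<times> nat, 'k) mpoly)"
      unfolding Var_def by (metis keys_single keys_zero empty_iff insertI1 zero_neq_one)
    then show ?thesis using q eval_hom_form_scr[of q L "len q" 0 l] by (simp add: L_def)
  qed
  ultimately have r0: "eval_hom 0 L r = 0" by simp
  show "r \<in> det_span X (profile l c')"
  proof (rule eval_hom_kernel[OF Ls r, where g = 0])
    fix v assume "v \<in> V" "fst v \<notin> L"
    then show "Var v \<in> det_span X (profile l c')"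
      by (cases v) (auto simp: L_def c'_def intro!: Var_in_profile)
  qed (simp_all add: r0)
qed

end

section \<open>Ideals with gaps\<close>

lemma linear_form_lookup_0: "p \<in> mpoly_component V (Suc 0) \<Longrightarrow> lookup p 0 = 0"
  unfolding mpoly_component_iff by (metis in_keys_iff monom_degree_simps(1) nat.distinct(1))

definition hom_part :: "nat \<Rightarrow> ('v, 'k::comm_ring_1) mpoly \<Rightarrow> ('v, 'k) mpoly" where
  "hom_part n p = (\<Sum>t | t \<in> keys p \<and> monom_degree t = n. single t (lookup p t))"

lemma lookup_hom_part: "lookup (hom_part n p) t = (if monom_degree t = n then lookup p t else 0)"
proof -
  have "lookup (hom_part n p) t = (\<Sum>s | s \<in> keys p \<and> monom_degree s = n. if s = t then lookup p t else 0)"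
    unfolding hom_part_def lookup_sum by (intro sum.cong) (auto simp: lookup_single when_def)
  also have "\<dots> = (if t \<in> {s \<in> keys p. monom_degree s = n} then lookup p t else 0)"
    by (subst sum.delta) simp_all
  finally show ?thesis by (auto simp: in_keys_iff)
qed

lemma hom_part_add: "hom_part n (p + q) = hom_part n p + hom_part n q"
  by (rule poly_mapping_eqI) (simp add: lookup_hom_part lookup_add)

lemma hom_part_0: "hom_part n 0 = 0"
  by (rule poly_mapping_eqI) (simp add: lookup_hom_part)

lemma hom_part_sum: "hom_part n (\<Sum>i\<in>A. f i) = (\<Sum>i\<in>A. hom_part n (f i))"
  by (induction A rule: infinite_finite_induct) (simp_all add: hom_part_add hom_part_0)

lemma hom_part_mult:
  assumes g: "\<And>t. t \<in> keys g \<Longrightarrow> monom_degree t = d"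
  shows "hom_part (n + d) (s * g) = hom_part n s * g"
proof -
  have single: "hom_part (n + d) (single a x * g) = hom_part n (single a x) * g" for a x
  proof -
    have key: "monom_degree t = monom_degree a + d" if "t \<in> keys (single a x * g)" for t
      using that keys_mult[of "single a x" g] g by (auto split: if_splits)
    have "hom_part (n + d) (single a x * g) = (if monom_degree a = n then single a x * g else 0)"
    proof (rule poly_mapping_eqI)
      fix t
      show "lookup (hom_part (n + d) (single a x * g)) t = lookup (if monom_degree a = n then single a x * g else 0) t"
        using key[of t] by (cases "t \<in> keys (single a x * g)") (auto simp: lookup_hom_part in_keys_iff)
    qed
    moreover have "hom_part n (single a x) = (if monom_degree a = n then single a x else 0)"
      by (intro poly_mapping_eqI) (auto simp: lookup_hom_part lookup_single when_def)
    ultimately show ?thesis by simp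
  qed
  have "hom_part (n + d) (s * g) = hom_part (n + d) ((\<Sum>t\<in>keys s. single t (lookup s t)) * g)"
    by (simp flip: poly_mapping_expand)
  also have "\<dots> = hom_part n (\<Sum>t\<in>keys s. single t (lookup s t)) * g"
    by (simp only: sum_distrib_right hom_part_sum single)
  finally show ?thesis by (simp flip: poly_mapping_expand)
qed

lemma lookup_mult_Mon: "lookup (p * Mon s) (t + s) = lookup (p :: ('v, 'k::comm_ring_1) mpoly) t"
proof -
  have "lookup (p * Mon s) (t + s) = (\<Sum>u\<in>keys p. lookup (single (u + s) (lookup p u)) (t + s))"
  proof -
    have "p * Mon s = (\<Sum>u\<in>keys p. single u (lookup p u)) * Mon s" by (simp flip: poly_mapping_expand)
    also have "\<dots> = (\<Sum>u\<in>keys p. single (u + s) (lookup p u))" by (simp add: sum_distrib_right mult_single)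
    finally show ?thesis by (simp add: lookup_sum)
  qed
  also have "\<dots> = (\<Sum>u\<in>keys p. if u = t then lookup p t else 0)"
    by (intro sum.cong) (auto simp: lookup_single when_def)
  also have "\<dots> = lookup p t" by (simp add: in_keys_iff)
  finally show ?thesis .
qed

lemma monom_degree_1: "monom_degree t = Suc 0 \<Longrightarrow> \<exists>v. t = single v 1"
proof -
  assume t: "monom_degree t = Suc 0"
  then have "t \<noteq> 0" by auto
  then obtain v where v: "v \<in> keys t" by (metis all_not_in_conv keys_eq_empty)
  then have "monom_degree t = 1 + monom_degree (t - single v 1)"
    by (subst exp_split[OF v]) simp
  then have "t - single v 1 = 0" using t by simp
  then show ?thesis using exp_split[OF v] by (metis add.right_neutral)
qed

context block_concat
begin

lemma V_N: "(i, a) \<in> V \<Longrightarrow> i < N \<and> 1 \<le> a"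
  by (auto simp: V_iff is_nilpotent_def is_scroll_def is_jordan_def)

lemma Var_form_0: 
  assumes "(i, a) \<in> V"
  shows "\<exists>b\<le>len i. Var (i, a) = form 0 i b"
proof -
  have "i < N" using V_N assms by blast
  then show ?thesis
  proof (cases rule: block_cases)
    case 1
    then show ?thesis using assms by (intro exI[of _ a]) (auto simp: V_nil form_nil)
  next
    case 2
    then show ?thesis using assms by (intro exI[of _ "a - 1"]) (auto simp: V_scr form_0_scr)
  next
    case (3 l)
    then show ?thesis using assms by (intro exI[of _ "a - 1"]) (auto simp: V_jor form_jor)
  qed
qed

lemma maximal_in_profile:
  assumes "lookup r 0 = 0" "mpoly_vars r \<subseteq> V"
  shows "r \<in> det_span X (profile l (\<lambda>_. 0))"
proof -
  have "Var ` V \<subseteq> det_span X (profile l (\<lambda>_. 0))" by (auto intro!: Var_in_profile)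
  then have "ideal_span (Var ` V) \<subseteq> det_span X (profile l (\<lambda>_. 0))"
    by (rule idl.span_minimal) (rule idl.subspace_span)
  then show ?thesis using in_maximal_ideal[OF assms] by blast
qed

lemma span_maximal: "det_span X (profile l (\<lambda>_. 0)) = det_span X (Var ` V)"
proof (unfold idl.span_eq, intro conjI)
  show "minors2 X \<union> profile l (\<lambda>_. 0) \<subseteq> det_span X (Var ` V)"
  proof
    fix p assume "p \<in> minors2 X \<union> profile l (\<lambda>_. 0)"
    then show "p \<in> det_span X (Var ` V)"
    proof
      assume "p \<in> profile l (\<lambda>_. 0)"
      then have p: "p \<in> linear_forms X" using profile_linear by blast
      then have "p \<in> ideal_span (Var ` V)"
        using linear_form_lookup_0[of p V] by (intro in_maximal_ideal) (auto simp: mpoly_component_def)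
      then show ?thesis using idl.span_mono[of "Var ` V" "minors2 X \<union> Var ` V"] by auto
    qed (auto intro: idl.span_base)
  qed
  show "minors2 X \<union> Var ` V \<subseteq> det_span X (profile l (\<lambda>_. 0))"
    by (auto intro!: Var_in_profile) (auto intro: idl.span_base)
qed

lemma column_linear: "(a, b) \<in> set X \<Longrightarrow> a \<in> linear_forms X \<and> b \<in> linear_forms X"
proof -
  assume "(a, b) \<in> set X"
  then obtain i where i: "i < N" "(a, b) \<in> set (block_matrix i (bs ! i))" by (auto simp: set_X)
  from i(1) show ?thesis
  proof (cases rule: block_cases)
    case 1
    then show ?thesis using i form_linear by (auto simp: set_X_nil[of i 0])
  next
    case 2
    then show ?thesis using i by (auto simp: set_X_scr Var_linear V_scr)
  next
    case (3 l)
    have "form l i (Suc e) + Const l * form l i e \<in> linear_forms X" for e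
      using mpoly_component_diff[OF form_linear form_linear, of i i l "Suc e" "- l" l e] i(1) by simp
    then show ?thesis using i 3 form_linear by (auto simp: set_X_jor[of l i l])
  qed
qed

lemma minors2_degree:
  assumes "g \<in> minors2 X" "t \<in> keys g"
  shows "monom_degree t = 2"
proof -
  obtain i j where ij: "i < j" "j < length X"
    and g: "g = fst (X ! i) * snd (X ! j) - fst (X ! j) * snd (X ! i)"
    using assms(1) by (auto simp: minors2_def)
  have lin: "fst (X ! l) \<in> linear_forms X" "snd (X ! l) \<in> linear_forms X" if "l < length X" for l
    using column_linear[of "fst (X ! l)" "snd (X ! l)"] nth_mem[OF that] by auto
  have mult: "monom_degree t = 2" if "t \<in> keys (p * q)" "p \<in> linear_forms X" "q \<in> linear_forms X" for t p q
    using that keys_mult[of p q] unfolding mpoly_component_iff by fastforce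
  have "t \<in> keys (fst (X ! i) * snd (X ! j)) \<or> t \<in> keys (fst (X ! j) * snd (X ! i))"
    using assms(2) unfolding g by (auto simp: in_keys_iff lookup_minus)
  moreover have "i < length X" using ij by simp
  ultimately show ?thesis using mult lin ij(2) by blast
qed

lemma det_span_lookup_1:
  assumes rJ: "r * Var w \<in> det_span X T" and T: "\<And>t. t \<in> T \<Longrightarrow> t = 0 \<or> (\<exists>v. v \<noteq> w \<and> t = Var v)"
  shows "lookup r 0 = 0"
proof -
  have "lookup (hom_part 1 p) (single w 1) = 0" if "p \<in> det_span X T" for p
    using that
  proof (induction rule: idl.span_induct_alt)
    case base
    then show ?case by (simp add: hom_part_0)
  next
    case (step c g y)
    have "lookup (hom_part 1 (c * g)) (single w 1) = 0"
    proof (cases "g \<in> minors2 X")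
      case True
      have "monom_degree t \<noteq> 1" if "t \<in> keys (c * g)" for t
        using that keys_mult[of c g] minors2_degree[OF True] by fastforce
      then have "single w 1 \<notin> keys (c * g)" by fastforce
      then show ?thesis by (simp add: lookup_hom_part in_keys_iff)
    next
      case False
      then consider "g = 0" | v where "v \<noteq> w" "g = Var v" using step(1) T by blast
      then show ?thesis
      proof cases
        case 2
        have "hom_part (0 + 1) (c * g) = hom_part 0 c * g"
          by (rule hom_part_mult) (auto simp: 2 Var_def)
        moreover have "single w 1 \<notin> keys (hom_part 0 c * g)"
        proof
          assume "single w 1 \<in> keys (hom_part 0 c * g)"
          then obtain a where "single w 1 = a + single v (1 :: nat)"
            using keys_mult[of "hom_part 0 c" g] by (auto simp: 2 Var_def)
          then have "v \<in> keys (single w (1 :: nat))" by (simp add: keys_exp_add)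
          then show False using 2 by simp
        qed
        ultimately show ?thesis by (simp add: in_keys_iff)
      qed (simp add: hom_part_0)
    qed
    then show ?case using step(2) by (simp add: hom_part_add lookup_add)
  qed
  from this[OF rJ] have "lookup (r * Mon (single w 1)) (0 + single w 1) = 0"
    by (simp add: lookup_hom_part Var_eq_Mon)
  then show ?thesis by (simp only: lookup_mult_Mon)
qed

text \<open>The common criterion for a colon to be the maximal ideal, written as the profile with
  all exponents 0 because it must come from the family.\<close>

lemma det_span_colon_maximal:
  assumes x: "\<And>v. v \<in> V \<Longrightarrow> Var v * Var w \<in> det_span X T"
    and T: "\<And>t. t \<in> T \<Longrightarrow> t = 0 \<or> (\<exists>v. v \<noteq> w \<and> t = Var v)" and r: "mpoly_vars r \<subseteq> V"
  shows "r * Var w \<in> det_span X T \<longleftrightarrow> r \<in> det_span X (profile 0 (\<lambda>_. 0))"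
proof
  assume "r * Var w \<in> det_span X T"
  then have "lookup r 0 = 0" using T by (rule det_span_lookup_1)
  then show "r \<in> det_span X (profile 0 (\<lambda>_. 0))" using r by (rule maximal_in_profile)
next
  assume "r \<in> det_span X (profile 0 (\<lambda>_. 0))"
  then have "r \<in> det_span X (Var ` V)" by (simp only: span_maximal)
  then show "r * Var w \<in> det_span X T"
  proof (rule span_mult_closed)
    fix g assume "g \<in> minors2 X \<union> Var ` V"
    then show "g * Var w \<in> det_span X T"
    proof
      assume "g \<in> minors2 X"
      then have "g \<in> det_span X T" by (intro idl.span_base) simp
      then show ?thesis by (rule span_scale_right)
    qed (use x in auto)
  qed
qed

text \<open>The upper end \<open>g\<close> is common to all scroll blocks, as it will be m minus the
  middle index; the lower end depends on the length of the block. The other blocks are contained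
  entirely, since nilpotent and Jordan variables annihilate nilpotent ones.\<close>

definition gap_profile :: "nat \<Rightarrow> (nat \<Rightarrow> nat) \<Rightarrow> (nat \<times> nat, 'k) mpoly set" where
  "gap_profile g d = {form 0 i a | i a. i < N \<and> a \<le> len i \<and> (is_scroll i \<longrightarrow> g \<le> a \<or> a < d i)}"

lemma gap_profileI: "i < N \<Longrightarrow> a \<le> len i \<Longrightarrow> (is_scroll i \<Longrightarrow> g \<le> a \<or> a < d i) \<Longrightarrow> form 0 i a \<in> gap_profile g d"
  by (auto simp: gap_profile_def)

lemma gap_in: "i < N \<Longrightarrow> a \<le> len i \<Longrightarrow> (is_scroll i \<Longrightarrow> g \<le> a \<or> a < d i) \<Longrightarrow> form 0 i a \<in> det_span X (gap_profile g d)"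
  by (rule idl.span_base) (auto intro: gap_profileI)

lemma gap_profile_linear: "gap_profile g d \<subseteq> linear_forms X"
  unfolding gap_profile_def using form_linear by blast

text \<open>The passage from gap ideals to profile ideals, once all low forms are gone.\<close>

lemma gap_profile_0:
  assumes "\<And>i. is_scroll i \<Longrightarrow> d i = 0"
  shows "gap_profile g d = profile 0 (\<lambda>i. if is_scroll i then g else 0)"
proof -
  have "(i < N \<and> a \<le> len i \<and> (is_scroll i \<longrightarrow> g \<le> a \<or> a < d i)) \<longleftrightarrow>
      (i < N \<and> (if is_scroll i then g else 0) \<le> a \<and> a \<le> len i)" for i a
    using assms[of i] by auto
  then show ?thesis by (simp add: gap_profile_def profile_def)
qed

lemma gap_profile_insert:
  assumes "is_scroll q" "d q = e" "e \<le> len q"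
  shows "gap_profile g (d(q := Suc e)) = insert (form 0 q e) (gap_profile g d)"
proof (intro equalityI subsetI)
  fix f assume "f \<in> gap_profile g (d(q := Suc e))"
  then obtain i a where f: "f = form 0 i a" "i < N" "a \<le> len i" "is_scroll i \<longrightarrow> g \<le> a \<or> a < (d(q := Suc e)) i"
    by (auto simp: gap_profile_def)
  show "f \<in> insert (form 0 q e) (gap_profile g d)"
  proof (cases "i = q \<and> a = e")
    case False
    then have "is_scroll i \<longrightarrow> g \<le> a \<or> a < d i" using f(4) assms(2) by (auto split: if_splits)
    then show ?thesis using f by (auto intro: gap_profileI)
  qed (use f in auto)
next
  fix f assume "f \<in> insert (form 0 q e) (gap_profile g d)"
  then consider "f = form 0 q e" | i a where "f = form 0 i a" "i < N" "a \<le> len i" "is_scroll i \<longrightarrow> g \<le> a \<or> a < d i"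
    by (auto simp: gap_profile_def)
  then show "f \<in> gap_profile g (d(q := Suc e))"
  proof cases
    case 1
    then show ?thesis using assms by (auto intro!: gap_profileI simp: is_scroll_def)
  next
    case 2
    then show ?thesis unfolding 2(1) using assms by (intro gap_profileI) auto
  qed
qed

text \<open>A block that has low forms lies in the colon entirely. On the blocks without low forms
  the ideal is mapped to multiples of t^g, and Y is a nonzerodivisor modulo t^g.\<close>

theorem gap_profile_colon_first:
  assumes g: "1 \<le> g" "\<And>i. is_scroll i \<Longrightarrow> g \<le> len i" and q: "is_scroll q" "d q = 0" and r: "mpoly_vars r \<subseteq> V"
  shows "r * form 0 q 0 \<in> det_span X (gap_profile g d) \<longleftrightarrow>
    r \<in> det_span X (profile 0 (\<lambda>i. if is_scroll i \<and> d i = 0 then g else 0))" (is "_ \<in> ?J \<longleftrightarrow> _ \<in> det_span X (profile 0 ?c)")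
proof
  have qN: "q < N" using q by (simp add: is_scroll_def)
  {
    assume "r \<in> det_span X (profile 0 ?c)"
    then show "r * form 0 q 0 \<in> ?J"
    proof (rule span_mult_closed)
      fix f assume "f \<in> minors2 X \<union> profile 0 ?c"
      then consider "f \<in> minors2 X" | i a where "i < N" "?c i \<le> a" "a \<le> len i" "f = form 0 i a"
        by (auto simp: profile_def)
      then show "f * form 0 q 0 \<in> ?J"
      proof cases
        case 1
        then have "f \<in> ?J" by (intro idl.span_base) simp
        then show ?thesis by (rule span_scale_right)
      next
        case 2
        show ?thesis
        proof (cases "is_scroll i \<longrightarrow> g \<le> a \<or> a < d i")
          case True
          then have "f \<in> ?J" unfolding 2(4) using 2 by (intro gap_in) auto
          then show ?thesis by (rule span_scale_right)
        next
          case False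
          then have i: "is_scroll i" "a < g" "d i \<le> a" "d i \<noteq> 0" using 2 by (auto split: if_splits)
          \<comment> \<open>So many powers of t go to Y t^0; what remains is the highest low form of
            block \<open>i\<close>.\<close>
          define s where "s = a - (d i - 1)"
          have "form 0 i (a - s) \<in> ?J" using i 2 by (intro gap_in) (auto simp: s_def)
          then have "form 0 q (0 + s) * form 0 i (a - s) \<in> ?J" by (rule idl.span_scale)
          then have "form 0 q 0 * form 0 i a \<in> ?J"
            by (rule slide_in[OF at_point_simps(2)[OF q(1)] at_point_simps(2)[OF i(1)], rotated -1])
              (use g(2)[OF q(1)] i 2 in \<open>auto simp: s_def\<close>)
          then show ?thesis by (simp add: 2(4) mult.commute)
        qed
      qed
    qed
  }
  assume rJ: "r * form 0 q 0 \<in> ?J"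
  define L where "L = {i. is_scroll i \<and> d i = 0}"
  have L: "\<And>i. i \<in> L \<Longrightarrow> is_scroll i" by (simp add: L_def)
  define D :: "(nat \<times> nat, 'k) mpoly poly" where "D = monom 1 g"
  have "D dvd eval_hom 0 L (r * form 0 q 0)"
    using eval_hom_morph rJ
  proof (rule dvd_morph_span)
    fix f assume "f \<in> minors2 X \<union> gap_profile g d"
    then consider "f \<in> minors2 X" | i a where "i < N" "a \<le> len i" "is_scroll i \<longrightarrow> g \<le> a \<or> a < d i" "f = form 0 i a"
      by (auto simp: gap_profile_def)
    then show "D dvd eval_hom 0 L f"
    proof cases
      case 2
      show ?thesis
      proof (cases "i \<in> L")
        case True
        then have "eval_hom 0 L f = D * monom (Var (i, Suc 0)) (a - g)"
          using 2 by (auto simp: eval_hom_form L_def D_def mult_monom)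
        then show ?thesis by simp
      qed (use 2 eval_hom_dead in simp)
    qed (use eval_hom_minors2_zero[OF L] in simp)
  qed
  also have "eval_hom 0 L (r * form 0 q 0) = eval_hom 0 L r * monom (Var (q, Suc 0)) 0"
    using q by (auto simp: eval_homD eval_hom_form L_def)
  finally obtain s where s: "eval_hom 0 L r * monom (Var (q, Suc 0)) 0 = D * s" by (auto elim: dvdE)
  have nz: "Var (q, Suc 0) \<noteq> (0 :: (nat \<times> nat, 'k) mpoly)"
    unfolding Var_def by (metis keys_single keys_zero empty_iff insertI1 zero_neq_one)
  show "r \<in> det_span X (profile 0 ?c)"
  proof (rule eval_hom_kernel[OF L r, where g = g])
    fix v assume "v \<in> V" "fst v \<notin> L"
    then show "Var v \<in> det_span X (profile 0 ?c)"
      by (cases v) (auto simp: L_def intro!: Var_in_profile)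
  next
    fix w assume w: "coeff (eval_hom 0 L r) w \<noteq> 0"
    show "g \<le> w"
    proof (rule ccontr)
      assume "\<not> g \<le> w"
      then have "coeff (D * s) w = 0" by (simp add: D_def coeff_monom_mult)
      moreover have "coeff (eval_hom 0 L r * monom (Var (q, Suc 0)) 0) w = Var (q, Suc 0) * coeff (eval_hom 0 L r) w"
        by (simp add: mult.commute[of "eval_hom 0 L r"] coeff_monom_mult)
      ultimately show False using s w nz by simp
    qed
  next
    fix t assume t: "live L t" "g \<le> weight t"
    then have "t \<noteq> 0" using g(1) by (auto simp: weight_def)
    then obtain j b where jb: "(j, b) \<in> keys t" by (metis all_not_in_conv keys_eq_empty surj_pair)
    then have j: "j \<in> L" using t by (auto simp: live_def)
    \<comment> \<open>Collecting powers of t in one factor raises it to an exponent at least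
      \<open>g\<close>, because \<open>g \<le> len j\<close>.\<close>
    obtain s where s: "Mon t - Var (j, Suc (min (len j) (weight t))) * Mon s \<in> I2"
      using pull_out[OF L t(1) jb] by blast
    have "form 0 j (min (len j) (weight t)) \<in> det_span X (profile 0 ?c)"
      using j g(2)[of j] t(2) by (intro form_in_profile) (auto simp: L_def is_scroll_def)
    then have "Var (j, Suc (min (len j) (weight t))) * Mon s \<in> det_span X (profile 0 ?c)"
      using j by (intro span_scale_right) (auto simp: L_def form_0_scr)
    from idl.span_add[OF I2_in[OF s] this] show "Mon t \<in> det_span X (profile 0 ?c)" by simp
  qed
qed

text \<open>Any scroll form below \<open>g\<close> can take one power of t from
  \<open>form 0 q (Suc e)\<close>, since \<open>g \<le> len i\<close>, and what remains is the
  generator \<open>form 0 q e\<close>.\<close>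

theorem gap_profile_colon_next:
  assumes g: "\<And>i. is_scroll i \<Longrightarrow> g \<le> len i" and q: "is_scroll q" "d q = Suc e" "Suc e < g" and r: "mpoly_vars r \<subseteq> V"
  shows "r * form 0 q (Suc e) \<in> det_span X (gap_profile g d) \<longleftrightarrow> r \<in> det_span X (profile 0 (\<lambda>_. 0))"
proof -
  have eq: "form 0 q (Suc e) = Var (q, Suc (Suc e))" using q g[of q] by (simp add: form_0_scr)
  have qN: "q < N" using q by (simp add: is_scroll_def)
  have "r * Var (q, Suc (Suc e)) \<in> det_span X (gap_profile g d) \<longleftrightarrow> r \<in> det_span X (profile 0 (\<lambda>_. 0))"
  proof (rule det_span_colon_maximal[OF _ _ r])
    fix v assume v: "v \<in> V"
    obtain i a where ia: "v = (i, a)" by fastforce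
    then obtain b where b: "b \<le> len i" "Var v = form 0 i b" using Var_form_0 v by blast
    have iN: "i < N" using V_N v ia by blast
    have "form 0 i b * form 0 q (Suc e) \<in> det_span X (gap_profile g d)"
    proof (cases "is_scroll i \<longrightarrow> g \<le> b")
      case True
      then show ?thesis using b iN by (intro span_scale_right gap_in) auto
    next
      case False
      have "form 0 q (Suc e - 1) \<in> det_span X (gap_profile g d)"
        using q g[of q] qN by (intro gap_in) auto
      then have "form 0 i (b + 1) * form 0 q (Suc e - 1) \<in> det_span X (gap_profile g d)"
        by (rule idl.span_scale)
      then show ?thesis
        by (rule slide_in[OF at_point_simps(2) at_point_simps(2), rotated -1])
          (use False q g[of i] g[of q] in auto)
    qed
    then show "Var v * Var (q, Suc (Suc e)) \<in> det_span X (gap_profile g d)" by (simp only: b eq)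
  next
    fix t assume "t \<in> gap_profile g d"
    then obtain i a where t: "t = form 0 i a" "i < N" "a \<le> len i" "is_scroll i \<longrightarrow> g \<le> a \<or> a < d i"
      by (auto simp: gap_profile_def)
    from t(2) show "t = 0 \<or> (\<exists>v. v \<noteq> (q, Suc (Suc e)) \<and> t = Var v)"
    proof (cases rule: block_cases)
      case 1
      then have "i \<noteq> q" using q block_distinct(1) by blast
      then show ?thesis using t(1) form_nil[OF 1, of 0 a] by (metis prod.inject)
    next
      case 2
      then have "t = Var (i, Suc a)" "(i, Suc a) \<noteq> (q, Suc (Suc e))"
        using t q by (auto simp: form_0_scr)
      then show ?thesis by blast
    next
      case (3 l)
      then have "i \<noteq> q" using q block_distinct(3) by blast
      then show ?thesis using t(1) form_jor[OF 3, of 0 a] by (metis prod.inject)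
    qed
  qed
  then show ?thesis by (simp only: eq)
qed

end

section \<open>Colon ideals by nilpotent variables\<close>

lemma lookup_Const_mult: "lookup (Const c * p) t = c * lookup p t"
  by (simp add: Const_def Poly_Mapping.map.rep_eq when_def flip: mult_map_scale_conv_mult)

context block_concat
begin

text \<open>A product of x_a with a scroll form is zero unless its exponent c satisfies n < c <
  \<open>len i\<close>. Then the hypotheses give 0 \<le> c - m \<le> n, so it equals x_m Y
  t^(c-m).\<close>

lemma nil_colon_maximal:
  assumes i: "is_nilpotent i" "(i, a) \<in> V" "(i, m) \<in> V"
    and m: "\<And>j. is_scroll j \<Longrightarrow> m \<le> len j \<and> len i \<le> len j + m"
    and S: "(i, m) \<in> S" "(i, a) \<notin> S" and r: "mpoly_vars r \<subseteq> V"
  shows "r * Var (i, a) \<in> det_span X (Var ` S) \<longleftrightarrow> r \<in> det_span X (profile 0 (\<lambda>_. 0))"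
proof (rule det_span_colon_maximal[OF _ _ r])
  have a: "1 \<le> a" "a < len i" "1 \<le> m" "m < len i" using i by (auto simp: V_nil)
  have fa: "form 0 i a = Var (i, a)" and fm: "form 0 i m = Var (i, m)" using a i(1) by (simp_all add: form_nil)
  have m_in: "form 0 i m \<in> det_span X (Var ` S)" unfolding fm using S(1) by (intro idl.span_base) simp
  fix v assume v: "v \<in> V"
  obtain j c where jc: "v = (j, c)" by fastforce
  have "j < N" using V_N v jc by blast
  then have "Var v * form 0 i a \<in> det_span X (Var ` S)"
  proof (cases rule: block_cases)
    case 1
    then have "Var v = form 0 j c" using v jc by (simp add: V_nil form_nil)
    then show ?thesis using nil_nil[OF 1 i(1), of c a] by (simp add: I2_in)
  next
    case (3 l)
    then have "Var v = form l j (c - 1)" using v jc by (auto simp: V_jor form_jor)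
    then show ?thesis using nil_jor[OF i(1) 3, of a "c - 1"] by (simp add: I2_in mult.commute)
  next
    case 2
    define b where "b = c - 1"
    have b: "b \<le> len j" "Var v = form 0 j b" using v jc 2 by (auto simp: V_scr form_0_scr b_def)
    have mj: "m \<le> len j" "len i \<le> len j + m" using m[OF 2] by auto
    note ai = at_point_simps(1)[OF i(1), of 0, simplified] and aj = at_point_simps(2)[OF 2, of 0]
    consider "a + b \<le> len j \<or> len i \<le> a + b" | "m < a" "b + (a - m) \<le> len j" | "a \<le> m" "m - a \<le> b"
      using mj by linarith
    then have "form 0 j b * form 0 i a \<in> det_span X (Var ` S)"
    proof cases
      case 1
      then show ?thesis using nil_scr[OF i(1) 2, of a b] by (simp add: I2_in mult.commute)
    next
      case 2
      have "form 0 j (b + (a - m)) * form 0 i (a - (a - m)) \<in> det_span X (Var ` S)"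
        using 2 m_in by (intro idl.span_scale) simp
      then show ?thesis by (rule slide_in[OF aj ai, rotated -1]) (use 2 a in auto)
    next
      case 3
      have "form 0 i (a + (m - a)) * form 0 j (b - (m - a)) \<in> det_span X (Var ` S)"
        using 3 m_in by (intro span_scale_right) simp
      then have "form 0 i a * form 0 j b \<in> det_span X (Var ` S)"
        by (rule slide_in[OF ai aj, rotated -1]) (use 3 a b in auto)
      then show ?thesis by (simp add: mult.commute)
    qed
    then show ?thesis by (simp only: b(2))
  qed
  then show "Var v * Var (i, a) \<in> det_span X (Var ` S)" by (simp only: fa)
next
  fix t assume "t \<in> Var ` S"
  then show "t = 0 \<or> (\<exists>v. v \<noteq> (i, a) \<and> t = Var v)" using S(2) by auto
qed

lemma eval_hom_form_nil:
  assumes "is_nilpotent i" "i \<in> L"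
  shows "eval_hom l L (form l' i a) = (if 1 \<le> a \<and> a < len i then monom (Var (i, Suc 0)) (a - 1) else 0)"
  using assms block_distinct(1)[of i] by (simp add: form_nil eval_hom_Var eval_homD)

section \<open>A functional on quadratic forms that detects the gap\<close>

context
  fixes i j k :: nat
  assumes i: "is_nilpotent i" and j: "is_scroll j" and k: "len j \<le> k" "Suc k < len i"
begin

text \<open>
  As \<open>eval_hom\<close> sends \<open>x\<^sub>a\<close> to \<open>X t\<^sup>a\<^sup>-\<^sup>1\<close>, this is the coefficient of \<open>X Y t\<^sup>k\<^sup>+\<^sup>1\<close>. On quadratic forms it
  kills the minors precisely because \<open>k + 1\<close> lies strictly between \<open>n\<close> and \<open>m\<close>.
\<close>

abbreviation "mixed_coeff p \<equiv> lookup (coeff p k) (single (i, Suc 0) (Suc 0) + single (j, Suc 0) (Suc 0))"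

lemma ij: "i \<noteq> j"
  using i j block_distinct(1) by blast

lemma mixed_coeff_monom:
  "mixed_coeff (monom (Var (i, Suc 0)) a * monom (Var (i, Suc 0)) b) = 0"
  "mixed_coeff (monom (Var (j, Suc 0)) a * monom (Var (i, Suc 0)) b) = (if a + b = k then 1 else 0)"
proof -
  have "single (i, Suc 0) (Suc 0) \<noteq> single (j, Suc 0) (Suc 0)"
  proof
    assume "single (i, Suc 0) (Suc 0) = single (j, Suc 0) (Suc 0)"
    then have "lookup (single (i, Suc 0) (Suc 0)) (i, Suc 0) = lookup (single (j, Suc 0) (Suc 0)) (i, Suc 0)"
      by simp
    then show False using ij by (simp add: lookup_single when_def)
  qed
  then show "mixed_coeff (monom (Var (i, Suc 0)) a * monom (Var (i, Suc 0)) b) = 0"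
    by (simp add: mult_monom Var_eq_Mon lookup_single_not_eq flip: Mon_add)
  show "mixed_coeff (monom (Var (j, Suc 0)) a * monom (Var (i, Suc 0)) b) = (if a + b = k then 1 else 0)"
    by (simp add: mult_monom Var_eq_Mon add.commute[of "single (j, Suc 0) _"] flip: Mon_add)
qed

text \<open>The lower entry is t times the upper one except at the two ends of block
  \<open>i\<close>: in exponents shifted by one, the column (0, x_1) leaves the error X t^0 and the
  last column the error - X t^(m-1).\<close>

lemma mixed_column:
  assumes "(a, b) \<in> set X"
  shows "eval_hom 0 {i, j} a = 0 \<or> (\<exists>e. eval_hom 0 {i, j} a = monom (Var (i, Suc 0)) e) \<or>
      (\<exists>e<len j. eval_hom 0 {i, j} a = monom (Var (j, Suc 0)) e)" (is ?A)
    and "eval_hom 0 {i, j} b - monom 1 (Suc 0) * eval_hom 0 {i, j} a \<in>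
      {0, monom (Var (i, Suc 0)) 0, - monom (Var (i, Suc 0)) (len i - 1)}" (is ?B)
proof -
  obtain q where q: "q < N" "(a, b) \<in> set (block_matrix q (bs ! q))" using assms by (auto simp: set_X)
  consider "q = i" | "q = j" | "q \<notin> {i, j}" by blast
  then have "?A \<and> ?B"
  proof cases
    case 1
    then obtain e where e: "e < len i" "a = form 0 i e" "b = form 0 i (Suc e)"
      using q i by (auto simp: set_X_nil[of i 0])
    consider "e = 0" | "1 \<le> e" "Suc e = len i" | "1 \<le> e" "Suc e < len i" using e by linarith
    then show ?thesis
    proof cases
      case 2
      then have "len i - 1 = e" by simp
      then show ?thesis using 2 by (auto simp: e eval_hom_form_nil[OF i] mult_monom)
    qed (use k in \<open>auto simp: e eval_hom_form_nil[OF i] mult_monom\<close>)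
  next
    case 2
    then obtain e where e: "e < len j" "a = Var (j, Suc e)" "b = Var (j, Suc (Suc e))"
      using q j by (auto simp: set_X_scr)
    then show ?thesis using j by (auto simp: eval_hom_Var mult_monom monom_altdef)
  next
    case 3
    from q(1) have "eval_hom 0 {i, j} a = 0 \<and> eval_hom 0 {i, j} b = 0"
    proof (cases rule: block_cases)
      case 1
      then show ?thesis using q 3 eval_hom_dead[OF q(1) 3] by (auto simp: set_X_nil[of q 0])
    next
      case 2
      then show ?thesis using q 3 by (auto simp: set_X_scr eval_hom_Var)
    next
      case l: (3 l)
      then show ?thesis using q 3 eval_hom_dead[OF q(1) 3] by (auto simp: set_X_jor[of l q 0] eval_homD)
    qed
    then show ?thesis by simp
  qed
  then show ?A ?B by auto
qed

text \<open>Against an upper entry Y t^e with e < n, these errors produce exponents at most n - 1 or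
  at least m - 1, and \<open>k\<close> lies strictly between.\<close>

lemma mixed_coeff_product:
  assumes "(a, b) \<in> set X" "(a', b') \<in> set X"
  shows "mixed_coeff (eval_hom 0 {i, j} a' * (eval_hom 0 {i, j} b - monom 1 (Suc 0) * eval_hom 0 {i, j} a)) = 0"
  using mixed_column(1)[OF assms(2)] mixed_column(2)[OF assms(1)] k
  by (auto simp: mixed_coeff_monom simp del: mult_monom)

lemma mixed_coeff_minor:
  assumes "g \<in> minors2 X"
  shows "mixed_coeff (eval_hom 0 {i, j} g) = 0"
proof -
  obtain u v where uv: "u < v" "v < length X"
    and g: "g = fst (X ! u) * snd (X ! v) - fst (X ! v) * snd (X ! u)"
    using assms by (auto simp: minors2_def)
  let ?h = "eval_hom 0 {i, j}"
  have "?h g = ?h (fst (X ! u)) * (?h (snd (X ! v)) - monom 1 (Suc 0) * ?h (fst (X ! v)))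
      - ?h (fst (X ! v)) * (?h (snd (X ! u)) - monom 1 (Suc 0) * ?h (fst (X ! u)))"
    unfolding g by (simp add: eval_homD algebra_simps)
  moreover have col: "(fst (X ! l), snd (X ! l)) \<in> set X" if "l < length X" for l
    using nth_mem[OF that] by simp
  moreover have "u < length X" using uv by simp
  ultimately show ?thesis
    using mixed_coeff_product[OF col col, of u v] mixed_coeff_product[OF col col, of v u] uv(2)
    by (simp add: lookup_minus)
qed

text \<open>In degree two a minor occurs only with a constant cofactor, so vanishing on the minors
  is enough; the variables in \<open>S\<close> belong to killed blocks.\<close>

lemma mixed_coeff_span:
  assumes "p \<in> det_span X (Var ` S)" and S: "\<And>v. v \<in> S \<Longrightarrow> fst v \<noteq> i \<and> fst v \<noteq> j"
  shows "mixed_coeff (eval_hom 0 {i, j} (hom_part 2 p)) = 0"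
  using assms(1)
proof (induction rule: idl.span_induct_alt)
  case base
  then show ?case by (simp add: hom_part_0 eval_homD)
next
  case (step c g y)
  have "mixed_coeff (eval_hom 0 {i, j} (hom_part 2 (c * g))) = 0"
  proof (cases "g \<in> minors2 X")
    case True
    have "hom_part (0 + 2) (c * g) = hom_part 0 c * g"
      using minors2_degree[OF True] by (rule hom_part_mult)
    also have "hom_part 0 c = Const (lookup c 0)"
      by (rule poly_mapping_eqI) (auto simp: lookup_hom_part Const_def lookup_single when_def)
    finally have "eval_hom 0 {i, j} (hom_part 2 (c * g)) = [:Const (lookup c 0):] * eval_hom 0 {i, j} g"
      by (simp add: eval_homD numeral_2_eq_2 del: mult_pCons_left)
    then show ?thesis using mixed_coeff_minor[OF True] by (simp add: lookup_Const_mult)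
  next
    case False
    then obtain v where v: "v \<in> S" "g = Var v" using step(1) by auto
    have "hom_part (1 + 1) (c * g) = hom_part 1 c * g"
      by (rule hom_part_mult) (auto simp: v Var_def)
    moreover have "eval_hom 0 {i, j} g = 0" using S[OF v(1)] v(2) by (cases v) (auto simp: eval_hom_Var)
    ultimately show ?thesis by (simp add: eval_homD numeral_2_eq_2)
  qed
  then show ?case using step(2) by (simp add: hom_part_add eval_homD lookup_add)
qed

text \<open>Only the linear part of \<open>r\<close> contributes, and within it only block
  \<open>j\<close> has the right multidegree and \<open>Var (j, Suc b)\<close> the right
  exponent.\<close>

lemma mixed_coeff_mult:
  assumes r: "mpoly_vars r \<subseteq> V" and m: "1 \<le> m" "m - 1 + b = k"
  shows "mixed_coeff (eval_hom 0 {i, j} (hom_part 2 (r * Var (i, m)))) = lookup r (single (j, Suc b) 1)"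
proof -
  let ?h = "eval_hom 0 {i, j}"
  have "hom_part (1 + 1) (r * Var (i, m)) = hom_part 1 r * Var (i, m)"
    by (rule hom_part_mult) (auto simp: Var_def)
  moreover have "?h (Var (i, m)) = monom (Var (i, Suc 0)) (m - 1)"
    using i block_distinct(1) by (simp add: eval_hom_Var)
  ultimately have "mixed_coeff (?h (hom_part 2 (r * Var (i, m)))) =
      mixed_coeff (?h (hom_part 1 r) * monom (Var (i, Suc 0)) (m - 1))"
    by (simp add: eval_homD numeral_2_eq_2)
  also have "hom_part 1 r = (\<Sum>t | t \<in> keys r \<and> monom_degree t = 1. Const (lookup r t) * Mon t)"
    by (simp add: hom_part_def Const_mult_Mon)
  also have "?h \<dots> = (\<Sum>t | t \<in> keys r \<and> monom_degree t = 1. [:Const (lookup r t):] * ?h (Mon t))"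
  proof -
    have "?h (\<Sum>t\<in>A. f t) = (\<Sum>t\<in>A. ?h (f t))" for A :: "(nat \<times> nat \<Rightarrow>\<^sub>0 nat) set" and f
      by (induction A rule: infinite_finite_induct) (simp_all add: eval_homD)
    then show ?thesis by (simp only: eval_homD eval_hom_Const)
  qed
  also have "mixed_coeff (\<dots> * monom (Var (i, Suc 0)) (m - 1)) =
      (\<Sum>t | t \<in> keys r \<and> monom_degree t = 1. lookup r t * mixed_coeff (?h (Mon t) * monom (Var (i, Suc 0)) (m - 1)))"
    unfolding sum_distrib_right coeff_sum lookup_sum mult.assoc
    by (simp add: lookup_Const_mult)
  also have "\<dots> = (\<Sum>t | t \<in> keys r \<and> monom_degree t = 1. if t = single (j, Suc b) 1 then lookup r t else 0)"
  proof (intro sum.cong refl)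
    fix t assume t: "t \<in> {t. t \<in> keys r \<and> monom_degree t = 1}"
    then obtain q c where qc: "t = single (q, c) 1" using monom_degree_1[of t] by auto
    moreover have "keys t \<subseteq> V" using t r by (auto simp: mpoly_vars_def)
    ultimately have "(q, c) \<in> V" by simp
    then have c: "1 \<le> c" using V_N by blast
    have Mon: "Mon t = (Var (q, c) :: (nat \<times> nat, 'k) mpoly)" by (simp only: qc Var_eq_Mon)
    have iff: "t = single (j, Suc b) 1 \<longleftrightarrow> q = j \<and> c = Suc b"
    proof
      assume "t = single (j, Suc b) 1"
      then have "keys (single (q, c) (1 :: nat)) = keys (single (j, Suc b) (1 :: nat))" using qc by simp
      then show "q = j \<and> c = Suc b" by simp
    qed (simp add: qc)
    consider "q = i" | "q = j" | "q \<noteq> i" "q \<noteq> j" by blast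
    then have "mixed_coeff (?h (Mon t) * monom (Var (i, Suc 0)) (m - 1)) = (if q = j \<and> c = Suc b then 1 else 0)"
    proof cases
      case 1
      then have "?h (Var (q, c)) = monom (Var (i, Suc 0)) (c - 1)"
        using i block_distinct(1) by (simp add: eval_hom_Var)
      then show ?thesis using 1 ij by (simp only: Mon mixed_coeff_monom if_False simp_thms)
    next
      case 2
      then have "?h (Var (q, c)) = monom (Var (j, Suc 0)) (c - 1)"
        using j by (simp add: eval_hom_Var monom_altdef)
      moreover have "c - 1 + (m - 1) = k \<longleftrightarrow> c = Suc b" using c m by auto
      ultimately show ?thesis using 2 by (simp only: Mon mixed_coeff_monom simp_thms)
    next
      case 3
      then have "?h (Var (q, c)) = 0" by (simp add: eval_hom_Var)
      then show ?thesis using 3 by (simp add: Mon)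
    qed
    then show "lookup r t * mixed_coeff (?h (Mon t) * monom (Var (i, Suc 0)) (m - 1)) =
        (if t = single (j, Suc b) 1 then lookup r t else 0)"
      using iff by simp
  qed
  also have "\<dots> = lookup r (single (j, Suc b) 1)"
    by (subst sum.delta) (auto simp: in_keys_iff)
  finally show ?thesis .
qed

end

text \<open>Of two forms in the gap, one is raised to t^g if the total exponent allows it; otherwise
  one is lowered to t^(d-1), and the other has room because the total is below \<open>g\<close>.
  Hence only linear terms matter modulo such an ideal.\<close>

lemma gap_quadratic:
  assumes g: "1 \<le> g" "\<And>j. is_scroll j \<Longrightarrow> g \<le> len j \<and> 1 \<le> d j" and v: "v \<in> V" "w \<in> V"
  shows "Var v * Var w \<in> det_span X (gap_profile g d)"
proof -
  obtain i a j b where v': "Var v = form 0 i a" "a \<le> len i" "i < N" and w': "Var w = form 0 j b" "b \<le> len j" "j < N"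
    using Var_form_0 V_N v by (metis surj_pair)
  consider "is_scroll i \<longrightarrow> g \<le> a \<or> a < d i" | "is_scroll j \<longrightarrow> g \<le> b \<or> b < d j"
    | "is_scroll i" "is_scroll j" "d i \<le> a" "a < g" "b < g" "g \<le> a + b" | "is_scroll i" "is_scroll j" "d i \<le> a" "a < g" "b < g" "a + b < g"
    by linarith
  then have "form 0 i a * form 0 j b \<in> det_span X (gap_profile g d)"
  proof cases
    case 1
    then show ?thesis using v' by (intro span_scale_right gap_in) auto
  next
    case 2
    then show ?thesis using w' by (intro idl.span_scale gap_in) auto
  next
    case 3
    have "form 0 i (a + (g - a)) * form 0 j (b - (g - a)) \<in> det_span X (gap_profile g d)"
      using 3 g(2)[of i] v' by (intro span_scale_right gap_in) auto
    then show ?thesis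
      by (rule slide_in[OF at_point_simps(2)[OF 3(1)] at_point_simps(2)[OF 3(2)], rotated -1])
        (use 3 g(2)[of i] w' in auto)
  next
    case 4
    define s where "s = Suc a - d i"
    have "form 0 j (b + s) * form 0 i (a - s) \<in> det_span X (gap_profile g d)"
      using 4 g(2)[of i] v' by (intro idl.span_scale gap_in) (auto simp: s_def)
    then have "form 0 j b * form 0 i a \<in> det_span X (gap_profile g d)"
      by (rule slide_in[OF at_point_simps(2)[OF 4(2)] at_point_simps(2)[OF 4(1)], rotated -1])
        (use 4 g(2)[of i] g(2)[of j] v' in \<open>auto simp: s_def\<close>)
    then show ?thesis by (simp add: mult.commute)
  qed
  then show ?thesis by (simp only: v' w')
qed

text \<open>x_m Y t^b vanishes if m + b \<le> n or m + b \<ge> \<open>len i\<close>, which gives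
  \<open>d\<close> and \<open>g\<close>. Conversely, quadratic terms of \<open>r\<close> are
  absorbed by \<open>gap_quadratic\<close>, and \<open>mixed_coeff\<close> excludes linear terms in
  the gap.\<close>

theorem nil_colon_middle:
  fixes i m
  defines "g \<equiv> len i - m" defines "d \<equiv> \<lambda>j. min g (Suc (len j - m))"
  assumes i: "is_nilpotent i" "(i, m) \<in> V" and m: "\<And>j. is_scroll j \<Longrightarrow> m \<le> len j \<and> len i \<le> len j + m"
    and S: "\<And>v. v \<in> S \<Longrightarrow> is_nilpotent (fst v) \<and> fst v \<noteq> i" and r: "mpoly_vars r \<subseteq> V"
  shows "r * Var (i, m) \<in> det_span X (Var ` S) \<longleftrightarrow> r \<in> det_span X (gap_profile g d)"
proof
  have m1: "1 \<le> m" "m < len i" using i by (auto simp: V_nil)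
  have fm: "form 0 i m = Var (i, m)" using m1 i by (simp add: form_nil)
  have g1: "1 \<le> g" using m1 by (simp add: g_def)
  {
    assume "r \<in> det_span X (gap_profile g d)"
    then show "r * Var (i, m) \<in> det_span X (Var ` S)"
    proof (rule span_mult_closed)
      fix f assume "f \<in> minors2 X \<union> gap_profile g d"
      then consider "f \<in> minors2 X" | j a where "j < N" "a \<le> len j" "is_scroll j \<longrightarrow> g \<le> a \<or> a < d j" "f = form 0 j a"
        by (auto simp: gap_profile_def)
      then have "f * Var (i, m) \<in> I2"
      proof cases
        case 1
        then show ?thesis by (intro span_scale_right idl.span_base)
      next
        case 2
        from 2(1) show ?thesis
        proof (cases rule: block_cases)
          case 1
          then show ?thesis using nil_nil[OF 1 i(1), of a m] by (simp add: 2 fm)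
        next
          case s: 2
          then have "m + a \<le> len j \<or> len i \<le> m + a" using 2(3) m[OF s] by (auto simp: g_def d_def)
          then show ?thesis using nil_scr[OF i(1) s, of m a] by (simp add: 2 fm mult.commute)
        next
          case (3 l)
          then show ?thesis using nil_jor[OF i(1) 3, of m a] by (simp add: 2 fm mult.commute form_jor)
        qed
      qed
      then show "f * Var (i, m) \<in> det_span X (Var ` S)" by (rule I2_in)
    qed
  }
  assume rJ: "r * Var (i, m) \<in> det_span X (Var ` S)"
  have r0: "lookup r 0 = 0"
    by (rule det_span_lookup_1[OF rJ]) (use S in fastforce)
  have "Const (lookup r t) * Mon t \<in> det_span X (gap_profile g d)" if t: "t \<in> keys r" for t
  proof -
    have "t \<noteq> 0" using t r0 by (auto simp: in_keys_iff)
    then obtain v where v: "v \<in> keys t" by (metis all_not_in_conv keys_eq_empty)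
    have vV: "v \<in> V" using v t r by (auto simp: mpoly_vars_def)
    define t' where "t' = t - single v 1"
    have t': "t = single v 1 + t'" unfolding t'_def by (rule exp_split[OF v])
    show ?thesis
    proof (cases "t' = 0")
      case True
      then have tv: "t = single v 1" using t' by simp
      obtain j c where jc: "v = (j, c)" by fastforce
      obtain b where b: "b \<le> len j" "Var v = form 0 j b" using Var_form_0 vV jc by blast
      have jN: "j < N" using V_N vV jc by blast
      show ?thesis
      proof (cases "is_scroll j \<longrightarrow> g \<le> b \<or> b < d j")
        case True
        then have "Mon t \<in> det_span X (gap_profile g d)"
          unfolding tv Var_eq_Mon[symmetric] b(2) using b jN by (intro gap_in) auto
        then show ?thesis by (rule idl.span_scale)
      next
        case False
        then have j: "is_scroll j" "b < g" "len j < m + b" by (auto simp: d_def)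
        have "Var v = (Var (j, Suc b) :: (nat \<times> nat, 'k) mpoly)" using b j by (simp add: form_0_scr)
        then have vb: "v = (j, Suc b)"
          by (metis (no_types, lifting) mpoly_vars_simps(5) singleton_inject)
        \<comment> \<open>The product has exponent m + b, which is \<open>m - 1 + b\<close> on the
          shifted scale of \<open>eval_hom\<close>.\<close>
        have k: "len j \<le> m - 1 + b" "Suc (m - 1 + b) < len i" using j m1 by (auto simp: g_def)
        have "lookup r (single (j, Suc b) 1) = 0"
          using mixed_coeff_span[OF i(1) j(1) k rJ] mixed_coeff_mult[OF i(1) j(1) k r m1(1) refl] S j(1) block_distinct(1)
          by metis
        then show ?thesis by (simp add: tv vb idl.span_zero)
      qed
    next
      case False
      then obtain w where w: "w \<in> keys t'" by (metis all_not_in_conv keys_eq_empty)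
      moreover have "keys t \<subseteq> V" using t r by (auto simp: mpoly_vars_def)
      ultimately have wV: "w \<in> V" using keys_exp_add[of "single v 1" t'] t' by auto
      define u where "u = t' - single w 1"
      have u: "t' = single w 1 + u" unfolding u_def by (rule exp_split[OF w])
      have "Mon t = Var v * Var w * (Mon u :: (nat \<times> nat, 'k) mpoly)"
        unfolding t' u by (simp only: Mon_add Var_eq_Mon mult.assoc)
      moreover have "Var v * Var w \<in> det_span X (gap_profile g d)"
      proof (intro gap_quadratic g1 vV wV)
        fix j assume "is_scroll j"
        from m[OF this] show "g \<le> len j \<and> 1 \<le> d j" using g1 by (auto simp: g_def d_def)
      qed
      ultimately show ?thesis by (simp only: idl.span_scale span_scale_right)
    qed
  qed
  then have "(\<Sum>t\<in>keys r. Const (lookup r t) * Mon t) \<in> det_span X (gap_profile g d)" by (rule idl.span_sum)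
  then show "r \<in> det_span X (gap_profile g d)" by (simp flip: mpoly_expand)
qed

end

section \<open>The filtration\<close>

locale koszul_concat = block_concat +
  assumes nil_le_scr: "\<And>i j. is_nilpotent i \<Longrightarrow> is_scroll j \<Longrightarrow> len i \<le> 2 * len j"
begin

text \<open>A block that occurs keeps its middle variable, as \<open>nil_colon_maximal\<close> needs
  it for the removal of every other variable of the block.\<close>

definition nil_sets :: "(nat \<times> nat) set set" where
  "nil_sets = {S. S \<subseteq> V \<and> (\<forall>v\<in>S. is_nilpotent (fst v) \<and> (fst v, len (fst v) div 2) \<in> S)}"

text \<open>A scroll block is started by the profile \<open>c\<close> if some of its forms belong to the ideal, that is, if \<open>c i \<le> len i\<close>.\<close>

definition unstarted :: "(nat \<Rightarrow> nat) \<Rightarrow> bool" where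
  "unstarted c \<longleftrightarrow> (\<forall>i. is_nilpotent i \<longrightarrow> c i = 0) \<and> (\<forall>i. is_scroll i \<longrightarrow> c i = Suc (len i)) \<and>
     (\<forall>l i. is_jordan l i \<longrightarrow> c i \<le> len i)"

text \<open>Jordan blocks at other points are complete because their variables cannot be exchanged
  with scroll forms at \<open>l\<close>. The bound 1 fits the colon ideals of
  \<open>profile_colon\<close> and never exceeds the length of a block.\<close>

definition started :: "'a \<Rightarrow> (nat \<Rightarrow> nat) \<Rightarrow> bool" where
  "started l c \<longleftrightarrow> (\<forall>i. is_nilpotent i \<longrightarrow> c i = 0) \<and> (\<forall>i. is_scroll i \<longrightarrow> c i \<le> Suc (len i)) \<and>
     (\<forall>m i. is_jordan m i \<longrightarrow> c i \<le> 1 \<and> (m \<noteq> l \<longrightarrow> c i = 0))"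

definition gaps :: "nat \<Rightarrow> (nat \<Rightarrow> nat) \<Rightarrow> bool" where
  "gaps g d \<longleftrightarrow> 1 \<le> g \<and> (\<forall>i. is_scroll i \<longrightarrow> g \<le> len i \<and> d i \<le> g)"

definition family :: "(nat \<times> nat, 'a) mpoly set set" where
  "family = {Var ` S | S. S \<in> nil_sets} \<union> {profile l c | l c. unstarted c} \<union>
     {profile l c | l c. started l c} \<union> {gap_profile g d | g d. gaps g d}"

lemma familyI:
  "S \<in> nil_sets \<Longrightarrow> Var ` S \<in> family" "unstarted c \<Longrightarrow> profile l c \<in> family"
  "started l c \<Longrightarrow> profile l c \<in> family" "gaps g d \<Longrightarrow> gap_profile g d \<in> family"
  by (auto simp: family_def)

lemma family_linear: "T \<in> family \<Longrightarrow> T \<subseteq> linear_forms X"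
  by (auto simp: family_def nil_sets_def
      intro: Var_linear profile_linear[unfolded One_nat_def, THEN subsetD] gap_profile_linear[unfolded One_nat_def, THEN subsetD])

lemma started_0: "started l (\<lambda>_. 0)"
  by (simp add: started_def)

definition step :: "(nat \<times> nat, 'a) mpoly set \<Rightarrow> bool" where
  "step T \<longleftrightarrow> (\<exists>T'\<in>family. \<exists>C\<in>family. \<exists>x\<in>linear_forms X. x \<notin> det_span X {} \<and>
     det_span X T = det_span X (insert x T') \<and>
     (\<forall>r. mpoly_vars r \<subseteq> V \<longrightarrow> (r * x \<in> det_span X T' \<longleftrightarrow> r \<in> det_span X C)))"

lemma stepI:
  assumes "T' \<in> family" "C \<in> family" "x \<in> linear_forms X" "x \<notin> det_span X {}" "T = insert x T'"
    and "\<And>r. mpoly_vars r \<subseteq> V \<Longrightarrow> r * x \<in> det_span X T' \<longleftrightarrow> r \<in> det_span X C"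
  shows "step T"
  unfolding step_def using assms by blast

lemma Var_nonzero: "Var w \<notin> det_span X {}"
  using det_span_lookup_1[of 1 w "{}"] by (auto simp: lookup_one)

lemma form_nonzero:
  assumes "is_scroll q \<and> e \<le> len q \<or> is_jordan l q \<and> e < len q"
  shows "form l q e \<notin> det_span X {}"
proof (cases "is_scroll q")
  case True
  show ?thesis
  proof
    assume "form l q e \<in> det_span X {}"
    then have "0 dvd eval_hom l {q} (form l q e)"
      by (rule dvd_morph_span[OF eval_hom_morph]) (use True eval_hom_minors2_zero[of "{q}"] in auto)
    moreover have "eval_hom l {q} (form l q e) = monom (Var (q, Suc 0)) e"
      using True assms block_distinct(3) by (auto simp: eval_hom_form)
    ultimately have "Var (q, Suc 0) = (0 :: (nat \<times> nat, 'a) mpoly)" by simp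
    then show False using Var_nonzero[of "(q, Suc 0)"] by (simp add: idl.span_zero)
  qed
next
  case False
  then show ?thesis using assms Var_nonzero by (auto simp: form_jor)
qed

text \<open>This is where the length condition enters: for a = m div 2 both a and m - a are at most
  n.\<close>

lemma middle:
  assumes "is_nilpotent i" "(i, a) \<in> V"
  shows "(i, len i div 2) \<in> V"
    and "is_scroll j \<Longrightarrow> len i div 2 \<le> len j \<and> len i \<le> len j + len i div 2"
  using assms nil_le_scr[OF assms(1), of j] by (auto simp: V_nil)

text \<open>Other variables leave first, with the maximal ideal as colon; a middle variable leaves
  as the last of its block and yields a gap ideal.\<close>

lemma step_nil:
  assumes S: "S \<in> nil_sets" "S \<noteq> {}"
  shows "step (Var ` S)"
proof -
  have lin: "Var v \<in> linear_forms X" if "v \<in> S" for v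
    using that S(1) by (auto simp: nil_sets_def intro!: Var_linear)
  have ins: "Var ` S = insert (Var v) (Var ` (S - {v}))" if "v \<in> S" for v
    using that by auto
  show ?thesis
  proof (cases "\<exists>i a. (i, a) \<in> S \<and> a \<noteq> len i div 2")
    case True
    then obtain i a where ia: "(i, a) \<in> S" "a \<noteq> len i div 2" by blast
    then have i: "is_nilpotent i" "(i, a) \<in> V" "(i, len i div 2) \<in> S" using S(1) by (auto simp: nil_sets_def)
    show ?thesis
    proof (rule stepI[OF familyI(1) familyI(3)[OF started_0] lin[OF ia(1)] Var_nonzero ins[OF ia(1)]])
      show "S - {(i, a)} \<in> nil_sets" using S(1) ia(2) by (auto simp: nil_sets_def)
      fix r :: "(nat \<times> nat, 'a) mpoly" assume "mpoly_vars r \<subseteq> V"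
      then show "r * Var (i, a) \<in> det_span X (Var ` (S - {(i, a)})) \<longleftrightarrow> r \<in> det_span X (profile 0 (\<lambda>_. 0))"
        using i ia middle[OF i(1,2)] by (intro nil_colon_maximal[where m = "len i div 2"]) auto
    qed
  next
    case False
    then have all: "a = len i div 2" if "(i, a) \<in> S" for i a using that by blast
    obtain v where v: "v \<in> S" using S(2) by blast
    define i where "i = fst v"
    define m where "m = len i div 2"
    have vi: "v = (i, m)" using v all[of i "snd v"] by (simp add: i_def m_def prod_eq_iff)
    have i: "is_nilpotent i" "(i, m) \<in> V" using S(1) v vi by (auto simp: nil_sets_def)
    define g d where "g = len i - m" and "d = (\<lambda>j. min g (Suc (len j - m)))"
    have fst: "fst w \<noteq> i" if "w \<in> S - {v}" for w
      using that all[of "fst w" "snd w"] by (cases w) (auto simp: vi m_def)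
    have mm: "is_scroll j \<Longrightarrow> m \<le> len j \<and> len i \<le> len j + m" for j
      using middle(2)[OF i] unfolding m_def .
    show ?thesis
    proof (rule stepI[OF familyI(1) familyI(4) lin[OF v] Var_nonzero ins[OF v]])
      show "S - {v} \<in> nil_sets" using S(1) fst by (auto simp: nil_sets_def vi)
      have "1 \<le> g" using i by (auto simp: V_nil g_def)
      moreover have "g \<le> len j \<and> d j \<le> g" if "is_scroll j" for j
        using mm[OF that] by (auto simp: g_def d_def)
      ultimately show "gaps g d" by (simp add: gaps_def)
      fix r :: "(nat \<times> nat, 'a) mpoly" assume r: "mpoly_vars r \<subseteq> V"
      have "is_nilpotent (fst w) \<and> fst w \<noteq> i" if "w \<in> S - {v}" for w
        using fst[OF that] that S(1) by (auto simp: nil_sets_def)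
      then show "r * Var v \<in> det_span X (Var ` (S - {v})) \<longleftrightarrow> r \<in> det_span X (gap_profile g d)"
        unfolding vi g_def d_def using nil_colon_middle[OF i mm _ r, of "S - {(i, m)}"] vi by simp
    qed
  qed
qed

lemma step_profile:
  assumes q: "is_scroll q \<or> is_jordan l q" "q < N" "c q = e" "is_scroll q \<and> e \<le> len q \<or> is_jordan l q \<and> e < len q"
    and T': "profile l (c(q := Suc e)) \<in> family" and C: "C \<in> family"
    and col: "\<And>r. mpoly_vars r \<subseteq> V \<Longrightarrow> r * form l q e \<in> det_span X (profile l (c(q := Suc e))) \<longleftrightarrow> r \<in> det_span X C"
  shows "step (profile l c)"
proof (rule stepI[OF T' C form_linear[OF q(2)] form_nonzero[OF q(4)] _ col])
  have "c = c(q := Suc e, q := e)" using q(3) by auto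
  then show "profile l c = insert (form l q e) (profile l (c(q := Suc e)))"
    using profile_insert[of q "c(q := Suc e)" e l] q(2,4) by auto
qed

lemma step_unstarted:
  assumes c: "unstarted c" and ne: "det_span X (profile l c) \<noteq> det_span X {}"
  shows "step (profile l c)"
proof (cases "\<exists>q m. is_jordan m q \<and> c q < len q")
  case True
  then obtain q m where q: "is_jordan m q" "c q < len q" by blast
  \<comment> \<open>No scroll form occurs, so \<open>l\<close> is immaterial and can be replaced by
    the eigenvalue of the chosen Jordan block.\<close>
  have "form l i a = form m i a" if "i < N" "c i \<le> a" "a \<le> len i" for i a
    using that(1) c that(2,3) by (cases rule: block_cases) (auto simp: form_nil form_jor unstarted_def)
  then have "profile l c = profile m c" unfolding profile_def by (metis (no_types, lifting))
  moreover have "step (profile m c)"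
  proof (rule step_profile[where e = "c q" and q = q and l = m and c = c, OF _ _ refl])
    show "profile m (c(q := Suc (c q))) \<in> family"
      using c q block_distinct(2,3)[of q] by (intro familyI(2)) (auto simp: unstarted_def)
    fix r :: "(nat \<times> nat, 'a) mpoly" assume r: "mpoly_vars r \<subseteq> V"
    show "r * form m q (c q) \<in> det_span X (profile m (c(q := Suc (c q)))) \<longleftrightarrow> r \<in> det_span X (profile m
        (\<lambda>i. if is_nilpotent i \<or> \<not> at_point m i \<or> (c(q := Suc (c q))) i \<le> c q \<and> (c(q := Suc (c q))) i \<le> len i then 0 else 1))"
      by (rule profile_colon[OF _ _ _ _ _ _ r])
        (use c q block_distinct(2,3)[of q] in \<open>auto simp: unstarted_def\<close>)
  qed (use q in \<open>auto simp: is_jordan_def started_def at_point_simps intro!: familyI(3)\<close>)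
  ultimately show ?thesis by simp
next
  case False
  \<comment> \<open>The Jordan blocks are exhausted, so just the nilpotent variables are
    left.\<close>
  define S where "S = {v \<in> V. is_nilpotent (fst v)}"
  have S: "S \<in> nil_sets" using middle(1) by (auto simp: nil_sets_def S_def)
  have eq: "det_span X (profile l c) = det_span X (Var ` S)"
  proof (unfold idl.span_eq, intro conjI)
    show "minors2 X \<union> profile l c \<subseteq> det_span X (Var ` S)"
    proof
      fix f assume "f \<in> minors2 X \<union> profile l c"
      then consider "f \<in> minors2 X" | i a where "i < N" "c i \<le> a" "a \<le> len i" "f = form l i a"
        by (auto simp: profile_def)
      then show "f \<in> det_span X (Var ` S)"
      proof cases
        case 2
        from 2(1) show ?thesis
        proof (cases rule: block_cases)
          case 1
          then have "f = 0 \<or> f \<in> Var ` S" using 2 by (auto simp: form_nil S_def V_nil)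
          then show ?thesis by (auto simp: idl.span_zero intro: idl.span_base)
        next
          case scroll: 2
          then show ?thesis using 2 c by (auto simp: unstarted_def)
        next
          case (3 m)
          then show ?thesis using 2 False by (auto simp: form_jor idl.span_zero)
        qed
      qed (auto intro: idl.span_base)
    qed
    show "minors2 X \<union> Var ` S \<subseteq> det_span X (profile l c)"
      using c by (auto simp: S_def unstarted_def intro!: Var_in_profile) (auto intro: idl.span_base)
  qed
  then have "S \<noteq> {}" using ne by (metis image_empty)
  from step_nil[OF S this] show ?thesis unfolding step_def eq .
qed

text \<open>Scroll blocks are emptied before any Jordan block, since the Jordan blocks at other
  points must stay complete meanwhile.\<close>

lemma step_started:
  assumes c: "started l c" and ne: "det_span X (profile l c) \<noteq> det_span X {}"
  shows "step (profile l c)"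
proof (cases "\<exists>q. is_scroll q \<and> c q \<le> len q")
  case False
  have "unstarted c"
    unfolding unstarted_def
  proof (intro conjI allI impI)
    fix m i assume "is_jordan m i"
    then show "c i \<le> len i" using c len_pos[of i] by (fastforce simp: started_def is_jordan_def)
  qed (use c False in \<open>auto simp: started_def not_le le_antisym Suc_le_eq dest: le_antisym\<close>)
  then show ?thesis using ne by (rule step_unstarted)
next
  case True
  define A where "A = {q. is_scroll q \<and> c q \<le> len q}"
  have fin: "finite A" by (rule finite_subset[of _ "{..<N}"]) (auto simp: A_def is_scroll_def)
  have "A \<noteq> {}" using True by (auto simp: A_def)
  then have "Max (c ` A) \<in> c ` A" using fin by (intro Max_in) auto
  then obtain q where q: "q \<in> A" "c q = Max (c ` A)" by auto
  \<comment> \<open>maximality of \<open>c q\<close> is needed when the last form of block \<open>q\<close> is removed\<close>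
  have mx: "c i \<le> c q" if "i \<in> A" for i using q(2) fin that by simp
  have sq: "is_scroll q" "c q \<le> len q" "q < N" using q(1) by (auto simp: A_def is_scroll_def)
  have nj: "\<not> is_nilpotent q" "\<not> is_jordan m q" for m using sq(1) block_distinct by blast+
  have T': "profile l (c(q := Suc (c q))) \<in> family"
    using c sq nj by (intro familyI(3)) (auto simp: started_def)
  show ?thesis
  proof (cases "c q < len q")
    case True
    show ?thesis
    proof (rule step_profile[where e = "c q" and q = q and l = l and c = c, OF _ sq(3) refl _ T'])
      fix r :: "(nat \<times> nat, 'a) mpoly" assume r: "mpoly_vars r \<subseteq> V"
      \<comment> \<open>The exponents of this colon ideal are 0 or 1, and 0 on Jordan blocks away
        from \<open>l\<close>, so it is again \<open>started\<close>.\<close>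
      show "r * form l q (c q) \<in> det_span X (profile l (c(q := Suc (c q)))) \<longleftrightarrow> r \<in> det_span X (profile l
          (\<lambda>i. if is_nilpotent i \<or> \<not> at_point l i \<or> (c(q := Suc (c q))) i \<le> c q \<and> (c(q := Suc (c q))) i \<le> len i then 0 else 1))"
      proof (rule profile_colon[OF _ True _ _ _ _ r])
        fix m i assume "is_jordan m i"
        then show "(c(q := Suc (c q))) i \<le> len i" using c nj len_pos[of i]
          by (fastforce simp: started_def is_jordan_def)
      qed (use c sq nj in \<open>auto simp: started_def\<close>)
    qed (use sq in \<open>auto simp: started_def at_point_simps intro!: familyI(3)\<close>)
  next
    case False
    then have e: "c q = len q" using sq by simp
    show ?thesis
    proof (rule step_profile[where e = "c q" and q = q and l = l and c = c, OF _ sq(3) refl _ T'])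
      fix r :: "(nat \<times> nat, 'a) mpoly" assume r: "mpoly_vars r \<subseteq> V"
      show "r * form l q (c q) \<in> det_span X (profile l (c(q := Suc (c q)))) \<longleftrightarrow> r \<in> det_span X (profile l
          (\<lambda>i. if is_scroll i \<and> len i < (c(q := Suc (c q))) i then Suc (len i) else 0))"
        unfolding e
      proof (rule profile_colon_fresh[OF sq(1) _ _ _ _ _ r])
        fix m i assume "is_jordan m i"
        then show "(c(q := Suc (len q))) i \<le> len i \<and> (c(q := Suc (len q))) i \<le> len q"
          using c nj len_pos[of i] len_pos[OF sq(3)] by (fastforce simp: started_def is_jordan_def)
      next
        fix i assume "is_scroll i" "(c(q := Suc (len q))) i \<le> len i"
        then show "(c(q := Suc (len q))) i \<le> len q"
          using mx[of i] e by (auto simp: A_def split: if_splits)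
      qed (use c sq nj in \<open>auto simp: started_def\<close>)
    qed (use sq in \<open>auto simp: started_def block_distinct intro!: familyI(3) dest: block_distinct\<close>)
  qed
qed

text \<open>Low forms of a block leave from the top, because a form is tied to its predecessor by
  sliding one t; Y t^0 has no predecessor and needs the other colon formula.\<close>

lemma step_gaps:
  assumes g: "gaps g d" and ne: "det_span X (gap_profile g d) \<noteq> det_span X {}"
  shows "step (gap_profile g d)"
proof (cases "\<exists>q. is_scroll q \<and> d q \<noteq> 0")
  case False
  then have eq: "gap_profile g d = profile 0 (\<lambda>i. if is_scroll i then g else 0)" by (intro gap_profile_0) blast
  have "started 0 (\<lambda>i. if is_scroll i then g else 0)"
    using g block_distinct by (auto simp: started_def gaps_def)
  then show ?thesis using ne unfolding eq by (rule step_started)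
next
  case True
  then obtain q where q: "is_scroll q" "d q \<noteq> 0" by blast
  define e where "e = d q - 1"
  have e: "d q = Suc e" "e < g" "e \<le> len q" using q g by (auto simp: e_def gaps_def)
  have g': "1 \<le> g" "\<And>i. is_scroll i \<Longrightarrow> g \<le> len i" using g by (auto simp: gaps_def)
  have qN: "q < N" using q by (simp add: is_scroll_def)
  have "d = d(q := e, q := Suc e)" using e by auto
  then have ins: "gap_profile g d = insert (form 0 q e) (gap_profile g (d(q := e)))"
    using gap_profile_insert[of q "d(q := e)" e g] q e by auto
  have T': "gap_profile g (d(q := e)) \<in> family" using g e by (intro familyI(4)) (auto simp: gaps_def)
  have nz: "form 0 q e \<notin> det_span X {}" using q e by (intro form_nonzero) simp
  show ?thesis
  proof (cases e)
    case 0
    show ?thesis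
    proof (rule stepI[OF T' _ form_linear[OF qN] nz ins])
      show "profile 0 (\<lambda>i. if is_scroll i \<and> (d(q := e)) i = 0 then g else 0) \<in> family"
        using g' block_distinct by (intro familyI(3)) (auto simp: started_def intro: le_SucI)
    qed (use gap_profile_colon_first[OF g' q(1), of "d(q := e)"] 0 in simp)
  next
    case (Suc e')
    show ?thesis
      by (rule stepI[OF T' familyI(3)[OF started_0] form_linear[OF qN] nz ins])
        (use gap_profile_colon_next[OF g'(2) q(1), of "d(q := e)" e'] Suc e in simp)
  qed
qed

theorem koszul: "\<exists>F. koszul_filtration (determinantal_ring X) (determinantal_component X) F"
proof (rule koszul_filtrationI[OF family_linear])
  show "\<exists>T\<in>family. det_span X T = det_span X {}"
    by (rule bexI[of _ "Var ` {}"]) (auto simp: nil_sets_def intro!: familyI(1)[of "{}", simplified])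
  show "\<exists>T\<in>family. det_span X T = det_span X (Var ` V)"
    using familyI(3)[OF started_0] span_maximal by blast
  fix T assume T: "T \<in> family" "det_span X T \<noteq> det_span X {}"
  from T(1) consider S where "S \<in> nil_sets" "T = Var ` S" | l c where "unstarted c" "T = profile l c"
    | l c where "started l c" "T = profile l c" | g d where "gaps g d" "T = gap_profile g d"
    unfolding family_def by blast
  then have "step T"
  proof cases
    case 1
    then have "S \<noteq> {}" using T(2) by (metis image_empty)
    then show ?thesis using step_nil 1 by simp
  next
    case 2
    then show ?thesis using step_unstarted T(2) by simp
  next
    case 3
    then show ?thesis using step_started T(2) by simp
  next
    case 4
    then show ?thesis using step_gaps T(2) by simp
  qed
  then show "\<exists>T'\<in>family. \<exists>C\<in>family. \<exists>x\<in>linear_forms X. x \<notin> det_span X {} \<and>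
      det_span X T = det_span X (insert x T') \<and>
      (\<forall>r. mpoly_vars r \<subseteq> V \<longrightarrow> (r * x \<in> det_span X T' \<longleftrightarrow> r \<in> det_span X C))"
    unfolding step_def .
qed

end

theorem theorem4p1:
  fixes bs :: "'k :: {alg_closed_field, field_char_0} block list"
  assumes "\<forall>b\<in>set bs. block_length b \<ge> 1"
    and "length_condition bs"
  shows "\<exists>F. koszul_filtration (determinantal_ring (concatenation bs))
               (determinantal_component (concatenation bs)) F"
proof -
  interpret block_concat bs by unfold_locales (rule assms(1))
  have "len i \<le> 2 * len j" if i: "is_nilpotent i" and j: "is_scroll j" for i j
  proof -
    let ?N = "{m. Nilpotent m \<in> set bs}" and ?S = "{n. Scroll n \<in> set bs}"
    have "?N \<subseteq> block_length ` set bs" "?S \<subseteq> block_length ` set bs"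
      by (force simp: image_iff)+
    then have fin: "finite ?N" "finite ?S" by (auto intro: finite_subset)
    \<comment> \<open>The two blocks show that neither set is empty, which leaves the inequality as
      the only alternative of \<open>length_condition\<close>.\<close>
    have mem: "len i \<in> ?N" "len j \<in> ?S"
      using i j by (auto simp: is_nilpotent_def is_scroll_def) (metis nth_mem)+
    then have "Max ?N \<le> 2 * Min ?S" using assms(2) by (auto simp: length_condition_def Let_def)
    moreover have "len i \<le> Max ?N" "Min ?S \<le> len j" using fin mem by auto
    ultimately show ?thesis by linarith
  qed
  then interpret koszul_concat bs by unfold_locales
  show ?thesis by (rule koszul)
qed

end
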